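(* Let $k\ge 1$ be a fixed integer and let $n$ range over the multiples of $k$ with $n/k\ge 2$. For each such $n$ let $$L=L^{(n)}=\begin{pmatrix}L_1&0&\cdots&0\\0&L_2&\cdots&0\\\vdots&\vdots&\ddots&\vdots\\0&0&\cdots&L_k\end{pmatrix}$$ be a $k$-block diagonal Laplacian matrix, where $L_1,\dots,L_k$ are independent Laplacian random matrices, each of size $(n/k)\times(n/k)$, with $L_r$ the Laplacian matrix of a real symmetric random matrix $X_r=X_r^{(n)}$. Assume all random variables are defined on the same probability space, that for each $n$ and $r$ the off-diagonal entries $\{(X_r^{(n)})_{ij}: i<j\}$ are independent (not necessarily identically distributed) with mean $0$ and variance $1$, and that for some $p>6$ $$\sup_{n,\;1\le r\le k,\; i<j}\mathbb{E}\bigl|(X_r^{(n)})_{ij}\bigr|^p<\infty .$$ Then $$\frac{\lambda_{\max}(L)}{\sqrt{n\log n}}\to\sqrt{\frac{2}{k}}$$ in probability as $n\to\infty$.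
   Context: For an $m\times m$ symmetric matrix $X=(X_{ij})$, the Laplacian matrix of $X$ is $L_X=D_X-X$, where $D_X$ is the diagonal matrix with $(D_X)_{ii}=\sum_{j=1}^m X_{ij}$. Thus $(L_X)_{ij}=-X_{ij}$ for $i\ne j$ and $(L_X)_{ii}=\sum_{j\neq i}X_{ij}$ (the diagonal of $X$ plays no role). $\lambda_{\max}(L)$ denotes the largest eigenvalue of $L$. *)

theory Defs
  imports "HOL-Probability.Probability" "Jordan_Normal_Form.Spectral_Radius"
begin

definition laplacian :: "real mat \<Rightarrow> real mat" where
  "laplacian A = mat_diag (dim_row A) (\<lambda>i. \<Sum>j<dim_col A. A $$ (i, j)) - A"

lemma laplacian_carrier [simp]: "A \<in> carrier_mat m m \<Longrightarrow> laplacian A \<in> carrier_mat m m"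
  by (auto simp: laplacian_def)

lemma laplacian_index:
  assumes A: "A \<in> carrier_mat m m" and ij: "i < m" "j < m"
  shows "laplacian A $$ (i, j) = (if i = j then \<Sum>l\<in>{..<m} - {i}. A $$ (i, l) else - A $$ (i, j))"
  using A ij by (auto simp: laplacian_def mat_diag_def sum.remove[of "{..<m}" j])

text \<open>The maximum is over the real eigenvalues. For a real symmetric matrix of positive size
  these are all the complex eigenvalues, and there is at least one.\<close>

definition lambda_max :: "real mat \<Rightarrow> real" where
  "lambda_max A = Max (spectrum A)"

text \<open>The Borel sigma-algebra on real \<open>m \<times> m\<close> matrices, as the one generated by the entries.\<close>

definition mat_borel :: "nat \<Rightarrow> real mat measure" where
  "mat_borel m = vimage_algebra (carrier_mat m m)
     (\<lambda>A. \<lambda>ij\<in>{..<m} \<times> {..<m}. A $$ ij) (Pi\<^sub>M ({..<m} \<times> {..<m}) (\<lambda>_. borel))"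

lemma measurable_mat_borel_iff:
  "f \<in> measurable M (mat_borel m) \<longleftrightarrow>
     (\<forall>x\<in>space M. f x \<in> carrier_mat m m) \<and>
     (\<forall>i<m. \<forall>j<m. (\<lambda>x. f x $$ (i, j)) \<in> borel_measurable M)"
proof (intro iffI conjI ballI allI impI)
  assume f: "f \<in> measurable M (mat_borel m)"
  show "f x \<in> carrier_mat m m" if "x \<in> space M" for x
    using measurable_space[OF f that] by (simp add: mat_borel_def)
  fix i j assume ij: "i < m" "j < m"
  have "(\<lambda>A. \<lambda>ij\<in>{..<m} \<times> {..<m}. A $$ ij) \<in>
      measurable (mat_borel m) (Pi\<^sub>M ({..<m} \<times> {..<m}) (\<lambda>_. borel))"
    unfolding mat_borel_def by (rule measurable_vimage_algebra1) (auto simp: space_PiM)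
  from measurable_compose[OF f measurable_compose[OF this
      measurable_component_singleton[of "(i, j)"]]]
  show "(\<lambda>x. f x $$ (i, j)) \<in> borel_measurable M" using ij by simp
next
  assume f: "(\<forall>x\<in>space M. f x \<in> carrier_mat m m) \<and>
     (\<forall>i<m. \<forall>j<m. (\<lambda>x. f x $$ (i, j)) \<in> borel_measurable M)"
  show "f \<in> measurable M (mat_borel m)"
    unfolding mat_borel_def
    by (rule measurable_vimage_algebra2) (use f in \<open>auto intro!: measurable_restrict\<close>)
qed

text \<open>Convergence in probability to a constant. Since \<^const>\<open>measure\<close> vanishes outside the
  sigma-algebra, measurability is part of the definition.\<close>

definition converges_in_prob ::
  "'a measure \<Rightarrow> ('i \<Rightarrow> 'a \<Rightarrow> real) \<Rightarrow> real \<Rightarrow> 'i filter \<Rightarrow> bool" where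
  "converges_in_prob M Y c F \<longleftrightarrow>
     (\<forall>\<^sub>F i in F. Y i \<in> borel_measurable M) \<and>
     (\<forall>\<epsilon>>0. ((\<lambda>i. measure M {\<omega> \<in> space M. \<bar>Y i \<omega> - c\<bar> > \<epsilon>}) \<longlongrightarrow> 0) F)"

end

theory Submission
  imports Defs "HOL-Real_Asymp.Real_Asymp"
begin

text \<open>Let \<open>m = n / k\<close> and \<open>T = \<surd>(m ln m)\<close>. The quadratic form of the Laplacian of one block is
  \<open>\<Sum>\<^sub>i d\<^sub>i v\<^sub>i\<^sup>2 - v\<^sup>T X v\<close> with degrees \<open>d\<^sub>i = \<Sum>\<^sub>j X\<^sub>i\<^sub>j\<close>, so it suffices that the largest degree is
  \<open>(\<surd>2 + o(1)) T\<close> and that the off-diagonal part has norm \<open>o(T)\<close>.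

  Degrees: after truncation at \<open>m\<^bsup>1/3\<^esup>\<close> the moment generating function of a degree is Gaussian up
  to \<open>m\<^bsup>o(1)\<^esup>\<close> on the scale \<open>\<surd>(ln m / m)\<close>. Chernoff's bound gives the upper estimate,
  exponential tilting the matching lower one for the degrees of the first \<open>\<theta> m\<close> vertices, which
  are independent once the few edges among these vertices are discarded.

  Norm: the part of \<open>X\<close> bounded by a constant has norm \<open>O(\<surd>m)\<close> by Hoeffding's inequality on a
  net, and the remaining part has small variance, so the crude estimate \<open>O(\<sigma> T)\<close> of the trace
  method with \<open>ln m\<close> steps is enough.\<close>

section \<open>Quadratic forms and the largest eigenvalue\<close>

text \<open>A degree exceeds a T with probability about m^(-a^2/2), and there are m degrees, so the
  critical value is a = sqrt 2. The factor 1 / sqrt k comes from n = k m: T / sqrt (n ln n) tends to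
  1 / sqrt k, and a maximum over a fixed number of blocks does not move the limit. The truncation
  exponent 1/3 answers two demands. All of the about m^2 entries must stay below the level, which
  the moment of order p makes likely once the exponent exceeds 2/p, and 2/p < 1/3 because p > 6.
  Also the level times sqrt (ln m / m) must vanish, which holds for exponents below 1/2 and makes
  the Taylor expansion of the moment generating function accurate. For the norm, entries as large as
  m^(1/3) are out of reach of Hoeffding's inequality on a net, while crude walk counting loses a
  factor sqrt (ln m), which is exactly the order of T; only a small variance can pay for that loss.
  The estimates are uniform over all arrays with the same moment bound, because the laws of the
  entries may change with n and with the block.\<close>

definition bform :: "nat \<Rightarrow> (nat \<Rightarrow> nat \<Rightarrow> real) \<Rightarrow> (nat \<Rightarrow> real) \<Rightarrow> (nat \<Rightarrow> real) \<Rightarrow> real" where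
  "bform m a u v = (\<Sum>i<m. \<Sum>j<m. a i j * u i * v j)"

text \<open>Vectors and matrices are functions of which only the indices below \<open>m\<close>
  count, which keeps carrier conditions out of the estimates. The norm stays squared, so that
  homogeneity needs no square roots.\<close>

definition norm2 :: "nat \<Rightarrow> (nat \<Rightarrow> real) \<Rightarrow> real" where
  "norm2 m v = (\<Sum>i<m. (v i)\<^sup>2)"

abbreviation qform :: "nat \<Rightarrow> (nat \<Rightarrow> nat \<Rightarrow> real) \<Rightarrow> (nat \<Rightarrow> real) \<Rightarrow> real" where
  "qform m a v \<equiv> bform m a v v"

lemma norm2_nonneg [simp]: "0 \<le> norm2 m v"
  by (auto simp: norm2_def intro: sum_nonneg)

lemma norm2_scale: "norm2 m (\<lambda>i. c * v i) = c\<^sup>2 * norm2 m v"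
  by (simp add: norm2_def power_mult_distrib sum_distrib_left)

lemma norm2_component: "i < m \<Longrightarrow> (v i)\<^sup>2 \<le> norm2 m v"
  unfolding norm2_def by (rule member_le_sum) auto

lemma norm2_add_diff: "norm2 m (\<lambda>i. u i + v i) + norm2 m (\<lambda>i. u i - v i) = 2 * norm2 m u + 2 * norm2 m v"
  unfolding norm2_def sum.distrib[symmetric] sum_distrib_left
  by (intro sum.cong) (auto simp: power2_eq_square algebra_simps)

lemma norm2_unit_vector: "i < m \<Longrightarrow> norm2 m (\<lambda>l. if l = i then 1 else 0) = 1"
  by (simp add: norm2_def if_distrib[of "\<lambda>x. x\<^sup>2"] cong: if_cong)

lemma norm2_cong: "(\<And>i. i < m \<Longrightarrow> u i = v i) \<Longrightarrow> norm2 m u = norm2 m v"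
  by (simp add: norm2_def)

lemma bform_cong:
  "(\<And>i j. i < m \<Longrightarrow> j < m \<Longrightarrow> a i j * u i * v j = b i j * u' i * v' j) \<Longrightarrow> bform m a u v = bform m b u' v'"
  by (auto simp: bform_def intro!: sum.cong)

lemma bform_scale: "bform m a (\<lambda>i. c * u i) (\<lambda>i. d * v i) = c * d * bform m a u v"
  by (simp add: bform_def sum_distrib_left mult_ac)

lemma bform_add_left: "bform m a (\<lambda>i. u i + u' i) v = bform m a u v + bform m a u' v"
  by (simp add: bform_def sum.distrib algebra_simps)

lemma bform_add_right: "bform m a u (\<lambda>i. v i + v' i) = bform m a u v + bform m a u v'"
  by (simp add: bform_def sum.distrib algebra_simps)

lemma bform_diff_left: "bform m a (\<lambda>i. u i - u' i) v = bform m a u v - bform m a u' v"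
  by (simp add: bform_def sum_subtractf algebra_simps)

lemma bform_diff_right: "bform m a u (\<lambda>i. v i - v' i) = bform m a u v - bform m a u v'"
  by (simp add: bform_def sum_subtractf algebra_simps)

lemma bform_commute:
  assumes "\<And>i j. i < m \<Longrightarrow> j < m \<Longrightarrow> a i j = a j i"
  shows "bform m a u v = bform m a v u"
proof -
  have "bform m a u v = (\<Sum>j<m. \<Sum>i<m. a i j * u i * v j)"
    unfolding bform_def by (rule sum.swap)
  also have "\<dots> = bform m a v u"
    unfolding bform_def using assms by (intro sum.cong) (auto simp: mult_ac)
  finally show ?thesis .
qed

text \<open>Termwise from 2 |x y| <= x^2 + y^2. Crude, but enough to make suprema of forms finite
  and to control the deterministic bias left by truncation.\<close>

lemma abs_qform_le: "\<bar>qform m a v\<bar> \<le> (\<Sum>i<m. \<Sum>j<m. \<bar>a i j\<bar>) * norm2 m v"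
proof -
  have *: "\<bar>v i * v j\<bar> \<le> norm2 m v" if "i < m" "j < m" for i j
  proof -
    have "0 \<le> (\<bar>v i\<bar> - \<bar>v j\<bar>)\<^sup>2" by simp
    then have "2 * \<bar>v i * v j\<bar> \<le> (v i)\<^sup>2 + (v j)\<^sup>2"
      by (simp add: power2_eq_square algebra_simps abs_mult)
    then show ?thesis using norm2_component[OF that(1), of v] norm2_component[OF that(2), of v] by linarith
  qed
  have "\<bar>qform m a v\<bar> \<le> (\<Sum>i<m. \<Sum>j<m. \<bar>a i j * v i * v j\<bar>)"
    unfolding bform_def by (rule order_trans[OF sum_abs sum_mono[OF sum_abs]])
  also have "\<dots> \<le> (\<Sum>i<m. \<Sum>j<m. \<bar>a i j\<bar> * norm2 m v)"
    using * by (intro sum_mono) (auto simp: abs_mult mult.assoc intro!: mult_left_mono)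
  finally show ?thesis by (simp add: sum_distrib_right)
qed

lemma abs_qform_le_sum: "norm2 m v = 1 \<Longrightarrow> \<bar>qform m a v\<bar> \<le> (\<Sum>i<m. \<Sum>j<m. \<bar>a i j\<bar>)"
  using abs_qform_le[of m a v] by simp

lemma bdd_above_abs_qform: "bdd_above {\<bar>qform m a v\<bar> | v. norm2 m v = 1}"
  using abs_qform_le_sum by (intro bdd_aboveI[of _ "\<Sum>i<m. \<Sum>j<m. \<bar>a i j\<bar>"]) blast

lemma cauchy_schwarz_row:
  "(\<Sum>j<m. b j * v j)\<^sup>2 \<le> (\<Sum>j<m. (b j)\<^sup>2) * norm2 m v" for b v :: "nat \<Rightarrow> real"
  unfolding norm2_def by (rule Cauchy_Schwarz_ineq_sum)

lemma mult_mat_vec_index: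
  fixes A :: "real mat"
  assumes "A \<in> carrier_mat m m" "i < m"
  shows "(A *\<^sub>v vec m v) $ i = (\<Sum>j<m. A $$ (i, j) * v j)"
  using assms by (simp add: scalar_prod_def atLeast0LessThan)

text \<open>Positivity is tested at v - w / K', where w = P v and K' bounds the form. This gives |P
  v|^2 <= K' (v, P v), and the assumed bound of |v| by |P v| turns it into coercivity.\<close>

lemma psd_coercive:
  fixes p :: "nat \<Rightarrow> nat \<Rightarrow> real"
  assumes sym: "\<And>i j. i < m \<Longrightarrow> j < m \<Longrightarrow> p i j = p j i"
    and psd: "\<And>v. 0 \<le> qform m p v"
    and inv: "\<And>v. norm2 m v \<le> K * norm2 m (\<lambda>i. \<Sum>j<m. p i j * v j)" and "0 \<le> K"
  shows "\<exists>\<kappa>>0. \<forall>v. \<kappa> * norm2 m v \<le> qform m p v"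
proof -
  define K' where "K' = (\<Sum>i<m. \<Sum>j<m. \<bar>p i j\<bar>) + 1"
  have K': "K' > 0" unfolding K'_def by (smt (verit) sum_nonneg abs_ge_zero)
  have main: "norm2 m v \<le> K * K' * qform m p v" for v
  proof -
    define w where "w = (\<lambda>i. \<Sum>j<m. p i j * v j)"
    define s where "s = 1 / K'"
    have "(\<Sum>j<m. p i j * w i * v j) = w i * w i" for i
    proof -
      have "(\<Sum>j<m. p i j * w i * v j) = w i * (\<Sum>j<m. p i j * v j)"
        by (simp add: sum_distrib_left mult_ac)
      then show ?thesis by (simp only: w_def)
    qed
    then have bw: "bform m p w v = norm2 m w"
      unfolding bform_def norm2_def by (simp only: power2_eq_square)
    have qw: "qform m p w \<le> K' * norm2 m w"
      using abs_qform_le[of m p w] unfolding K'_def by (simp add: algebra_simps) (smt (verit) norm2_nonneg)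
    have "0 \<le> qform m p (\<lambda>i. v i - s * w i)" by (rule psd)
    also have "\<dots> = qform m p v - 2 * s * bform m p w v + s\<^sup>2 * qform m p w"
    proof -
      have "bform m p (\<lambda>i. s * w i) v = s * bform m p w v"
        using bform_scale[of m p s w 1 v] by simp
      moreover have "bform m p v (\<lambda>i. s * w i) = bform m p (\<lambda>i. s * w i) v"
        by (rule bform_commute) (rule sym)
      moreover have "bform m p (\<lambda>i. s * w i) (\<lambda>i. s * w i) = s\<^sup>2 * qform m p w"
        by (simp only: bform_scale power2_eq_square)
      ultimately show ?thesis by (simp only: bform_diff_left bform_diff_right)
    qed
    also have "\<dots> \<le> qform m p v - 2 * s * norm2 m w + s\<^sup>2 * (K' * norm2 m w)"
      using qw by (simp add: bw mult_left_mono)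
    also have "\<dots> = qform m p v - norm2 m w / K'"
      using K' by (simp add: s_def power2_eq_square field_simps)
    finally have "norm2 m w \<le> K' * qform m p v" using K' by (simp add: field_simps)
    then have "K * norm2 m w \<le> K * (K' * qform m p v)" using \<open>0 \<le> K\<close> by (rule mult_left_mono)
    then show ?thesis using inv[of v] unfolding w_def by (simp add: mult.assoc)
  qed
  have "1 / (K * K' + 1) * norm2 m v \<le> qform m p v" for v
  proof -
    have "norm2 m v \<le> (K * K' + 1) * qform m p v" using main[of v] psd[of v] by (simp add: algebra_simps)
    moreover have "K * K' + 1 > 0" using K' \<open>0 \<le> K\<close> by (smt (verit) mult_nonneg_nonneg)
    ultimately show ?thesis by (simp add: field_simps)
  qed
  moreover have "1 / (K * K' + 1) > 0" using K' \<open>0 \<le> K\<close> by (smt (verit) mult_nonneg_nonneg divide_pos_pos)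
  ultimately show ?thesis by blast
qed

lemma qform_le_of_unit:
  assumes "\<And>u. norm2 m u = 1 \<Longrightarrow> qform m a u \<le> c"
  shows "qform m a v \<le> c * norm2 m v"
proof (cases "norm2 m v = 0")
  case True
  then have "\<And>i. i < m \<Longrightarrow> v i = 0" using norm2_component[of _ m v] by fastforce
  then show ?thesis using True by (simp add: bform_def)
next
  case False
  define t where "t = 1 / sqrt (norm2 m v)"
  have t: "t\<^sup>2 * norm2 m v = 1" using False by (simp add: t_def power_divide)
  then have "qform m a (\<lambda>i. t * v i) \<le> c" by (intro assms) (simp add: norm2_scale)
  then have "t\<^sup>2 * qform m a v \<le> c * (t\<^sup>2 * norm2 m v)" using t
    by (simp add: bform_scale power2_eq_square)
  moreover have "t\<^sup>2 > 0" using False by (simp add: t_def)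
  ultimately show ?thesis by (simp add: mult.left_commute)
qed

lemma abs_qform_le_of_unit:
  assumes "\<And>u. norm2 m u = 1 \<Longrightarrow> \<bar>qform m a u\<bar> \<le> c"
  shows "\<bar>qform m a v\<bar> \<le> c * norm2 m v"
proof -
  have neg: "qform m (\<lambda>i j. - a i j) u = - qform m a u" for u
    by (simp add: bform_def sum_negf)
  have "qform m a v \<le> c * norm2 m v"
    by (rule qform_le_of_unit) (use assms in fastforce)
  moreover have "qform m (\<lambda>i j. - a i j) v \<le> c * norm2 m v"
    by (rule qform_le_of_unit) (use assms neg in fastforce)
  ultimately show ?thesis using neg[of v] by linarith
qed

text \<open>The supremum of the Rayleigh quotient is an eigenvalue: otherwise the form
  \<open>P = c I - A\<close> is positive semidefinite and invertible, hence coercive.\<close>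

lemma spectrum_sym_mat_sup:
  fixes A :: "real mat"
  assumes A: "A \<in> carrier_mat m m" and m: "m > 0"
    and sym: "\<And>i j. i < m \<Longrightarrow> j < m \<Longrightarrow> A $$ (i, j) = A $$ (j, i)"
  shows "\<exists>c\<in>spectrum A. \<forall>v. qform m (\<lambda>i j. A $$ (i, j)) v \<le> c * norm2 m v"
proof -
  let ?a = "\<lambda>i j. A $$ (i, j)"
  define S where "S = {qform m ?a v | v. norm2 m v = 1}"
  define c where "c = Sup S"
  have ne: "S \<noteq> {}" unfolding S_def using norm2_unit_vector[OF m] by blast
  have "x \<le> (\<Sum>i<m. \<Sum>j<m. \<bar>A $$ (i, j)\<bar>)" if "x \<in> S" for x
    using that abs_qform_le_sum[of m _ ?a] unfolding S_def by (auto simp: abs_le_iff)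
  then have bdd: "bdd_above S" by (rule bdd_aboveI)
  have le: "qform m ?a v \<le> c * norm2 m v" for v
    by (rule qform_le_of_unit) (auto simp: c_def S_def intro!: cSup_upper bdd[unfolded S_def])
  have "eigenvalue A c"
  proof (rule ccontr)
    assume "\<not> eigenvalue A c"
    then have "det (char_matrix A c) \<noteq> 0" using eigenvalue_det[OF A] by simp
    moreover have C: "char_matrix A c \<in> carrier_mat m m" using A by (simp add: char_matrix_def)
    ultimately obtain B where B: "B \<in> carrier_mat m m" and BC: "B * char_matrix A c = 1\<^sub>m m"
      using det_non_zero_imp_unit[OF C, of undefined] by (auto simp: Units_def ring_mat_def)
    define p where "p = (\<lambda>i j. (if i = j then c else 0) - A $$ (i, j))"
    \<comment> \<open>The squared Frobenius norm of the inverse: by Cauchy-Schwarz in each row it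
      bounds |v|^2 by a multiple of |P v|^2.\<close>
    define K where "K = (\<Sum>i<m. \<Sum>j<m. (B $$ (i, j))\<^sup>2)"
    have Cij: "char_matrix A c $$ (i, j) = - p i j" if "i < m" "j < m" for i j
      using A that by (auto simp: char_matrix_def p_def)
    have inv: "norm2 m v \<le> K * norm2 m (\<lambda>i. \<Sum>j<m. p i j * v j)" for v
    proof -
      let ?w = "\<lambda>i. \<Sum>j<m. p i j * v j"
      have Cv: "char_matrix A c *\<^sub>v vec m v = vec m (\<lambda>i. - ?w i)"
        using C by (intro eq_vecI) (auto simp: mult_mat_vec_index[OF C] Cij sum_negf[symmetric] simp del: index_mult_mat_vec)
      have "vec m v = (B * char_matrix A c) *\<^sub>v vec m v" using BC by simp
      also have "\<dots> = B *\<^sub>v vec m (\<lambda>i. - ?w i)"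
        using B C Cv by (subst assoc_mult_mat_vec[of _ m m _ m]) auto
      finally have vi: "v i = (\<Sum>j<m. B $$ (i, j) * - ?w j)" if "i < m" for i
        using that mult_mat_vec_index[OF B that] by (metis (no_types, lifting) index_vec sum.cong)
      have "(v i)\<^sup>2 \<le> (\<Sum>j<m. (B $$ (i, j))\<^sup>2) * norm2 m ?w" if "i < m" for i
      proof -
        have "(v i)\<^sup>2 = (\<Sum>j<m. B $$ (i, j) * - ?w j)\<^sup>2" by (rule arg_cong[OF vi[OF that]])
        also have "\<dots> \<le> (\<Sum>j<m. (B $$ (i, j))\<^sup>2) * norm2 m (\<lambda>j. - ?w j)" by (rule cauchy_schwarz_row)
        finally show ?thesis by (simp only: norm2_def power2_minus)
      qed
      then have "norm2 m v \<le> (\<Sum>i<m. (\<Sum>j<m. (B $$ (i, j))\<^sup>2) * norm2 m ?w)"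
        unfolding norm2_def[of m v] by (intro sum_mono) auto
      then show ?thesis by (simp add: K_def sum_distrib_right)
    qed
    have qp: "qform m p v = c * norm2 m v - qform m ?a v" for v
    proof -
      have "qform m p v = (\<Sum>i<m. (\<Sum>j<m. (if i = j then c * v i * v j else 0)) - (\<Sum>j<m. A $$ (i, j) * v i * v j))"
        unfolding bform_def p_def sum_subtractf[symmetric] by (intro sum.cong) (auto simp: algebra_simps)
      also have "\<dots> = c * norm2 m v - qform m ?a v"
        by (simp add: sum_subtractf bform_def norm2_def sum_distrib_left power2_eq_square mult.assoc)
      finally show ?thesis .
    qed
    have "\<exists>\<kappa>>0. \<forall>v. \<kappa> * norm2 m v \<le> qform m p v"
    proof (rule psd_coercive[OF _ _ inv])
      show "p i j = p j i" if "i < m" "j < m" for i j using sym[OF that] by (simp add: p_def)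
      show "0 \<le> qform m p v" for v using le[of v] by (simp add: qp)
      show "0 \<le> K" by (simp add: K_def sum_nonneg)
    qed
    then obtain \<kappa> where \<kappa>: "\<kappa> > 0" "\<And>v. \<kappa> * norm2 m v \<le> qform m p v" by blast
    \<comment> \<open>Coercivity of c I - A makes c - \<kappa> an upper bound of the Rayleigh
      quotients too, although c is the least one.\<close>
    have "c \<le> c - \<kappa>" unfolding c_def
    proof (rule cSup_least[OF ne])
      fix x assume "x \<in> S"
      then obtain v where "norm2 m v = 1" "x = qform m ?a v" by (auto simp: S_def)
      then show "x \<le> Sup S - \<kappa>" using \<kappa>(2)[of v] by (simp add: qp c_def)
    qed
    then show False using \<kappa>(1) by simp
  qed
  then show ?thesis using le by (auto simp: spectrum_def)
qed

lemma lambda_max_mem_spectrum: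
  fixes A :: "real mat"
  assumes A: "A \<in> carrier_mat m m" and m: "m > 0"
    and sym: "\<And>i j. i < m \<Longrightarrow> j < m \<Longrightarrow> A $$ (i, j) = A $$ (j, i)"
  shows "lambda_max A \<in> spectrum A"
proof -
  from spectrum_sym_mat_sup[OF assms] have "spectrum A \<noteq> {}" by blast
  then show ?thesis unfolding lambda_max_def using Max_in[OF card_finite_spectrum(1)[OF A]] by blast
qed

text \<open>One direction uses that some eigenvalue dominates the form, the other evaluates the form
  at an eigenvector for \<open>lambda_max A\<close>. It lets the random estimates speak of forms
  instead of eigenvalues.\<close>

lemma lambda_max_le_iff:
  fixes A :: "real mat"
  assumes A: "A \<in> carrier_mat m m" and m: "m > 0"
    and sym: "\<And>i j. i < m \<Longrightarrow> j < m \<Longrightarrow> A $$ (i, j) = A $$ (j, i)"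
  shows "lambda_max A \<le> c \<longleftrightarrow> (\<forall>v. qform m (\<lambda>i j. A $$ (i, j)) v \<le> c * norm2 m v)"
proof
  assume le: "lambda_max A \<le> c"
  from spectrum_sym_mat_sup[OF assms] obtain d where d: "d \<in> spectrum A"
    "\<And>v. qform m (\<lambda>i j. A $$ (i, j)) v \<le> d * norm2 m v" by blast
  have "d \<le> c" using Max_ge[OF card_finite_spectrum(1)[OF A] d(1)] le by (simp add: lambda_max_def)
  then show "\<forall>v. qform m (\<lambda>i j. A $$ (i, j)) v \<le> c * norm2 m v"
    using d(2) by (meson mult_right_mono norm2_nonneg order_trans)
next
  assume all: "\<forall>v. qform m (\<lambda>i j. A $$ (i, j)) v \<le> c * norm2 m v"
  from lambda_max_mem_spectrum[OF assms] obtain x where x: "x \<in> carrier_vec m" "x \<noteq> 0\<^sub>v m"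
    "A *\<^sub>v x = lambda_max A \<cdot>\<^sub>v x"
    using A by (auto simp: spectrum_def eigenvalue_def eigenvector_def)
  define v where "v = (\<lambda>i. x $ i)"
  have xv: "x = vec m v" using x(1) by (auto simp: v_def)
  have row: "(\<Sum>j<m. A $$ (i, j) * v j) = lambda_max A * v i" if "i < m" for i
  proof -
    have "(A *\<^sub>v vec m v) $ i = (lambda_max A \<cdot>\<^sub>v vec m v) $ i" using x(3) by (simp only: xv)
    then show ?thesis using that A by (simp only: mult_mat_vec_index[OF A that]) simp
  qed
  have "qform m (\<lambda>i j. A $$ (i, j)) v = (\<Sum>i<m. v i * (\<Sum>j<m. A $$ (i, j) * v j))"
    unfolding bform_def by (intro sum.cong refl) (simp add: sum_distrib_left mult_ac)
  also have "\<dots> = (\<Sum>i<m. v i * (lambda_max A * v i))" by (intro sum.cong) (auto simp: row)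
  also have "\<dots> = lambda_max A * norm2 m v"
    by (simp add: norm2_def sum_distrib_left power2_eq_square mult_ac)
  finally have "lambda_max A * norm2 m v \<le> c * norm2 m v" using all by metis
  moreover have "norm2 m v > 0"
  proof -
    obtain i where "i < m" "x $ i \<noteq> 0" using x(1,2) by (metis carrier_vecD eq_vecI index_zero_vec)
    then show ?thesis using norm2_component[of i m v] by (auto simp: v_def intro: less_le_trans[of _ "(x $ i)\<^sup>2"])
  qed
  ultimately show "lambda_max A \<le> c" by simp
qed

text \<open>Tested on a coordinate vector. This is how one large degree forces a large
  eigenvalue.\<close>

lemma diag_le_lambda_max:
  fixes A :: "real mat"
  assumes A: "A \<in> carrier_mat m m" and m: "i < m"
    and sym: "\<And>i j. i < m \<Longrightarrow> j < m \<Longrightarrow> A $$ (i, j) = A $$ (j, i)"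
  shows "A $$ (i, i) \<le> lambda_max A"
proof -
  let ?v = "\<lambda>l. if l = i then 1 else 0 :: real"
  have m': "m > 0" using m by simp
  have "qform m (\<lambda>i j. A $$ (i, j)) ?v \<le> lambda_max A * norm2 m ?v"
    using lambda_max_le_iff[OF A m' sym, of "lambda_max A"] by simp
  moreover have "norm2 m ?v = 1" by (rule norm2_unit_vector[OF m])
  moreover have "qform m (\<lambda>i j. A $$ (i, j)) ?v = A $$ (i, i)"
    using m by (simp add: bform_def if_distrib[of "\<lambda>x. _ * x"] sum.If_cases cong: if_cong)
  ultimately show ?thesis by simp
qed

text \<open>By density of the rationals and homogeneity, integer vectors suffice.\<close>

lemma qform_le_iff_int:
  "(\<forall>v. qform m a v \<le> c * norm2 m v) \<longleftrightarrow>
   (\<forall>z \<in> PiE {..<m} (\<lambda>_. UNIV :: int set). qform m a (\<lambda>i. of_int (z i)) \<le> c * norm2 m (\<lambda>i. of_int (z i)))"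
  (is "_ \<longleftrightarrow> ?int")
proof
  assume all: "\<forall>v. qform m a v \<le> c * norm2 m v"
  show ?int by (intro ballI spec[OF all])
next
  assume int: ?int
  show "\<forall>v. qform m a v \<le> c * norm2 m v"
  proof
    fix v :: "nat \<Rightarrow> real"
    \<comment> \<open>Rounding down at resolution 1/k. At k = 0 division by zero yields the zero
      vector, so the inequality needs no separate case there.\<close>
    define w where "w = (\<lambda>k i. real_of_int \<lfloor>real k * v i\<rfloor> / real k)"
    have w: "(\<lambda>k. w k i) \<longlonglongrightarrow> v i" for i unfolding w_def by real_asymp
    have "qform m a (w k) \<le> c * norm2 m (w k)" for k
    proof -
      define z where "z = restrict (\<lambda>i. \<lfloor>real k * v i\<rfloor>) {..<m}"
      have "qform m a (\<lambda>i. of_int (z i)) \<le> c * norm2 m (\<lambda>i. of_int (z i))"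
        using int by (rule bspec) (unfold z_def, rule restrict_PiE_iff[THEN iffD2], simp)
      then have "(1 / real k)\<^sup>2 * qform m a (\<lambda>i. of_int (z i)) \<le> (1 / real k)\<^sup>2 * (c * norm2 m (\<lambda>i. of_int (z i)))"
        by (rule mult_left_mono) simp
      also have "(1 / real k)\<^sup>2 * qform m a (\<lambda>i. of_int (z i)) = qform m a (w k)"
        unfolding power2_eq_square bform_scale[symmetric] by (rule bform_cong) (simp add: w_def z_def)
      also have "(1 / real k)\<^sup>2 * (c * norm2 m (\<lambda>i. of_int (z i))) = c * norm2 m (w k)"
        unfolding mult.left_commute[of _ c] norm2_scale[symmetric]
        by (rule arg_cong[of _ _ "(*) c"], rule norm2_cong) (simp add: w_def z_def)
      finally show ?thesis .
    qed
    moreover have "(\<lambda>k. qform m a (w k)) \<longlonglongrightarrow> qform m a v" "(\<lambda>k. c * norm2 m (w k)) \<longlonglongrightarrow> c * norm2 m v"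
      unfolding bform_def norm2_def by (intro tendsto_intros w)+
    ultimately show "qform m a v \<le> c * norm2 m v" by (blast intro: LIMSEQ_le)
  qed
qed

text \<open>A sublevel set is cut out by one inequality per vector. Restricting to integer vectors,
  taken extensional so that they form a countable set, leaves a countable intersection of measurable
  sets.\<close>

lemma borel_measurable_lambda_max:
  assumes A: "\<And>\<omega>. \<omega> \<in> space M \<Longrightarrow> A \<omega> \<in> carrier_mat m m" and m: "m > 0"
    and sym: "\<And>\<omega> i j. \<omega> \<in> space M \<Longrightarrow> i < m \<Longrightarrow> j < m \<Longrightarrow> A \<omega> $$ (i, j) = A \<omega> $$ (j, i)"
    and meas: "\<And>i j. i < m \<Longrightarrow> j < m \<Longrightarrow> (\<lambda>\<omega>. A \<omega> $$ (i, j)) \<in> borel_measurable M"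
  shows "(\<lambda>\<omega>. lambda_max (A \<omega>)) \<in> borel_measurable M"
proof (subst borel_measurable_iff_le, intro allI)
  fix c :: real
  let ?Z = "PiE {..<m} (\<lambda>_. UNIV :: int set)"
  let ?Q = "\<lambda>z. {\<omega> \<in> space M. qform m (\<lambda>i j. A \<omega> $$ (i, j)) (\<lambda>i. of_int (z i)) \<le> c * norm2 m (\<lambda>i. of_int (z i))}"
  have "{\<omega> \<in> space M. lambda_max (A \<omega>) \<le> c} = (\<Inter>z\<in>?Z. ?Q z)"
  proof (intro equalityI subsetI)
    fix \<omega> assume "\<omega> \<in> {\<omega> \<in> space M. lambda_max (A \<omega>) \<le> c}"
    then show "\<omega> \<in> (\<Inter>z\<in>?Z. ?Q z)"
      using lambda_max_le_iff[OF A m sym, of \<omega> c] unfolding qform_le_iff_int by blast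
  next
    fix \<omega> assume *: "\<omega> \<in> (\<Inter>z\<in>?Z. ?Q z)"
    have "restrict (\<lambda>_. 0) {..<m} \<in> ?Z" by auto
    with * have "\<omega> \<in> space M" by blast
    with * show "\<omega> \<in> {\<omega> \<in> space M. lambda_max (A \<omega>) \<le> c}"
      using lambda_max_le_iff[OF A m sym, of \<omega> c] unfolding qform_le_iff_int by blast
  qed
  moreover have "(\<Inter>z\<in>?Z. ?Q z) \<in> sets M"
  proof (rule sets.countable_INT')
    show "countable ?Z" by (rule countable_PiE) auto
    show "?Z \<noteq> {}" by (simp add: PiE_eq_empty_iff)
    have "?Q z \<in> sets M" for z
      unfolding bform_def
      by (intro borel_measurable_le borel_measurable_sum borel_measurable_times meas borel_measurable_const) auto
    then show "?Q ` ?Z \<subseteq> sets M" by blast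
  qed
  ultimately show "{\<omega> \<in> space M. lambda_max (A \<omega>) \<le> c} \<in> sets M" by simp
qed

section \<open>Spectra of block diagonal matrices\<close>

lemma spectrum_four_block_diag:
  fixes A B :: "real mat"
  assumes A: "A \<in> carrier_mat a a" and B: "B \<in> carrier_mat b b"
  shows "spectrum (four_block_mat A (0\<^sub>m a b) (0\<^sub>m b a) B) = spectrum A \<union> spectrum B"
proof -
  let ?F = "four_block_mat A (0\<^sub>m a b) (0\<^sub>m b a) B"
  have F: "?F \<in> carrier_mat (a + b) (a + b)" by (rule four_block_carrier_mat[OF A B])
  have C: "char_matrix A e \<in> carrier_mat a a" "char_matrix B e \<in> carrier_mat b b" for e
    using A B by (auto simp: char_matrix_def)
  have cm: "char_matrix ?F e = four_block_mat (char_matrix A e) (0\<^sub>m a b) (0\<^sub>m b a) (char_matrix B e)"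
    (is "?l = ?r") for e
  proof (rule eq_matI)
    have r: "?r \<in> carrier_mat (a + b) (a + b)" by (rule four_block_carrier_mat[OF C])
    have l: "?l \<in> carrier_mat (a + b) (a + b)" using F by (auto simp: char_matrix_def)
    show "dim_row ?l = dim_row ?r" "dim_col ?l = dim_col ?r"
      using carrier_matD[OF l] carrier_matD[OF r] by (simp_all only:)
    fix i j
    assume "i < dim_row ?r" "j < dim_col ?r"
    then have "i < a + b" "j < a + b" unfolding carrier_matD[OF r] .
    then show "?l $$ (i, j) = ?r $$ (i, j)"
      using A B by (cases "i < a"; cases "j < a") (auto simp: char_matrix_def)
  qed
  \<comment> \<open>The determinant factors, so an eigenvalue of the whole is a root of one of the
    two factors.\<close>
  have "det (char_matrix ?F e) = det (char_matrix A e) * det (char_matrix B e)" for e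
    unfolding cm by (rule det_four_block_mat_lower_left_zero[OF C(1) _ refl C(2)]) simp
  then show ?thesis
    using eigenvalue_det[OF A] eigenvalue_det[OF B] eigenvalue_det[OF F]
    by (auto simp: spectrum_def)
qed

lemma spectrum_diag_block_mat:
  fixes As :: "real mat list"
  assumes "\<And>A. A \<in> set As \<Longrightarrow> square_mat A"
  shows "spectrum (diag_block_mat As) = (\<Union>A\<in>set As. spectrum A)"
  using assms
proof (induction As)
  case Nil
  \<comment> \<open>In dimension 0 there is no nonzero vector, hence no eigenvector, and the
    spectrum is empty like the union.\<close>
  have "carrier_vec 0 = {0\<^sub>v 0 :: real vec}" by auto
  then show ?case by (auto simp: spectrum_def eigenvalue_def eigenvector_def)
next
  case (Cons A As)
  let ?D = "diag_block_mat As"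
  have "square_mat ?D" using Cons.prems by (intro diag_block_mat_square) auto
  then have D': "dim_col ?D = dim_row ?D" by (simp only: square_mat.simps)
  then have D: "?D \<in> carrier_mat (dim_row ?D) (dim_row ?D)" by (intro carrier_matI refl)
  have "square_mat A" using Cons.prems by simp
  then have A': "dim_col A = dim_row A" by (simp only: square_mat.simps)
  then have A: "A \<in> carrier_mat (dim_row A) (dim_row A)" by (intro carrier_matI refl)
  have "spectrum (diag_block_mat (A # As)) = spectrum A \<union> spectrum ?D"
    using spectrum_four_block_diag[OF A D] by (simp only: diag_block_mat.simps Let_def A' D')
  also have "spectrum ?D = (\<Union>A\<in>set As. spectrum A)"
    by (rule Cons.IH) (use Cons.prems in simp)
  finally show ?case by simp
qed

lemma lambda_max_diag_block_mat:
  fixes A :: "nat \<Rightarrow> real mat"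
  assumes A: "\<And>r. r < k \<Longrightarrow> A r \<in> carrier_mat m m" and m: "m > 0" and k: "k > 0"
    and sym: "\<And>r i j. r < k \<Longrightarrow> i < m \<Longrightarrow> j < m \<Longrightarrow> A r $$ (i, j) = A r $$ (j, i)"
  shows "lambda_max (diag_block_mat (map A [0..<k])) = Max ((\<lambda>r. lambda_max (A r)) ` {..<k})"
proof -
  have sq: "square_mat B" if "B \<in> set (map A [0..<k])" for B
  proof -
    from that obtain r where "r < k" "B = A r" by auto
    then show ?thesis using carrier_matD[OF A] by (simp only: square_mat.simps)
  qed
  have "spectrum (diag_block_mat (map A [0..<k])) = (\<Union>B\<in>set (map A [0..<k]). spectrum B)"
    by (rule spectrum_diag_block_mat[OF sq])
  then have sp: "spectrum (diag_block_mat (map A [0..<k])) = (\<Union>r<k. spectrum (A r))"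
    by (simp only: set_map image_image set_upt atLeast0LessThan)
  have fin: "finite (spectrum (A r))" if "r < k" for r using card_finite_spectrum(1)[OF A[OF that]] .
  have mem: "lambda_max (A r) \<in> spectrum (A r)" if "r < k" for r
    by (rule lambda_max_mem_spectrum[OF A[OF that] m sym[OF that]])
  have le: "x \<le> lambda_max (A r)" if "r < k" "x \<in> spectrum (A r)" for r x
    unfolding lambda_max_def by (rule Max_ge[OF fin[OF that(1)] that(2)])
  let ?L = "(\<lambda>r. lambda_max (A r)) ` {..<k}"
  have "Max ?L \<in> ?L" using k by (intro Max_in) auto
  then obtain r where r: "r < k" "Max ?L = lambda_max (A r)" by auto
  have "Max (\<Union>r<k. spectrum (A r)) = Max ?L"
  proof (rule Max_eqI)
    show "finite (\<Union>r<k. spectrum (A r))" by (rule finite_UN_I) (simp_all add: fin)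
    show "Max ?L \<in> (\<Union>r<k. spectrum (A r))" unfolding r(2) using mem[OF r(1)] r(1) by blast
  next
    fix x assume "x \<in> (\<Union>r<k. spectrum (A r))"
    then obtain r' where r': "r' < k" "x \<in> spectrum (A r')" by blast
    then have "x \<le> lambda_max (A r')" by (rule le)
    also have "\<dots> \<le> Max ?L" using r'(1) by (intro Max_ge) auto
    finally show "x \<le> Max ?L" .
  qed
  then show ?thesis by (simp only: lambda_max_def[of "diag_block_mat (map A [0..<k])"] sp)
qed

section \<open>Symmetric arrays with bounded entries\<close>

definition upper_pairs :: "nat \<Rightarrow> (nat \<times> nat) set" where
  "upper_pairs m = {(i, j). i < j \<and> j < m}"

text \<open>Independence is available above the diagonal only, so random arrays are indexed by pairs
  i < j and symmetrised afterwards. The zero diagonal is the one left when the degrees are split off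
  the Laplacian.\<close>

definition sym_ext :: "(nat \<times> nat \<Rightarrow> real) \<Rightarrow> nat \<Rightarrow> nat \<Rightarrow> real" where
  "sym_ext z i j = (if i < j then z (i, j) else if j < i then z (j, i) else 0)"

text \<open>As the matrix is symmetric, this is the bound \<open>t\<close> on its operator
  norm.\<close>

abbreviation form_le :: "nat \<Rightarrow> (nat \<times> nat \<Rightarrow> real) \<Rightarrow> real \<Rightarrow> bool" where
  "form_le m z t \<equiv> \<forall>v. \<bar>qform m (sym_ext z) v\<bar> \<le> t * norm2 m v"

lemma sym_ext_commute: "sym_ext z i j = sym_ext z j i"
  by (auto simp: sym_ext_def)

lemma finite_upper_pairs [simp]: "finite (upper_pairs m)"
  by (rule finite_subset[of _ "{..<m} \<times> {..<m}"]) (auto simp: upper_pairs_def)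

lemma card_upper_pairs_le: "card (upper_pairs m) \<le> m * m"
proof -
  have "card (upper_pairs m) \<le> card ({..<m} \<times> {..<m})"
    by (rule card_mono) (auto simp: upper_pairs_def)
  then show ?thesis by simp
qed

lemma sum_off_diagonal:
  fixes f :: "nat \<Rightarrow> nat \<Rightarrow> real"
  assumes "\<And>i. f i i = 0" "\<And>i j. f i j = f j i"
  shows "(\<Sum>i<m. \<Sum>j<m. f i j) = 2 * (\<Sum>(i, j)\<in>upper_pairs m. f i j)"
proof -
  let ?U = "upper_pairs m" and ?g = "\<lambda>(i, j). f i j"
  have sw: "sum ?g (prod.swap ` ?U) = sum ?g ?U"
    by (subst sum.reindex) (auto simp: assms(2) intro!: sum.cong)
  have "(\<Sum>i<m. \<Sum>j<m. f i j) = sum ?g ({..<m} \<times> {..<m})"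
    by (rule sum.cartesian_product)
  also have "\<dots> = sum ?g (?U \<union> prod.swap ` ?U)"
  proof (rule sum.mono_neutral_right)
    show "\<forall>x\<in>{..<m} \<times> {..<m} - (?U \<union> prod.swap ` ?U). ?g x = 0"
    proof
      fix x assume x: "x \<in> {..<m} \<times> {..<m} - (?U \<union> prod.swap ` ?U)"
      obtain i j where ij: "x = (i, j)" by fastforce
      have "x = prod.swap (j, i)" using ij by simp
      then have "i = j" using x ij by (fastforce simp: upper_pairs_def not_less)
      then show "?g x = 0" using assms(1) ij by simp
    qed
    show "?U \<union> prod.swap ` ?U \<subseteq> {..<m} \<times> {..<m}"
      unfolding upper_pairs_def by (auto dest: less_trans)
  qed simp
  also have "\<dots> = sum ?g ?U + sum ?g (prod.swap ` ?U)"
    by (rule sum.union_disjoint) (simp, simp, auto simp: upper_pairs_def)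
  finally show ?thesis using sw by simp
qed

lemma qform_sym_ext:
  "qform m (sym_ext z) v = (\<Sum>(i, j)\<in>upper_pairs m. 2 * v i * v j * z (i, j))"
proof -
  have "qform m (sym_ext z) v = 2 * (\<Sum>(i, j)\<in>upper_pairs m. sym_ext z i j * v i * v j)"
    unfolding bform_def by (rule sum_off_diagonal) (auto simp: sym_ext_def)
  also have "\<dots> = (\<Sum>(i, j)\<in>upper_pairs m. 2 * v i * v j * z (i, j))"
    unfolding sum_distrib_left by (intro sum.cong) (auto simp: upper_pairs_def sym_ext_def)
  finally show ?thesis .
qed

text \<open>A unit vector scaled by 4 sqrt m and rounded moves by at most sqrt m in norm, so its
  norm becomes at most 5 sqrt m; hence the constant 25. Extensionality makes the set finite.\<close>

definition lattice_net :: "nat \<Rightarrow> (nat \<Rightarrow> int) set" where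
  "lattice_net m = {z \<in> PiE {..<m} (\<lambda>_. UNIV). (\<Sum>i<m. (z i)\<^sup>2) \<le> 25 * int m}"

text \<open>The vectors \<open>z / (4 \<surd>m)\<close>, \<open>z \<in> lattice_net m\<close>, form a \<open>1/4\<close>-net of the unit sphere.\<close>

lemma abs_qform_le_of_lattice_net:
  assumes m: "m > 0" and sym: "\<And>i j. i < m \<Longrightarrow> j < m \<Longrightarrow> a i j = a j i"
    and net: "\<And>z. z \<in> lattice_net m \<Longrightarrow> \<bar>qform m a (\<lambda>i. of_int (z i))\<bar> \<le> s * real m"
  shows "\<bar>qform m a v\<bar> \<le> s * norm2 m v"
proof -
  define S where "S = {\<bar>qform m a v\<bar> | v. norm2 m v = 1}"
  define A where "A = Sup S"
  have ne: "S \<noteq> {}" unfolding S_def using norm2_unit_vector[OF m] by blast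
  have bdd: "bdd_above S" unfolding S_def by (rule bdd_above_abs_qform)
  have bnd: "\<bar>qform m a v\<bar> \<le> A * norm2 m v" for v
  proof -
    have u: "\<bar>qform m a u\<bar> \<le> A" if "norm2 m u = 1" for u
      unfolding A_def by (rule cSup_upper[OF _ bdd]) (use that in \<open>auto simp: S_def\<close>)
    show ?thesis by (rule abs_qform_le_of_unit) (rule u)
  qed
  \<comment> \<open>Polarisation and the parallelogram law. The sum of squares in place of a product
    of norms is made sharp below by rescaling the two arguments.\<close>
  have polar: "\<bar>bform m a x y\<bar> \<le> A * (norm2 m x + norm2 m y) / 2" for x y
  proof -
    have "4 * bform m a x y = qform m a (\<lambda>i. x i + y i) - qform m a (\<lambda>i. x i - y i)"
      using bform_commute[of m a y x, OF sym]
      by (simp add: bform_add_left bform_add_right bform_diff_left bform_diff_right)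
    moreover have "A * norm2 m (\<lambda>i. x i + y i) + A * norm2 m (\<lambda>i. x i - y i) = A * (2 * norm2 m x + 2 * norm2 m y)"
      using norm2_add_diff[of m x y] by (metis distrib_left)
    ultimately show ?thesis
      using bnd[of "\<lambda>i. x i + y i"] bnd[of "\<lambda>i. x i - y i"] by (simp add: distrib_left)
  qed
  have step: "\<bar>qform m a v\<bar> \<le> s / 16 + 9 / 16 * A" if v: "norm2 m v = 1" for v
  proof -
    define t where "t = 4 * sqrt (real m)"
    have t: "t > 0" "t\<^sup>2 = 16 * real m" using m by (auto simp: t_def power_mult_distrib)
    define z where "z = restrict (\<lambda>i. \<lfloor>t * v i\<rfloor>) {..<m}"
    define w where "w = (\<lambda>i. (1 / t) * real_of_int (z i))"
    define e where "e = (\<lambda>i. v i - w i)"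
    have e: "(e i)\<^sup>2 \<le> 1 / (16 * real m)" if "i < m" for i
    proof -
      have "e i = (t * v i - \<lfloor>t * v i\<rfloor>) / t" using that t by (simp add: e_def w_def z_def field_simps)
      moreover have "0 \<le> t * v i - \<lfloor>t * v i\<rfloor>" "t * v i - \<lfloor>t * v i\<rfloor> \<le> 1" by linarith+
      ultimately have "(e i)\<^sup>2 \<le> (1 / t)\<^sup>2" using t(1)
        by (intro power_mono) (auto intro: divide_right_mono)
      then show ?thesis using t(2) by (simp add: power_divide)
    qed
    have ne: "norm2 m e \<le> 1 / 16"
    proof -
      have "norm2 m e \<le> (\<Sum>i<m. 1 / (16 * real m))" unfolding norm2_def by (rule sum_mono) (use e in auto)
      then show ?thesis using m by simp
    qed
    have nw: "norm2 m w \<le> 25 / 16"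
    proof -
      \<comment> \<open>The weights are those for which equality is possible at |v| = 1, |e| = 1/4,
        so the triangle inequality |w| <= 5/4 is recovered without roots. The bound 81/16 for v + w
        = 2 v - e arises in the same way from 9/4.\<close>
      have "(w i)\<^sup>2 \<le> 5 / 4 * (v i)\<^sup>2 + 5 * (e i)\<^sup>2" for i
      proof -
        have "0 \<le> (v i / 2 + 2 * e i)\<^sup>2" by simp
        then have "(v i - e i)\<^sup>2 \<le> 5 / 4 * (v i)\<^sup>2 + 5 * (e i)\<^sup>2"
          by (simp add: power2_eq_square algebra_simps)
        then show ?thesis by (simp add: e_def)
      qed
      then have "norm2 m w \<le> 5 / 4 * norm2 m v + 5 * norm2 m e"
        unfolding norm2_def sum_distrib_left sum.distrib[symmetric] by (intro sum_mono) auto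
      then show ?thesis using v ne by simp
    qed
    have nu: "norm2 m (\<lambda>i. v i + w i) \<le> 81 / 16"
    proof -
      have "(v i + w i)\<^sup>2 \<le> 9 / 2 * (v i)\<^sup>2 + 9 * (e i)\<^sup>2" for i
      proof -
        have "0 \<le> (v i + 4 * e i)\<^sup>2" by simp
        then have "(2 * v i - e i)\<^sup>2 \<le> 9 / 2 * (v i)\<^sup>2 + 9 * (e i)\<^sup>2"
          by (simp add: power2_eq_square algebra_simps)
        then show ?thesis by (simp add: e_def)
      qed
      then have "norm2 m (\<lambda>i. v i + w i) \<le> 9 / 2 * norm2 m v + 9 * norm2 m e"
        unfolding norm2_def sum_distrib_left sum.distrib[symmetric] by (intro sum_mono) auto
      then show ?thesis using v ne by simp
    qed
    have nz: "norm2 m (\<lambda>i. of_int (z i)) = t\<^sup>2 * norm2 m w"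
      unfolding w_def norm2_scale using t(1) by (simp add: power_divide)
    have "real_of_int (\<Sum>i<m. (z i)\<^sup>2) = norm2 m (\<lambda>i. of_int (z i))" by (simp add: norm2_def)
    also have "\<dots> \<le> 25 * real m" using nw m by (simp add: nz t(2))
    finally have "(\<Sum>i<m. (z i)\<^sup>2) \<le> 25 * int m" by linarith
    moreover have "z \<in> PiE {..<m} (\<lambda>_. UNIV)" unfolding z_def by (rule restrict_PiE_iff[THEN iffD2]) simp
    ultimately have "z \<in> lattice_net m" by (simp add: lattice_net_def)
    from net[OF this] have "\<bar>qform m a (\<lambda>i. of_int (z i))\<bar> \<le> s * real m" .
    then have "1 / t\<^sup>2 * \<bar>qform m a (\<lambda>i. of_int (z i))\<bar> \<le> 1 / t\<^sup>2 * (s * real m)"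
      by (rule mult_left_mono) simp
    moreover have "\<bar>qform m a w\<bar> = 1 / t\<^sup>2 * \<bar>qform m a (\<lambda>i. of_int (z i))\<bar>"
      unfolding w_def bform_scale by (simp add: abs_mult power2_eq_square)
    ultimately have qw: "\<bar>qform m a w\<bar> \<le> s / 16" using m by (simp add: t(2))
    \<comment> \<open>The factors 3 and 1/3 balance the bounds 1/4 for e and 9/4 for v + w to 3/4
      each, so that \<open>polar\<close> yields the product 9/16.\<close>
    let ?x = "\<lambda>i. 3 * e i" and ?y = "\<lambda>i. (1 / 3) * (v i + w i)"
    have "bform m a e (\<lambda>i. v i + w i) = bform m a ?x ?y" unfolding bform_scale by simp
    moreover have "\<bar>bform m a ?x ?y\<bar> \<le> A * (norm2 m ?x + norm2 m ?y) / 2" by (rule polar)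
    moreover have "norm2 m ?x + norm2 m ?y \<le> 9 / 8"
      using ne nu unfolding norm2_scale by (simp add: power_divide)
    then have "A * (norm2 m ?x + norm2 m ?y) \<le> A * (9 / 8)"
      using bnd[of v] v by (intro mult_left_mono) auto
    ultimately have be: "\<bar>bform m a e (\<lambda>i. v i + w i)\<bar> \<le> 9 / 16 * A" by linarith
    have "bform m a e (\<lambda>i. v i + w i) = qform m a v - qform m a w"
      unfolding e_def bform_diff_left bform_add_right using bform_commute[of m a w v, OF sym] by simp
    then show ?thesis using qw be by linarith
  qed
  \<comment> \<open>The difference of the form at v and at w is absorbed because 9/16 < 1. This
    gives 7 A <= s, and A <= s follows as A is nonnegative.\<close>
  have "A \<le> s / 16 + 9 / 16 * A" unfolding A_def
    by (rule cSup_least[OF ne]) (use step in \<open>auto simp: S_def A_def\<close>)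
  moreover have "0 \<le> A"
  proof -
    obtain x where "x \<in> S" using ne by blast
    then have "x \<le> A" "0 \<le> x" unfolding A_def by (auto simp: S_def intro!: cSup_upper bdd[unfolded S_def])
    then show ?thesis by simp
  qed
  ultimately have "A \<le> s" by simp
  then have "A * norm2 m v \<le> s * norm2 m v" by (intro mult_right_mono) auto
  then show ?thesis using bnd[of v] by linarith
qed

lemma sum_half_powers_le: "(\<Sum>x\<in>{-int K..int K}. (1 / 2) ^ nat \<bar>x\<bar>) \<le> (4 :: real)"
proof -
  let ?f = "\<lambda>x :: int. (1 / 2 :: real) ^ nat \<bar>x\<bar>"
  have geo: "(\<Sum>n\<le>K. (1 / 2 :: real) ^ n) \<le> 2"
    using sum_gp_basic[of "1 / 2 :: real" K] by simp
  have "{-int K..int K} \<subseteq> int ` {..K} \<union> (\<lambda>n. - int n) ` {..K}"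
  proof
    fix x assume x: "x \<in> {-int K..int K}"
    show "x \<in> int ` {..K} \<union> (\<lambda>n. - int n) ` {..K}"
    proof (cases "x \<ge> 0")
      case True
      then have "x = int (nat x)" "nat x \<in> {..K}" using x by auto
      then show ?thesis by blast
    next
      case False
      then have "x = - int (nat (- x))" "nat (- x) \<in> {..K}" using x by auto
      then show ?thesis by blast
    qed
  qed
  then have "sum ?f {-int K..int K} \<le> sum ?f (int ` {..K} \<union> (\<lambda>n. - int n) ` {..K})"
    by (intro sum_mono2) auto
  also have "\<dots> \<le> sum ?f (int ` {..K}) + sum ?f ((\<lambda>n. - int n) ` {..K})"
    by (subst sum.union_inter[symmetric]) (auto intro: sum_nonneg)
  also have "\<dots> = (\<Sum>n\<le>K. (1 / 2) ^ n) + (\<Sum>n\<le>K. (1 / 2) ^ n)"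
    by (subst (1 2) sum.reindex) (auto simp: inj_on_def)
  finally show ?thesis using geo by simp
qed

text \<open>Counting by exponential weights: since |x| <= x^2 for integers and e >= 2, each net
  point satisfies 1 <= exp (25 m) times the product of the weights 2^(-|z_i|). Summed over a box,
  these weights factor over the coordinates, and every factor is at most 4 <= e^2.\<close>

lemma card_lattice_net: "finite (lattice_net m)" "real (card (lattice_net m)) \<le> exp (27 * real m)"
proof -
  \<comment> \<open>A side length for a box containing the net; it only has to be finite, as the
    weights sum to at most 4 on any interval around 0.\<close>
  define K where "K = 25 * m"
  let ?P = "PiE {..<m} (\<lambda>_. {-int K..int K})"
  let ?f = "\<lambda>x :: int. (1 / 2 :: real) ^ nat \<bar>x\<bar>"
  have le_sq: "\<bar>x\<bar> \<le> x\<^sup>2" for x :: int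
  proof (cases "x = 0")
    case False
    then have "\<bar>x\<bar> * 1 \<le> \<bar>x\<bar> * \<bar>x\<bar>" by (intro mult_left_mono) auto
    then show ?thesis by (simp add: power2_eq_square)
  qed simp
  have sub: "lattice_net m \<subseteq> ?P"
  proof
    fix z assume z: "z \<in> lattice_net m"
    have "z i \<in> {- int K..int K}" if "i < m" for i
    proof -
      have "(z i)\<^sup>2 \<le> (\<Sum>i<m. (z i)\<^sup>2)" using that by (intro member_le_sum) auto
      then have "\<bar>z i\<bar> \<le> int K" using z le_sq[of "z i"] by (simp add: lattice_net_def K_def)
      then show ?thesis by auto
    qed
    moreover have "z i = undefined" if "i \<notin> {..<m}" for i
      using z that by (auto simp: lattice_net_def PiE_def extensional_def)
    ultimately show "z \<in> ?P" by (intro PiE_I) auto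
  qed
  have finP: "finite ?P" by (intro finite_PiE) auto
  show fin: "finite (lattice_net m)" by (rule finite_subset[OF sub finP])
  have pw: "1 \<le> exp (25 * real m) * (\<Prod>i<m. ?f (z i))" if "z \<in> lattice_net m" for z
  proof -
    have "exp (- real_of_int (\<Sum>i<m. (z i)\<^sup>2)) = (\<Prod>i<m. exp (- real_of_int ((z i)\<^sup>2)))"
      by (simp add: exp_sum[symmetric] sum_negf)
    also have "\<dots> \<le> (\<Prod>i<m. ?f (z i))"
    proof (rule prod_mono)
      fix i
      have "exp (- real_of_int ((z i)\<^sup>2)) \<le> exp (- real (nat \<bar>z i\<bar>))"
        using le_sq[of "z i"] by (simp flip: of_int_abs of_int_power)
      also have "\<dots> = exp (-1) ^ nat \<bar>z i\<bar>" by (simp flip: exp_of_nat_mult)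
      also have "\<dots> \<le> ?f (z i)"
        using exp_ge_add_one_self[of 1] by (intro power_mono) (auto simp: exp_minus field_simps)
      finally show "0 \<le> exp (- real_of_int ((z i)\<^sup>2)) \<and> exp (- real_of_int ((z i)\<^sup>2)) \<le> ?f (z i)" by simp
    qed
    finally have *: "exp (- real_of_int (\<Sum>i<m. (z i)\<^sup>2)) \<le> (\<Prod>i<m. ?f (z i))" .
    have "real_of_int (\<Sum>i<m. (z i)\<^sup>2) \<le> 25 * real m"
      using that unfolding lattice_net_def by (metis (mono_tags, lifting) mem_Collect_eq of_int_le_iff of_int_mult of_int_numeral of_int_of_nat_eq)
    then have "1 \<le> exp (25 * real m + (- real_of_int (\<Sum>i<m. (z i)\<^sup>2)))" by (simp only: one_le_exp_iff) 
    also have "\<dots> \<le> exp (25 * real m) * (\<Prod>i<m. ?f (z i))"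
      unfolding exp_add using * by (intro mult_left_mono) auto
    finally show ?thesis .
  qed
  have "real (card (lattice_net m)) = (\<Sum>z\<in>lattice_net m. 1)" by simp
  also have "\<dots> \<le> (\<Sum>z\<in>lattice_net m. exp (25 * real m) * (\<Prod>i<m. ?f (z i)))"
    by (rule sum_mono) (rule pw)
  also have "\<dots> \<le> (\<Sum>z\<in>?P. exp (25 * real m) * (\<Prod>i<m. ?f (z i)))"
    by (rule sum_mono2[OF finP sub]) (simp add: prod_nonneg)
  also have "\<dots> = exp (25 * real m) * (\<Prod>i<m. \<Sum>x\<in>{-int K..int K}. ?f x)"
    by (subst prod_sum_PiE) (simp_all add: sum_distrib_left)
  also have "\<dots> \<le> exp (25 * real m) * (\<Prod>i<m. 4)"
    by (intro mult_left_mono prod_mono conjI sum_half_powers_le) (auto intro: sum_nonneg)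
  also have "\<dots> \<le> exp (25 * real m) * exp (2 * real m)"
  proof -
    have "(4 :: real) \<le> exp 1 * exp 1"
      using exp_ge_add_one_self[of 1] mult_mono[of 2 "exp 1 :: real" 2 "exp 1"] by simp
    then have "4 ^ m \<le> (exp 2 :: real) ^ m" by (intro power_mono) (auto simp flip: exp_add)
    also have "\<dots> = exp (2 * real m)" by (simp add: exp_of_nat2_mult)
    finally show ?thesis by simp
  qed
  also have "\<dots> = exp (27 * real m)" by (simp flip: exp_add)
  finally show "real (card (lattice_net m)) \<le> exp (27 * real m)" .
qed


section \<open>Union bounds and Hoeffding's inequality on the net\<close>

context prob_space
begin

text \<open>The event that \<open>P\<close> holds need not be measurable, only its complement must lie in a small
  event; this allows \<open>P\<close> to quantify over all vectors.\<close>

definition whp :: "real \<Rightarrow> ('a \<Rightarrow> bool) \<Rightarrow> bool" where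
  "whp \<gamma> P \<longleftrightarrow> (\<exists>B\<in>events. prob B \<le> \<gamma> \<and> (\<forall>\<omega>\<in>space M - B. P \<omega>))"

lemma whp_mono:
  assumes "whp \<gamma> P" "\<gamma> \<le> \<gamma>'" "\<And>\<omega>. \<omega> \<in> space M \<Longrightarrow> P \<omega> \<Longrightarrow> Q \<omega>"
  shows "whp \<gamma>' Q"
proof -
  from assms(1) obtain B where B: "B \<in> events" "prob B \<le> \<gamma>" "\<forall>\<omega>\<in>space M - B. P \<omega>"
    unfolding whp_def by blast
  have "prob B \<le> \<gamma>'" using B(2) assms(2) by linarith
  moreover have "\<forall>\<omega>\<in>space M - B. Q \<omega>" using B(3) assms(3) by blast
  ultimately show ?thesis unfolding whp_def using B(1) by blast
qed

lemma whp_event: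
  assumes "{\<omega> \<in> space M. \<not> P \<omega>} \<in> events" "prob {\<omega> \<in> space M. \<not> P \<omega>} \<le> \<gamma>"
  shows "whp \<gamma> P"
  unfolding whp_def using assms by (intro bexI[of _ "{\<omega> \<in> space M. \<not> P \<omega>}"]) auto

lemma whp_conj:
  assumes "whp \<gamma> P" "whp \<delta> Q"
  shows "whp (\<gamma> + \<delta>) (\<lambda>\<omega>. P \<omega> \<and> Q \<omega>)"
proof -
  from assms obtain A B where "A \<in> events" "B \<in> events" and p: "prob A \<le> \<gamma>" "prob B \<le> \<delta>"
    and *: "\<forall>\<omega>\<in>space M - A. P \<omega>" "\<forall>\<omega>\<in>space M - B. Q \<omega>"
    unfolding whp_def by blast
  then have "A \<union> B \<in> events" "prob (A \<union> B) \<le> \<gamma> + \<delta>"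
    using measure_Un_le[of A M B] by auto
  then show ?thesis unfolding whp_def using * by (intro bexI[of _ "A \<union> B"]) auto
qed

lemma whp_ball:
  assumes "finite I" "\<And>i. i \<in> I \<Longrightarrow> whp (\<gamma> i) (P i)"
  shows "whp (\<Sum>i\<in>I. \<gamma> i) (\<lambda>\<omega>. \<forall>i\<in>I. P i \<omega>)"
  using assms
proof (induction I rule: finite_induct)
  case empty
  then show ?case unfolding whp_def by (intro bexI[of _ "{}"]) auto
next
  case (insert i I)
  have "whp (\<gamma> i + (\<Sum>i\<in>I. \<gamma> i)) (\<lambda>\<omega>. P i \<omega> \<and> (\<forall>i\<in>I. P i \<omega>))"
    using insert by (intro whp_conj) auto
  then show ?case using insert.hyps by (auto elim: whp_mono)
qed

lemma prob_le_of_whp: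
  assumes "whp \<gamma> P" "\<And>\<omega>. \<omega> \<in> A \<Longrightarrow> \<omega> \<in> space M \<and> \<not> P \<omega>"
  shows "prob A \<le> \<gamma>"
proof -
  from assms(1) obtain B where B: "B \<in> events" "prob B \<le> \<gamma>" "\<forall>\<omega>\<in>space M - B. P \<omega>"
    unfolding whp_def by blast
  have "A \<subseteq> B" using B(3) assms(2) by blast
  then have "prob A \<le> prob B" using B(1) by (rule finite_measure_mono)
  then show ?thesis using B(2) by linarith
qed

text \<open>Hoeffding's inequality for the linear combination of the entries with coefficients c = 2
  x_i x_j. The sum of c^2 over pairs i < j is at most 2 |x|^4, half of the full double sum, so the
  squared widths add up to at most 8 B^2 K^2.\<close>

lemma prob_qform_bounded_ge:
  fixes x :: "nat \<Rightarrow> real"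
  assumes ind: "indep_vars (\<lambda>_. borel) Z (upper_pairs m)"
    and mean: "\<And>e. e \<in> upper_pairs m \<Longrightarrow> expectation (Z e) = 0"
    and bdd: "\<And>e \<omega>. e \<in> upper_pairs m \<Longrightarrow> \<omega> \<in> space M \<Longrightarrow> \<bar>Z e \<omega>\<bar> \<le> B"
    and B: "B > 0" and K: "norm2 m x \<le> K" "K > 0" and s: "s > 0"
  shows "prob {\<omega> \<in> space M. s \<le> \<bar>qform m (sym_ext (\<lambda>e. Z e \<omega>)) x\<bar>} \<le> 2 * exp (- (s\<^sup>2 / (4 * B\<^sup>2 * K\<^sup>2)))"
proof -
  let ?U = "upper_pairs m"
  define c where "c = (\<lambda>(i, j). 2 * x i * x j)"
  have q: "qform m (sym_ext (\<lambda>e. Z e \<omega>)) x = (\<Sum>e\<in>?U. c e * Z e \<omega>)" for \<omega>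
    unfolding qform_sym_ext by (intro sum.cong) (auto simp: c_def)
  have indc: "indep_vars (\<lambda>_. borel) (\<lambda>e \<omega>. c e * Z e \<omega>) ?U"
    by (rule indep_vars_compose2[OF ind]) simp
  have "(\<Sum>e\<in>?U. (2 * \<bar>c e\<bar> * B)\<^sup>2) = 4 * B\<^sup>2 * (2 * (\<Sum>e\<in>?U. (c e)\<^sup>2 / 2))"
    by (simp add: sum_distrib_left power_mult_distrib mult_ac)
  also have "2 * (\<Sum>e\<in>?U. (c e)\<^sup>2 / 2) \<le> 2 * K\<^sup>2"
  proof -
    have "(\<Sum>i<m. \<Sum>j<m. if i = j then 0 else 2 * (x i)\<^sup>2 * (x j)\<^sup>2) =
        2 * (\<Sum>(i, j)\<in>?U. if i = j then 0 else 2 * (x i)\<^sup>2 * (x j)\<^sup>2)"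
      by (rule sum_off_diagonal) auto
    also have "(\<Sum>(i, j)\<in>?U. if i = j then 0 else 2 * (x i)\<^sup>2 * (x j)\<^sup>2) = (\<Sum>e\<in>?U. (c e)\<^sup>2 / 2)"
      by (intro sum.cong) (auto simp: c_def upper_pairs_def power_mult_distrib)
    finally have "2 * (\<Sum>e\<in>?U. (c e)\<^sup>2 / 2) = (\<Sum>i<m. \<Sum>j<m. if i = j then 0 else 2 * (x i)\<^sup>2 * (x j)\<^sup>2)"
      by simp
    also have "\<dots> \<le> (\<Sum>i<m. \<Sum>j<m. 2 * (x i)\<^sup>2 * (x j)\<^sup>2)"
      by (intro sum_mono) auto
    also have "\<dots> = 2 * (norm2 m x)\<^sup>2"
      by (simp add: norm2_def power2_eq_square sum_product sum_distrib_left mult_ac)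
    also have "\<dots> \<le> 2 * K\<^sup>2" using K by (simp add: power_mono)
    finally show ?thesis .
  qed
  finally have var: "(\<Sum>e\<in>?U. (2 * \<bar>c e\<bar> * B)\<^sup>2) \<le> 8 * B\<^sup>2 * K\<^sup>2" using B by simp
  show ?thesis
  \<comment> \<open>\<open>Hoeffding_ineq_abs_ge\<close> needs a positive total width. If it
    vanishes, all coefficients are 0 and the form cannot reach s > 0.\<close>
  proof (cases "(\<Sum>e\<in>?U. (2 * \<bar>c e\<bar> * B)\<^sup>2) > 0")
    case True
    interpret H: Hoeffding_ineq M ?U "\<lambda>e \<omega>. c e * Z e \<omega>" "\<lambda>e. - (\<bar>c e\<bar> * B)" "\<lambda>e. \<bar>c e\<bar> * B"
      "\<Sum>e\<in>?U. expectation (\<lambda>\<omega>. c e * Z e \<omega>)"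
    proof unfold_locales
      show "finite ?U" by simp
      show "indep_vars (\<lambda>_. borel) (\<lambda>e \<omega>. c e * Z e \<omega>) ?U" by (rule indc)
      fix e assume e: "e \<in> ?U"
      show "AE \<omega> in M. c e * Z e \<omega> \<in> {- (\<bar>c e\<bar> * B)..\<bar>c e\<bar> * B}"
      proof (rule AE_I2)
        fix \<omega> assume "\<omega> \<in> space M"
        then have "\<bar>c e * Z e \<omega>\<bar> \<le> \<bar>c e\<bar> * B" using bdd[OF e] by (simp add: abs_mult mult_left_mono)
        then show "c e * Z e \<omega> \<in> {- (\<bar>c e\<bar> * B)..\<bar>c e\<bar> * B}" by auto
      qed
    qed simp
    have mu: "(\<Sum>e\<in>?U. expectation (\<lambda>\<omega>. c e * Z e \<omega>)) = 0"
      by (rule sum.neutral) (simp add: mean)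
    have w: "\<bar>c e\<bar> * B - - (\<bar>c e\<bar> * B) = 2 * \<bar>c e\<bar> * B" for e by simp
    have "prob {\<omega> \<in> space M. s \<le> \<bar>(\<Sum>e\<in>?U. c e * Z e \<omega>) - 0\<bar>}
        \<le> 2 * exp (- 2 * s\<^sup>2 / (\<Sum>e\<in>?U. (2 * \<bar>c e\<bar> * B)\<^sup>2))"
      using H.Hoeffding_ineq_abs_ge[of s] True s unfolding mu w by simp
    also have "\<dots> \<le> 2 * exp (- (s\<^sup>2 / (4 * B\<^sup>2 * K\<^sup>2)))"
    proof -
      have "2 * s\<^sup>2 / (8 * B\<^sup>2 * K\<^sup>2) \<le> 2 * s\<^sup>2 / (\<Sum>e\<in>?U. (2 * \<bar>c e\<bar> * B)\<^sup>2)"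
        using True var by (intro divide_left_mono mult_pos_pos) auto
      then show ?thesis by simp
    qed
    finally show ?thesis unfolding q by simp
  next
    case False
    have z: "(2 * \<bar>c e\<bar> * B)\<^sup>2 = 0" if "e \<in> ?U" for e
    proof -
      have "(2 * \<bar>c e\<bar> * B)\<^sup>2 \<le> (\<Sum>e\<in>?U. (2 * \<bar>c e\<bar> * B)\<^sup>2)"
        using that by (intro member_le_sum) auto
      then show ?thesis using False by (smt (verit) zero_le_power2)
    qed
    have "c e = 0" if "e \<in> ?U" for e using z[OF that] B by simp
    then have "qform m (sym_ext (\<lambda>e. Z e \<omega>)) x = 0" for \<omega>
      unfolding q by (intro sum.neutral) auto
    then show ?thesis using s by simp
  qed
qed

lemma random_variable_qform_sym_ext:
  assumes "indep_vars (\<lambda>_. borel) Z (upper_pairs m)"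
  shows "random_variable borel (\<lambda>\<omega>. qform m (sym_ext (\<lambda>e. Z e \<omega>)) x)"
proof -
  have rv: "random_variable borel (Z e)" if "e \<in> upper_pairs m" for e
    using assms that by (auto simp: indep_vars_def)
  show ?thesis unfolding qform_sym_ext
    by (intro borel_measurable_sum) (use rv in \<open>auto split: prod.split\<close>)
qed

text \<open>For a net vector the failure probability is exp (- const m ln m), which beats the exp
  (27 m) points of the net. The extra ln m makes the values of the constants irrelevant. The vectors
  are left unnormalised, whence the squared norm 25 m and the threshold s m.\<close>

lemma whp_qform_bounded:
  assumes B: "B > 0" and \<delta>: "\<delta> > 0" and \<gamma>: "\<gamma> > 0"
  shows "\<forall>\<^sub>F m in sequentially. \<forall>Z. indep_vars (\<lambda>_. borel) Z (upper_pairs m) \<longrightarrow>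
    (\<forall>e\<in>upper_pairs m. expectation (Z e) = 0) \<longrightarrow>
    (\<forall>e\<in>upper_pairs m. \<forall>\<omega>\<in>space M. \<bar>Z e \<omega>\<bar> \<le> B) \<longrightarrow>
    whp \<gamma> (\<lambda>\<omega>. form_le m (\<lambda>e. Z e \<omega>) (\<delta> * sqrt (m * ln m)))"
proof -
  have "((\<lambda>m. exp (27 * real m) * (2 * exp (- ((\<delta> * sqrt (m * ln m) * m)\<^sup>2 / (4 * B\<^sup>2 * (25 * real m)\<^sup>2)))))
      \<longlongrightarrow> 0) sequentially"
    using B \<delta> by real_asymp
  then have "\<forall>\<^sub>F m in sequentially. exp (27 * real m) *
      (2 * exp (- ((\<delta> * sqrt (m * ln m) * m)\<^sup>2 / (4 * B\<^sup>2 * (25 * real m)\<^sup>2)))) < \<gamma>"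
    using \<gamma> by (rule order_tendstoD)
  moreover have "\<forall>\<^sub>F m :: nat in sequentially. m \<ge> 2" by (rule eventually_ge_at_top)
  ultimately show ?thesis
  proof eventually_elim
    case (elim m)
    define s where "s = \<delta> * sqrt (m * ln m)"
    have m: "m > 0" "s > 0" using elim \<delta> by (auto simp: s_def)
    show ?case
    proof (intro allI impI)
      fix Z
      assume ind: "indep_vars (\<lambda>_. borel) Z (upper_pairs m)"
        and mean: "\<forall>e\<in>upper_pairs m. expectation (Z e) = 0"
        and bdd: "\<forall>e\<in>upper_pairs m. \<forall>\<omega>\<in>space M. \<bar>Z e \<omega>\<bar> \<le> B"
      let ?q = "\<lambda>z \<omega>. qform m (sym_ext (\<lambda>e. Z e \<omega>)) (\<lambda>i. of_int (z i :: int))"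
      let ?p = "2 * exp (- ((s * m)\<^sup>2 / (4 * B\<^sup>2 * (25 * real m)\<^sup>2)))"
      have "whp ?p (\<lambda>\<omega>. \<bar>?q z \<omega>\<bar> \<le> s * m)" if z: "z \<in> lattice_net m" for z
      proof (rule whp_event)
        note [measurable] = random_variable_qform_sym_ext[OF ind]
        show "{\<omega> \<in> space M. \<not> \<bar>?q z \<omega>\<bar> \<le> s * m} \<in> events" by measurable
        have "real_of_int (\<Sum>i<m. (z i)\<^sup>2) \<le> real_of_int (25 * int m)"
          using z unfolding lattice_net_def of_int_le_iff by blast
        then have n2: "norm2 m (\<lambda>i. of_int (z i)) \<le> 25 * real m" by (simp add: norm2_def)
        have "prob {\<omega> \<in> space M. \<not> \<bar>?q z \<omega>\<bar> \<le> s * m} \<le> prob {\<omega> \<in> space M. s * m \<le> \<bar>?q z \<omega>\<bar>}"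
          by (rule finite_measure_mono) auto
        also have "\<dots> \<le> ?p"
          by (rule prob_qform_bounded_ge[OF ind]) (use mean bdd n2 m B in auto)
        finally show "prob {\<omega> \<in> space M. \<not> \<bar>?q z \<omega>\<bar> \<le> s * m} \<le> ?p" .
      qed
      then have "whp (\<Sum>z\<in>lattice_net m. ?p) (\<lambda>\<omega>. \<forall>z\<in>lattice_net m. \<bar>?q z \<omega>\<bar> \<le> s * m)"
        by (rule whp_ball[OF card_lattice_net(1)])
      then show "whp \<gamma> (\<lambda>\<omega>. form_le m (\<lambda>e. Z e \<omega>) (\<delta> * sqrt (m * ln m)))"
      proof (rule whp_mono)
        have "(\<Sum>z\<in>lattice_net m. ?p) = real (card (lattice_net m)) * ?p" by (rule sum_constant)
        also have "\<dots> \<le> exp (27 * real m) * ?p"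
          by (rule mult_right_mono[OF card_lattice_net(2)]) simp
        also have "\<dots> \<le> \<gamma>" using elim(1) unfolding s_def by (rule less_imp_le)
        finally show "(\<Sum>z\<in>lattice_net m. ?p) \<le> \<gamma>" .
        fix \<omega> assume "\<forall>z\<in>lattice_net m. \<bar>?q z \<omega>\<bar> \<le> s * m"
        then show "form_le m (\<lambda>e. Z e \<omega>) (\<delta> * sqrt (m * ln m))"
          unfolding s_def[symmetric] using m(1)
          by (intro allI abs_qform_le_of_lattice_net sym_ext_commute) auto
      qed
    qed
  qed
qed

end

section \<open>Walks and the trace method\<close>

primrec mpow :: "nat \<Rightarrow> (nat \<Rightarrow> nat \<Rightarrow> real) \<Rightarrow> nat \<Rightarrow> nat \<Rightarrow> nat \<Rightarrow> real" where
  "mpow m a 0 = (\<lambda>i j. if i = j then 1 else 0)"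
| "mpow m a (Suc n) = (\<lambda>i j. \<Sum>l<m. mpow m a n i l * a l j)"

lemma mpow_add:
  assumes "j < m"
  shows "mpow m a (p + q) i j = (\<Sum>l<m. mpow m a p i l * mpow m a q l j)"
  using assms
proof (induction q arbitrary: j)
  case 0
  have "(\<Sum>l<m. mpow m a p i l * (if l = j then 1 else 0)) = (\<Sum>l<m. if l = j then mpow m a p i l else 0)"
    by (rule sum.cong) auto
  also have "\<dots> = mpow m a p i j" using 0 by simp
  finally show ?case by simp
next
  case (Suc q)
  have "mpow m a (p + Suc q) i j = (\<Sum>k<m. (\<Sum>l<m. mpow m a p i l * mpow m a q l k) * a k j)"
    by (simp add: Suc.IH)
  also have "\<dots> = (\<Sum>k<m. \<Sum>l<m. mpow m a p i l * (mpow m a q l k * a k j))"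
    by (simp add: sum_distrib_right mult.assoc)
  also have "\<dots> = (\<Sum>l<m. \<Sum>k<m. mpow m a p i l * (mpow m a q l k * a k j))"
    by (rule sum.swap)
  also have "\<dots> = (\<Sum>l<m. mpow m a p i l * mpow m a (Suc q) l j)"
    by (simp add: sum_distrib_left)
  finally show ?case .
qed

lemma mpow_1: "i < m \<Longrightarrow> mpow m a (Suc 0) i j = a i j"
proof -
  assume i: "i < m"
  have "mpow m a (Suc 0) i j = (\<Sum>l<m. if l = i then a l j else 0)"
    unfolding mpow.simps by (rule sum.cong) auto
  then show ?thesis using i by simp
qed

lemma mpow_commute:
  assumes sym: "\<And>i j. i < m \<Longrightarrow> j < m \<Longrightarrow> a i j = a j i"
  shows "i < m \<Longrightarrow> j < m \<Longrightarrow> mpow m a n i j = mpow m a n j i"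
proof (induction n arbitrary: i j)
  case (Suc n)
  have "mpow m a (Suc n) i j = (\<Sum>l<m. mpow m a (Suc 0) j l * mpow m a n l i)"
    unfolding mpow.simps(2)[of m a n]
    by (rule sum.cong) (use Suc sym in \<open>simp_all add: mpow_1 mult.commute del: mpow.simps\<close>)
  also have "\<dots> = mpow m a (Suc 0 + n) j i" using Suc.prems by (subst mpow_add) auto
  finally show ?case by simp
qed simp

definition mtrace :: "nat \<Rightarrow> (nat \<Rightarrow> nat \<Rightarrow> real) \<Rightarrow> nat \<Rightarrow> real" where
  "mtrace m a n = (\<Sum>i<m. mpow m a n i i)"

context
  fixes m :: nat and a :: "nat \<Rightarrow> nat \<Rightarrow> real"
  assumes sym: "\<And>i j. i < m \<Longrightarrow> j < m \<Longrightarrow> a i j = a j i"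
begin

lemma mtrace_double: "mtrace m a (n + n) = (\<Sum>i<m. \<Sum>j<m. (mpow m a n i j)\<^sup>2)"
  unfolding mtrace_def
proof (rule sum.cong[OF refl])
  fix i assume "i \<in> {..<m}"
  then show "mpow m a (n + n) i i = (\<Sum>j<m. (mpow m a n i j)\<^sup>2)"
    by (auto simp: mpow_add power2_eq_square intro!: sum.cong mpow_commute[OF sym])
qed

lemma qform_mpow_double: "qform m (mpow m a (n + n)) v = (\<Sum>i<m. (\<Sum>j<m. mpow m a n i j * v j)\<^sup>2)"
proof -
  have "qform m (mpow m a (n + n)) v = (\<Sum>i<m. \<Sum>j<m. \<Sum>l<m. mpow m a n l i * v i * (mpow m a n l j * v j))"
    unfolding bform_def
  proof (intro sum.cong refl)
    fix i j assume ij: "i \<in> {..<m}" "j \<in> {..<m}"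
    then have "mpow m a (n + n) i j = (\<Sum>l<m. mpow m a n l i * mpow m a n l j)"
      by (auto simp: mpow_add intro!: sum.cong mpow_commute[OF sym])
    then show "mpow m a (n + n) i j * v i * v j = (\<Sum>l<m. mpow m a n l i * v i * (mpow m a n l j * v j))"
      by (simp add: sum_distrib_left sum_distrib_right mult_ac)
  qed
  also have "\<dots> = (\<Sum>i<m. \<Sum>l<m. \<Sum>j<m. mpow m a n l i * v i * (mpow m a n l j * v j))"
    by (intro sum.cong refl sum.swap)
  also have "\<dots> = (\<Sum>l<m. \<Sum>i<m. \<Sum>j<m. mpow m a n l i * v i * (mpow m a n l j * v j))"
    by (rule sum.swap)
  also have "\<dots> = (\<Sum>l<m. (\<Sum>j<m. mpow m a n l j * v j)\<^sup>2)"
    by (simp add: power2_eq_square sum_product)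
  finally show ?thesis .
qed

text \<open>Both are Cauchy-Schwarz. The middle quantity is |A^n v|^2, which lies above (v, A^n v)^2
  and below the squared Frobenius norm of A^n, that is, the trace of A^(2n).\<close>

lemma qform_mpow_double_le:
  assumes "norm2 m v = 1"
  shows "(qform m (mpow m a n) v)\<^sup>2 \<le> qform m (mpow m a (n + n)) v"
    and "qform m (mpow m a (n + n)) v \<le> mtrace m a (n + n)"
proof -
  have "qform m (mpow m a n) v = (\<Sum>i<m. (\<Sum>j<m. mpow m a n i j * v j) * v i)"
    unfolding bform_def by (intro sum.cong refl) (simp add: sum_distrib_left sum_distrib_right mult_ac)
  also have "\<dots>\<^sup>2 \<le> (\<Sum>i<m. (\<Sum>j<m. mpow m a n i j * v j)\<^sup>2) * norm2 m v"
    by (rule cauchy_schwarz_row)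
  finally show "(qform m (mpow m a n) v)\<^sup>2 \<le> qform m (mpow m a (n + n)) v"
    using assms by (simp add: qform_mpow_double)
  have "(\<Sum>j<m. mpow m a n i j * v j)\<^sup>2 \<le> (\<Sum>j<m. (mpow m a n i j)\<^sup>2)" for i
    using cauchy_schwarz_row[of "mpow m a n i" v m] assms by simp
  then show "qform m (mpow m a (n + n)) v \<le> mtrace m a (n + n)"
    unfolding qform_mpow_double mtrace_double by (rule sum_mono)
qed

text \<open>Repeated squaring replaces diagonalisation. It reaches only exponents that are powers of
  two, which is why the number of steps is later taken of this form.\<close>

lemma abs_qform_power_le_mtrace:
  assumes "norm2 m v = 1"
  shows "\<bar>qform m a v\<bar> ^ (2 ^ Suc s) \<le> mtrace m a (2 ^ Suc s)"
proof -
  have "\<bar>qform m a v\<bar> ^ (2 ^ s) \<le> \<bar>qform m (mpow m a (2 ^ s)) v\<bar>"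
  proof (induction s)
    case 0
    have "qform m (mpow m a 1) v = qform m a v"
      by (rule bform_cong) (simp add: mpow_1 del: mpow.simps)
    then show ?case by simp
  next
    case (Suc s)
    have "\<bar>qform m a v\<bar> ^ (2 ^ Suc s) = (\<bar>qform m a v\<bar> ^ (2 ^ s))\<^sup>2"
      by (simp add: power_mult[symmetric] mult.commute)
    also have "\<dots> \<le> \<bar>qform m (mpow m a (2 ^ s)) v\<bar>\<^sup>2"
      by (rule power_mono[OF Suc]) simp
    also have "\<dots> \<le> qform m (mpow m a (2 ^ s + 2 ^ s)) v"
      using qform_mpow_double_le(1)[OF assms, of "2 ^ s"] by simp
    also have "2 ^ s + 2 ^ s = (2 :: nat) ^ Suc s" by simp
    finally show ?case by linarith
  qed
  then have "(\<bar>qform m a v\<bar> ^ (2 ^ s))\<^sup>2 \<le> (qform m (mpow m a (2 ^ s)) v)\<^sup>2"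
    using power_mono[of "\<bar>qform m a v\<bar> ^ (2 ^ s)" "\<bar>qform m (mpow m a (2 ^ s)) v\<bar>" 2] by simp
  also have "\<dots> \<le> mtrace m a (2 ^ s + 2 ^ s)"
    using qform_mpow_double_le[OF assms, of "2 ^ s"] by linarith
  also have "2 ^ s + 2 ^ s = (2 :: nat) ^ Suc s" by simp
  also have "(\<bar>qform m a v\<bar> ^ (2 ^ s))\<^sup>2 = \<bar>qform m a v\<bar> ^ (2 ^ Suc s)"
    by (simp add: power_mult[symmetric] mult.commute)
  finally show ?thesis .
qed

lemma mtrace_even_nonneg: "0 \<le> mtrace m a (2 ^ Suc s)"
proof -
  have "(2 :: nat) ^ Suc s = 2 ^ s + 2 ^ s" by simp
  then show ?thesis by (simp only: mtrace_double) (simp add: sum_nonneg)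
qed

lemma abs_qform_le_of_mtrace:
  assumes "mtrace m a (2 ^ Suc s) \<le> t ^ (2 ^ Suc s)" "0 \<le> t"
  shows "\<bar>qform m a v\<bar> \<le> t * norm2 m v"
proof -
  have u: "\<bar>qform m a u\<bar> \<le> t" if "norm2 m u = 1" for u
  proof (rule power_le_imp_le_base)
    show "\<bar>qform m a u\<bar> ^ Suc (2 ^ Suc s - 1) \<le> t ^ Suc (2 ^ Suc s - 1)"
      using abs_qform_power_le_mtrace[OF that, of s] assms(1) by (simp add: Suc_diff_1)
  qed (rule assms(2))
  show ?thesis by (rule abs_qform_le_of_unit) (rule u)
qed

end

lemma sum_PiE_atMost_Suc:
  "(\<Sum>w\<in>PiE {..Suc n} (\<lambda>_. A). F w) = (\<Sum>w\<in>PiE {..n} (\<lambda>_. A). \<Sum>y\<in>A. F (w(Suc n := y)))"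
proof -
  have "(\<Sum>w\<in>PiE {..Suc n} (\<lambda>_. A). F w) = (\<Sum>w\<in>PiE (insert (Suc n) {..n}) (\<lambda>_. A). F w)"
    by (simp add: atMost_Suc)
  also have "\<dots> = (\<Sum>(y, w)\<in>A \<times> PiE {..n} (\<lambda>_. A). F (w(Suc n := y)))"
    unfolding PiE_insert_eq by (subst sum.reindex[OF inj_combinator]) (auto simp: case_prod_unfold)
  also have "\<dots> = (\<Sum>y\<in>A. \<Sum>w\<in>PiE {..n} (\<lambda>_. A). F (w(Suc n := y)))"
    by (rule sum.cartesian_product[symmetric])
  also have "\<dots> = (\<Sum>w\<in>PiE {..n} (\<lambda>_. A). \<Sum>y\<in>A. F (w(Suc n := y)))"
    by (rule sum.swap)
  finally show ?thesis .
qed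

abbreviation walks :: "nat \<Rightarrow> nat \<Rightarrow> (nat \<Rightarrow> nat) set" where
  "walks m n \<equiv> PiE {..n} (\<lambda>_. {..<m})"

abbreviation walk_weight :: "(nat \<Rightarrow> nat \<Rightarrow> real) \<Rightarrow> (nat \<Rightarrow> nat) \<Rightarrow> nat \<Rightarrow> real" where
  "walk_weight a w n \<equiv> \<Prod>t<n. a (w t) (w (Suc t))"

lemma mpow_eq_sum_walks:
  assumes "j < m"
  shows "mpow m a n i j = (\<Sum>w\<in>walks m n. if w 0 = i \<and> w n = j then walk_weight a w n else 0)"
  using assms
proof (induction n arbitrary: j)
  case 0
  let ?f = "\<lambda>w :: nat \<Rightarrow> nat. if w 0 = i \<and> w 0 = j then 1 else 0 :: real"
  define g where "g = (\<lambda>y. (\<lambda>_ :: nat. undefined :: nat)(0 := y))"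
  have W: "walks m 0 = g ` {..<m}"
    using PiE_insert_eq[of "0 :: nat" "{}" "\<lambda>_. {..<m}"] by (auto simp: g_def image_iff)
  have inj: "inj_on g {..<m}"
    by (auto simp: g_def inj_on_def dest: fun_cong[of _ _ 0])
  have "sum ?f (walks m 0) = sum (?f \<circ> g) {..<m}"
    unfolding W by (rule sum.reindex[OF inj])
  also have "\<dots> = (\<Sum>y<m. if y = j then (if i = j then 1 else 0) else 0)"
    by (rule sum.cong) (auto simp: g_def)
  finally show ?case using 0 by (simp cong: if_cong)
next
  case (Suc n)
  let ?p = "\<lambda>w. walk_weight a w n"
  have "(\<Sum>w\<in>walks m (Suc n). if w 0 = i \<and> w (Suc n) = j then walk_weight a w (Suc n) else 0) =
      (\<Sum>w\<in>walks m n. \<Sum>y<m. if y = j then (if w 0 = i then ?p w * a (w n) j else 0) else 0)"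
    unfolding sum_PiE_atMost_Suc
  proof (intro sum.cong refl)
    fix w :: "nat \<Rightarrow> nat" and y :: nat
    let ?w = "w(Suc n := y)"
    have "(walk_weight a ?w n) = ?p w" by (rule prod.cong) auto
    then show "(if ?w 0 = i \<and> ?w (Suc n) = j then walk_weight a ?w (Suc n) else 0) =
        (if y = j then (if w 0 = i then ?p w * a (w n) j else 0) else 0)"
      by auto
  qed
  also have "\<dots> = (\<Sum>w\<in>walks m n. if w 0 = i then ?p w * a (w n) j else 0)"
    using Suc.prems by simp
  also have "\<dots> = (\<Sum>w\<in>walks m n. \<Sum>l<m. (if w 0 = i \<and> w n = l then ?p w else 0) * a l j)"
  proof (rule sum.cong[OF refl])
    fix w assume "w \<in> walks m n"
    then have wn: "w n \<in> {..<m}" by (rule PiE_mem) simp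
    have "(\<Sum>l<m. (if w 0 = i \<and> w n = l then ?p w else 0) * a l j) =
        (\<Sum>l<m. if l = w n then (if w 0 = i then ?p w * a (w n) j else 0) else 0)"
      by (rule sum.cong) auto
    then show "(if w 0 = i then ?p w * a (w n) j else 0) =
        (\<Sum>l<m. (if w 0 = i \<and> w n = l then ?p w else 0) * a l j)"
      using wn by simp
  qed
  also have "\<dots> = (\<Sum>l<m. \<Sum>w\<in>walks m n. (if w 0 = i \<and> w n = l then ?p w else 0) * a l j)"
    by (rule sum.swap)
  also have "\<dots> = mpow m a (Suc n) i j"
    by (simp add: Suc.IH sum_distrib_right)
  finally show ?case by (rule sym)
qed

lemma finite_walks [simp]: "finite (walks m n)"
  by (intro finite_PiE) auto

lemma mtrace_eq_sum_walks:
  "mtrace m a n = (\<Sum>w\<in>walks m n. if w 0 = w n then walk_weight a w n else 0)"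
proof -
  have "mtrace m a n = (\<Sum>i<m. \<Sum>w\<in>walks m n. if w 0 = i \<and> w n = i then walk_weight a w n else 0)"
    unfolding mtrace_def by (intro sum.cong refl) (simp add: mpow_eq_sum_walks)
  also have "\<dots> = (\<Sum>w\<in>walks m n. \<Sum>i<m. if w 0 = i \<and> w n = i then walk_weight a w n else 0)"
    by (rule sum.swap)
  also have "\<dots> = (\<Sum>w\<in>walks m n. if w 0 = w n then walk_weight a w n else 0)"
  proof (rule sum.cong[OF refl])
    fix w assume "w \<in> walks m n"
    then have wn: "w 0 \<in> {..<m}" by (rule PiE_mem) simp
    have "(\<Sum>i<m. if w 0 = i \<and> w n = i then walk_weight a w n else 0) =
      (\<Sum>i<m. if i = w 0 then (if w 0 = w n then walk_weight a w n else 0) else 0)"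
      by (rule sum.cong) auto
    then show "(\<Sum>i<m. if w 0 = i \<and> w n = i then walk_weight a w n else 0) =
      (if w 0 = w n then walk_weight a w n else 0)" using wn by simp
  qed
  finally show ?thesis .
qed

text \<open>The pair is ordered so that the edge of a proper step indexes the independent entry
  which that step picks up, in either direction.\<close>

definition walk_edge :: "(nat \<Rightarrow> nat) \<Rightarrow> nat \<Rightarrow> nat \<times> nat" where
  "walk_edge w t = (min (w t) (w (Suc t)), max (w t) (w (Suc t)))"

text \<open>A connected graph has at most one vertex more than it has edges.\<close>

lemma card_walk_vertices_le: "card (w ` {..n}) \<le> card (walk_edge w ` {..<n}) + 1"
proof (induction n)
  case (Suc n)
  show ?case
  proof (cases "w (Suc n) \<in> w ` {..n}")
    case True
    then have "w ` {..Suc n} = w ` {..n}" by (auto simp: atMost_Suc)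
    moreover have "card (walk_edge w ` {..<n}) \<le> card (walk_edge w ` {..<Suc n})"
      by (intro card_mono image_mono) auto
    ultimately show ?thesis using Suc by simp
  next
    case False
    \<comment> \<open>A new vertex is entered through a new edge, since both ends of an old edge
      have been visited.\<close>
    have "walk_edge w n \<notin> walk_edge w ` {..<n}"
    proof
      assume "walk_edge w n \<in> walk_edge w ` {..<n}"
      then obtain t where t: "t < n" "walk_edge w n = walk_edge w t" by auto
      then have "w (Suc n) = w t \<or> w (Suc n) = w (Suc t)"
        by (auto simp: walk_edge_def min_def max_def split: if_splits)
      then show False using False t(1) by (metis Suc_leI atMost_iff image_eqI less_imp_le)
    qed
    then have "card (walk_edge w ` {..<Suc n}) = Suc (card (walk_edge w ` {..<n}))"
      by (simp add: lessThan_Suc)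
    moreover have "card (w ` {..Suc n}) \<le> Suc (card (w ` {..n}))"
      by (simp add: atMost_Suc card_insert_if)
    ultimately show ?thesis using Suc by simp
  qed
qed simp

section \<open>Counting walks by the number of visited vertices\<close>

lemma binomial_fact_le_power: "(m choose v) * fact v \<le> m ^ v"
proof (induction v arbitrary: m)
  case (Suc v)
  show ?case
  proof (cases m)
    case (Suc k)
    have "(Suc k choose Suc v) * fact (Suc v) = Suc v * (Suc k choose Suc v) * fact v"
      unfolding fact_Suc of_nat_id by (simp only: mult_ac)
    also have "\<dots> = Suc k * ((k choose v) * fact v)"
      by (metis Suc_times_binomial_eq mult.assoc mult.commute)
    also have "\<dots> \<le> Suc k * k ^ v" by (intro mult_left_mono Suc.IH) simp
    also have "\<dots> \<le> Suc k * Suc k ^ v" by (intro mult_left_mono power_mono) auto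
    finally show ?thesis using Suc by simp
  qed simp
qed simp

text \<open>A weak Stirling bound, by (1 + 1/v)^v <= e in the induction step. With
  \<open>binomial_fact_le_power\<close> it bounds (m choose v) v^v by (e m)^v.\<close>

lemma self_power_le_exp_fact: "real v ^ v \<le> exp (real v) * fact v"
proof (induction v)
  case (Suc v)
  show ?case
  proof (cases "v = 0")
    case False
    have "real (Suc v) ^ v = real v ^ v * (1 + 1 / real v) ^ v"
      using False by (simp add: power_mult_distrib[symmetric] field_simps)
    also have "\<dots> \<le> real v ^ v * exp 1"
      using exp_ge_one_plus_x_over_n_power_n[of v 1] False by (intro mult_left_mono) auto
    also have "\<dots> \<le> exp (real v) * fact v * exp 1" by (intro mult_right_mono Suc) auto
    finally have "real (Suc v) * real (Suc v) ^ v \<le> real (Suc v) * (exp (real v) * fact v * exp 1)"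
      by (rule mult_left_mono) simp
    then show ?thesis by (simp add: exp_add mult_ac)
  qed (use exp_ge_add_one_self[of 1] in simp)
qed simp

text \<open>Choose the set of visited vertices, then an arbitrary sequence of n + 1 of its
  elements.\<close>

lemma card_walks_vertices:
  "real (card {w \<in> walks m n. card (w ` {..n}) = v}) \<le> real (m choose v) * real v ^ (n + 1)"
proof -
  let ?V = "{V. V \<subseteq> {..<m} \<and> card V = v}"
  have finV: "finite ?V" by (rule finite_subset[of _ "Pow {..<m}"]) auto
  have sub: "{w \<in> walks m n. card (w ` {..n}) = v} \<subseteq> (\<Union>V\<in>?V. PiE {..n} (\<lambda>_. V))"
  proof
    fix w assume w: "w \<in> {w \<in> walks m n. card (w ` {..n}) = v}"
    then have "w ` {..n} \<in> ?V" by auto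
    moreover have "w \<in> PiE {..n} (\<lambda>_. w ` {..n})" using w by (auto simp: PiE_def)
    ultimately show "w \<in> (\<Union>V\<in>?V. PiE {..n} (\<lambda>_. V))" by blast
  qed
  have "card {w \<in> walks m n. card (w ` {..n}) = v} \<le> card (\<Union>V\<in>?V. PiE {..n} (\<lambda>_. V))"
    by (rule card_mono[OF _ sub]) (auto intro!: finite_PiE finV dest: finite_subset)
  also have "\<dots> \<le> (\<Sum>V\<in>?V. card (PiE {..n} (\<lambda>_. V)))" by (rule card_UN_le[OF finV])
  also have "\<dots> = (\<Sum>V\<in>?V. v ^ (n + 1))" by (intro sum.cong) (auto simp: card_PiE)
  also have "\<dots> = (m choose v) * v ^ (n + 1)" by (simp add: n_subsets)
  finally have "real (card {w \<in> walks m n. card (w ` {..n}) = v}) \<le> real ((m choose v) * v ^ (n + 1))"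
    by (rule of_nat_mono)
  then show ?thesis by simp
qed

section \<open>Expected traces of random arrays\<close>

context prob_space
begin

lemma abs_expectation_power_le:
  fixes Y :: "'a \<Rightarrow> real"
  assumes rv: "random_variable borel Y" and bdd: "\<And>\<omega>. \<omega> \<in> space M \<Longrightarrow> \<bar>Y \<omega>\<bar> \<le> B"
    and var: "expectation (\<lambda>\<omega>. (Y \<omega>)\<^sup>2) \<le> S" and B: "0 < B" and k: "2 \<le> k"
  shows "\<bar>expectation (\<lambda>\<omega>. Y \<omega> ^ k)\<bar> \<le> S * B ^ (k - 2)"
proof -
  note [measurable] = rv
  have int: "integrable M (\<lambda>\<omega>. Y \<omega> ^ k)" for k
    by (rule integrable_const_bound[of _ "B ^ k"])
      (auto intro!: AE_I2 power_mono bdd simp: power_abs)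
  have "\<bar>expectation (\<lambda>\<omega>. Y \<omega> ^ k)\<bar> \<le> expectation (\<lambda>\<omega>. \<bar>Y \<omega> ^ k\<bar>)"
    by (rule integral_abs_bound)
  also have "\<dots> \<le> expectation (\<lambda>\<omega>. (Y \<omega>)\<^sup>2 * B ^ (k - 2))"
  proof (rule integral_mono)
    fix \<omega> assume \<omega>: "\<omega> \<in> space M"
    have "\<bar>Y \<omega> ^ k\<bar> = \<bar>Y \<omega>\<bar> ^ (2 + (k - 2))" using k by (simp only: power_abs le_add_diff_inverse)
    also have "\<dots> = (Y \<omega>)\<^sup>2 * \<bar>Y \<omega>\<bar> ^ (k - 2)" by (simp only: power_add power2_abs)
    finally have "\<bar>Y \<omega> ^ k\<bar> = (Y \<omega>)\<^sup>2 * \<bar>Y \<omega>\<bar> ^ (k - 2)" .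
    moreover have "(Y \<omega>)\<^sup>2 * \<bar>Y \<omega>\<bar> ^ (k - 2) \<le> (Y \<omega>)\<^sup>2 * B ^ (k - 2)"
      by (intro mult_left_mono power_mono bdd[OF \<omega>]) auto
    ultimately show "\<bar>Y \<omega> ^ k\<bar> \<le> (Y \<omega>)\<^sup>2 * B ^ (k - 2)" by simp
  qed (use int in auto)
  also have "\<dots> = expectation (\<lambda>\<omega>. (Y \<omega>)\<^sup>2) * B ^ (k - 2)" by simp
  also have "\<dots> \<le> S * B ^ (k - 2)" using var B by (intro mult_right_mono) auto
  finally show ?thesis .
qed

text \<open>By independence and centering only walks traversing every edge at least twice
  contribute; each such edge is worth at most \<open>S\<close> for two traversals and \<open>B\<close> for each further one.\<close>

lemma abs_expectation_walk_le:
  fixes Z :: "nat \<times> nat \<Rightarrow> 'a \<Rightarrow> real"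
  assumes ind: "indep_vars (\<lambda>_. borel) Z (upper_pairs m)"
    and mean: "\<And>e. e \<in> upper_pairs m \<Longrightarrow> expectation (Z e) = 0"
    and bdd: "\<And>e \<omega>. e \<in> upper_pairs m \<Longrightarrow> \<omega> \<in> space M \<Longrightarrow> \<bar>Z e \<omega>\<bar> \<le> B"
    and var: "\<And>e. e \<in> upper_pairs m \<Longrightarrow> expectation (\<lambda>\<omega>. (Z e \<omega>)\<^sup>2) \<le> S"
    and B: "0 < B" and S: "0 < S" "S \<le> B\<^sup>2" and w: "w \<in> walks m (2 * q)"
  defines "P \<equiv> \<lambda>\<omega>. \<Prod>t<2 * q. sym_ext (\<lambda>e. Z e \<omega>) (w t) (w (Suc t))"
  shows "integrable M P"
    and "\<bar>expectation P\<bar> \<le> (let u = card (w ` {..2 * q}) - 1 in if u \<le> q then S ^ u * B ^ (2 * (q - u)) else 0)"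
proof -
  let ?n = "2 * q"
  \<comment> \<open>A lower bound for the number of distinct edges. The estimate is stated through
    vertices because walks are counted by vertices.\<close>
  define u where "u = card (w ` {..?n}) - 1"
  define F where "F = walk_edge w ` {..<?n}"
  define k where "k = (\<lambda>e. card {t \<in> {..<?n}. walk_edge w t = e})"
  have wm: "w t < m" if "t \<le> ?n" for t using w that by auto
  have *: "integrable M P \<and> \<bar>expectation P\<bar> \<le> (if u \<le> q then S ^ u * B ^ (2 * (q - u)) else 0)"
  proof (cases "\<exists>t<?n. w t = w (Suc t)")
    case True
    then obtain t where "t < ?n" "w t = w (Suc t)" by blast
    then have "P \<omega> = 0" for \<omega> unfolding P_def by (intro prod_zero bexI[of _ t]) (auto simp: sym_ext_def)
    then have "P = (\<lambda>_. 0)" by blast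
    then show ?thesis using S B by auto
  next
    case False
    have FU: "F \<subseteq> upper_pairs m"
    proof
      fix e assume "e \<in> F"
      then obtain t where t: "t < ?n" "e = walk_edge w t" by (auto simp: F_def)
      have "w t < m" "w (Suc t) < m" "w t \<noteq> w (Suc t)" using t wm False by auto
      then show "e \<in> upper_pairs m" by (auto simp: t walk_edge_def upper_pairs_def min_def max_def)
    qed
    have finF: "finite F" by (simp add: F_def)
    have sw: "sym_ext (\<lambda>e. Z e \<omega>) (w t) (w (Suc t)) = Z (walk_edge w t) \<omega>" if "t < ?n" for t \<omega>
      using False that by (auto simp: sym_ext_def walk_edge_def min_def max_def)
    have P: "P \<omega> = (\<Prod>e\<in>F. Z e \<omega> ^ k e)" for \<omega>
    proof -
      have "P \<omega> = (\<Prod>t\<in>{..<?n}. Z (walk_edge w t) \<omega>)" unfolding P_def by (intro prod.cong) (auto simp: sw)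
      also have "\<dots> = (\<Prod>e\<in>F. \<Prod>t\<in>{t \<in> {..<?n}. walk_edge w t = e}. Z (walk_edge w t) \<omega>)"
        unfolding F_def by (rule prod.image_gen) simp
      also have "\<dots> = (\<Prod>e\<in>F. Z e \<omega> ^ k e)"
        by (rule prod.cong) (auto simp: k_def)
      finally show ?thesis .
    qed
    have rv: "random_variable borel (Z e)" if "e \<in> F" for e
      using ind FU that by (auto simp: indep_vars_def)
    have indF: "indep_vars (\<lambda>_. borel) (\<lambda>e \<omega>. Z e \<omega> ^ k e) F"
      by (rule indep_vars_compose2[OF indep_vars_subset[OF ind FU]]) simp
    have intF: "integrable M (\<lambda>\<omega>. Z e \<omega> ^ k e)" if "e \<in> F" for e
    proof (rule integrable_const_bound[of _ "B ^ k e"])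
      note [measurable] = rv[OF that]
      show "random_variable borel (\<lambda>\<omega>. Z e \<omega> ^ k e)" by measurable
      show "AE \<omega> in M. norm (Z e \<omega> ^ k e) \<le> B ^ k e"
        using that FU by (auto intro!: AE_I2 power_mono bdd simp: power_abs)
    qed
    have int: "integrable M P"
      unfolding P using indep_vars_integrable[OF finF indF intF] by simp
    have EP: "expectation P = (\<Prod>e\<in>F. expectation (\<lambda>\<omega>. Z e \<omega> ^ k e))"
      unfolding P using indep_vars_lebesgue_integral[OF finF indF intF] by simp
    have sumk: "(\<Sum>e\<in>F. k e) = ?n"
      using sum.image_gen[of "{..<?n}" "\<lambda>_. 1 :: nat" "walk_edge w"] by (simp add: F_def k_def)
    have uF: "u \<le> card F" using card_walk_vertices_le[of w ?n] by (simp add: u_def F_def)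
    have kpos: "k e \<noteq> 0" if "e \<in> F" for e
      using that by (auto simp: k_def F_def card_eq_0_iff)
    show ?thesis
    proof (cases "\<exists>e\<in>F. k e = 1")
      case True
      then obtain e where e: "e \<in> F" "k e = 1" by blast
      then have "expectation (\<lambda>\<omega>. Z e \<omega> ^ k e) = 0" using mean[of e] FU by auto
      then have "expectation P = 0" unfolding EP using e(1) finF by (intro prod_zero) auto
      then show ?thesis using int S B by auto
    next
      case False
      then have k2: "2 \<le> k e" if "e \<in> F" for e using kpos[OF that] that by (metis One_nat_def Suc_1 Suc_leI le_neq_implies_less less_one linorder_not_le)
      \<comment> \<open>All edges being used at least twice, there are at most q of them. A walk
        with u > q has more than q edges and so belongs to the vanishing case above.\<close>
      have "2 * card F = (\<Sum>e\<in>F. 2)" by simp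
      also have "\<dots> \<le> (\<Sum>e\<in>F. k e)" by (rule sum_mono) (rule k2)
      finally have F2: "card F \<le> q" by (simp add: sumk)
      have "\<bar>expectation P\<bar> = (\<Prod>e\<in>F. \<bar>expectation (\<lambda>\<omega>. Z e \<omega> ^ k e)\<bar>)"
        unfolding EP by (rule abs_prod)
      also have "\<dots> \<le> (\<Prod>e\<in>F. S * B ^ (k e - 2))"
        by (intro prod_mono conjI abs_expectation_power_le) (use rv FU bdd var B k2 in auto)
      also have "\<dots> = S ^ card F * B ^ (\<Sum>e\<in>F. k e - 2)"
        by (simp add: prod.distrib power_sum)
      also have "(\<Sum>e\<in>F. k e - 2) = 2 * (q - card F)"
        using k2 by (subst sum_subtractf_nat) (auto simp: sumk)
      \<comment> \<open>Replacing the number of edges by the smaller u trades factors S for factors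
        B^2, which is allowed as S <= B^2.\<close>
      also have "S ^ card F * B ^ (2 * (q - card F)) \<le> S ^ u * B ^ (2 * (q - u))"
      proof -
        have "S ^ card F * B ^ (2 * (q - card F)) = S ^ u * (S ^ (card F - u) * B ^ (2 * (q - card F)))"
          using uF by (simp add: power_add[symmetric] mult.assoc[symmetric])
        also have "\<dots> \<le> S ^ u * ((B\<^sup>2) ^ (card F - u) * B ^ (2 * (q - card F)))"
          using S B by (intro mult_left_mono mult_right_mono power_mono) auto
        also have "(B\<^sup>2) ^ (card F - u) * B ^ (2 * (q - card F)) = B ^ (2 * (q - u))"
          using uF F2 by (simp add: power_mult[symmetric] power_add[symmetric] diff_mult_distrib2[symmetric] algebra_simps)
        finally show ?thesis .
      qed
      finally show ?thesis using int uF F2 by simp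
    qed
  qed
  show "integrable M P" using * by simp
  show "\<bar>expectation P\<bar> \<le> (let u = card (w ` {..?n}) - 1 in if u \<le> q then S ^ u * B ^ (2 * (q - u)) else 0)"
    using * unfolding Let_def u_def by (rule conjunct2)
qed

text \<open>Each vertex of a walk is worth e m S, while each vertex short of the maximum is made up
  by a freedom q + 1 and two factors B. The hypothesis on B says that this exchange never pays, so
  every class of walks obeys the bound of the tree-like walks, u = q.\<close>

lemma walk_count_weight_le:
  assumes u: "u \<le> q" and S: "0 < S" and B: "real (q + 1) * B\<^sup>2 \<le> real m * exp 1 * S"
  shows "real (m choose Suc u) * real (Suc u) ^ (2 * q + 1) * (S ^ u * B ^ (2 * (q - u)))
    \<le> real m * exp 1 * real (q + 1) ^ q * (real m * exp 1 * S) ^ q"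
proof -
  let ?v = "Suc u" and ?a = "real m * exp 1"
  have "real (m choose ?v) * real ?v ^ ?v \<le> real (m choose ?v) * (exp (real ?v) * fact ?v)"
    by (rule mult_left_mono[OF self_power_le_exp_fact]) simp
  also have "\<dots> = exp (real ?v) * real ((m choose ?v) * fact ?v)"
    by (simp only: of_nat_mult of_nat_fact mult_ac)
  also have "\<dots> \<le> exp (real ?v) * real (m ^ ?v)"
    by (intro mult_left_mono of_nat_mono binomial_fact_le_power) simp
  also have "\<dots> = ?a ^ ?v" using exp_of_nat_mult[of ?v "1 :: real"] by (simp add: power_mult_distrib mult.commute)
  finally have 1: "real (m choose ?v) * real ?v ^ ?v \<le> ?a ^ ?v" .
  \<comment> \<open>Of the 2q + 1 powers of u + 1, exactly u + 1 are consumed by the binomial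
    coefficient; the others are bounded by powers of q + 1.\<close>
  have e: "2 * q + 1 = ?v + (q + (q - u))" using u by simp
  have "real (m choose ?v) * real ?v ^ (2 * q + 1) = (real (m choose ?v) * real ?v ^ ?v) * real ?v ^ (q + (q - u))"
    unfolding e power_add by (simp only: mult_ac)
  also have "\<dots> \<le> ?a ^ ?v * real (q + 1) ^ (q + (q - u))"
    using u by (intro mult_mono 1 power_mono) auto
  finally have "real (m choose ?v) * real ?v ^ (2 * q + 1) * (S ^ u * B ^ (2 * (q - u)))
      \<le> ?a ^ ?v * real (q + 1) ^ (q + (q - u)) * (S ^ u * B ^ (2 * (q - u)))"
    using S by (intro mult_right_mono) (auto simp: power_mult)
  also have "\<dots> = ?a * real (q + 1) ^ q * ((?a * S) ^ u * (real (q + 1) * B\<^sup>2) ^ (q - u))"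
    unfolding power_add power_mult power_mult_distrib[of "real (q + 1)"] by (simp add: power_mult_distrib mult_ac)
  also have "\<dots> \<le> ?a * real (q + 1) ^ q * ((?a * S) ^ u * (?a * S) ^ (q - u))"
    using S B by (intro mult_left_mono power_mono) auto
  also have "(?a * S) ^ u * (?a * S) ^ (q - u) = (?a * S) ^ q"
    using u by (simp flip: power_add)
  finally show ?thesis .
qed

text \<open>The walks are grouped by the number of visited vertices. At most q + 1 classes
  contribute, all with the same bound D. That a walk is closed is dropped, since the estimate of a
  single walk holds without it.\<close>

lemma expectation_mtrace_le:
  fixes Z :: "nat \<times> nat \<Rightarrow> 'a \<Rightarrow> real"
  assumes ind: "indep_vars (\<lambda>_. borel) Z (upper_pairs m)"
    and mean: "\<And>e. e \<in> upper_pairs m \<Longrightarrow> expectation (Z e) = 0"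
    and bdd: "\<And>e \<omega>. e \<in> upper_pairs m \<Longrightarrow> \<omega> \<in> space M \<Longrightarrow> \<bar>Z e \<omega>\<bar> \<le> B"
    and var: "\<And>e. e \<in> upper_pairs m \<Longrightarrow> expectation (\<lambda>\<omega>. (Z e \<omega>)\<^sup>2) \<le> S"
    and B: "0 < B" and S: "0 < S" "S \<le> B\<^sup>2" and q: "real (q + 1) * B\<^sup>2 \<le> real m * exp 1 * S"
  shows "integrable M (\<lambda>\<omega>. mtrace m (sym_ext (\<lambda>e. Z e \<omega>)) (2 * q))"
    and "expectation (\<lambda>\<omega>. mtrace m (sym_ext (\<lambda>e. Z e \<omega>)) (2 * q))
      \<le> real m * exp 1 * real (q + 1) ^ (q + 1) * (real m * exp 1 * S) ^ q"
proof -
  let ?n = "2 * q"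
  let ?P = "\<lambda>w \<omega>. \<Prod>t<?n. sym_ext (\<lambda>e. Z e \<omega>) (w t) (w (Suc t))"
  let ?c = "\<lambda>w. card (w ` {..?n})"
  define D where "D = real m * exp 1 * real (q + 1) ^ q * (real m * exp 1 * S) ^ q"
  define g where "g v = (if v - 1 \<le> q then S ^ (v - 1) * B ^ (2 * (q - (v - 1))) else 0)" for v
  have g0: "0 \<le> g v" for v using S B by (simp add: g_def)
  have int: "integrable M (?P w)" if "w \<in> walks m ?n" for w
    by (rule abs_expectation_walk_le(1)[OF ind mean bdd var B S that])
  have le: "\<bar>expectation (?P w)\<bar> \<le> g (?c w)" if "w \<in> walks m ?n" for w
    using abs_expectation_walk_le(2)[OF ind mean bdd var B S that] by (simp only: g_def Let_def)
  have int': "integrable M (\<lambda>\<omega>. if w 0 = w ?n then ?P w \<omega> else 0)" if "w \<in> walks m ?n" for w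
    using int[OF that] by (cases "w 0 = w ?n") simp_all
  show "integrable M (\<lambda>\<omega>. mtrace m (sym_ext (\<lambda>e. Z e \<omega>)) (2 * q))"
    unfolding mtrace_eq_sum_walks by (rule Bochner_Integration.integrable_sum) (rule int')
  have "expectation (\<lambda>\<omega>. mtrace m (sym_ext (\<lambda>e. Z e \<omega>)) (2 * q)) =
      (\<Sum>w\<in>walks m ?n. expectation (\<lambda>\<omega>. if w 0 = w ?n then ?P w \<omega> else 0))"
    unfolding mtrace_eq_sum_walks by (rule Bochner_Integration.integral_sum) (rule int')
  also have "\<dots> \<le> (\<Sum>w\<in>walks m ?n. g (?c w))"
  proof (rule sum_mono)
    fix w assume "w \<in> walks m ?n"
    from le[OF this] g0[of "?c w"] show "expectation (\<lambda>\<omega>. if w 0 = w ?n then ?P w \<omega> else 0) \<le> g (?c w)"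
      by (cases "w 0 = w ?n") simp_all
  qed
  also have "\<dots> = (\<Sum>v\<in>{1..?n + 1}. \<Sum>w\<in>{w \<in> walks m ?n. ?c w = v}. g (?c w))"
  proof (rule sum.group[symmetric])
    show "?c ` walks m ?n \<subseteq> {1..?n + 1}"
    proof
      fix v assume "v \<in> ?c ` walks m ?n"
      then obtain w :: "nat \<Rightarrow> nat" where v: "v = ?c w" by blast
      have "?c w \<le> ?n + 1" using card_image_le[of "{..?n}" w] by simp
      moreover have "?c w > 0" by (subst card_gt_0_iff) simp
      ultimately show "v \<in> {1..?n + 1}" unfolding v by simp
    qed
  qed simp_all
  also have "\<dots> = (\<Sum>v\<in>{1..?n + 1}. real (card {w \<in> walks m ?n. ?c w = v}) * g v)"
    by (intro sum.cong refl) simp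
  also have "\<dots> \<le> (\<Sum>v\<in>{1..?n + 1}. if v \<in> {1..q + 1} then D else 0)"
  proof (rule sum_mono)
    fix v assume v: "v \<in> {1..?n + 1}"
    then obtain u where u: "v = Suc u" by (cases v) auto
    show "real (card {w \<in> walks m ?n. ?c w = v}) * g v \<le> (if v \<in> {1..q + 1} then D else 0)"
    proof (cases "u \<le> q")
      case True
      have "real (card {w \<in> walks m ?n. ?c w = v}) * g v \<le> real (m choose v) * real v ^ (?n + 1) * g v"
        by (rule mult_right_mono[OF card_walks_vertices g0])
      also have "\<dots> \<le> D"
        using walk_count_weight_le[OF True S(1) q] True unfolding D_def g_def u by simp
      finally show ?thesis using True u by simp
    next
      case False
      then show ?thesis by (simp add: g_def u)
    qed
  qed
  also have "\<dots> = real (q + 1) * D"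
  proof -
    have "(\<Sum>v\<in>{1..?n + 1}. if v \<in> {1..q + 1} then D else 0) = (\<Sum>v\<in>{1..?n + 1} \<inter> {1..q + 1}. D)"
      by (rule sum.inter_restrict[symmetric]) simp
    also have "{1..?n + 1} \<inter> {1..q + 1} = {1..q + 1}" by auto
    finally show ?thesis by simp
  qed
  also have "\<dots> = real m * exp 1 * real (q + 1) ^ (q + 1) * (real m * exp 1 * S) ^ q"
    by (simp add: D_def)
  finally show "expectation (\<lambda>\<omega>. mtrace m (sym_ext (\<lambda>e. Z e \<omega>)) (2 * q))
      \<le> real m * exp 1 * real (q + 1) ^ (q + 1) * (real m * exp 1 * S) ^ q" .
qed

lemma power_of_2_between:
  fixes c :: real
  assumes "1 \<le> c"
  shows "\<exists>s. c \<le> 2 ^ s \<and> 2 ^ s \<le> 2 * c"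
proof -
  obtain n where n: "c < 2 ^ n" using real_arch_pow[of 2 c] by auto
  define s where "s = (LEAST s. c \<le> 2 ^ s)"
  have le: "c \<le> 2 ^ s" unfolding s_def by (rule LeastI[of _ n]) (use n in simp)
  have "2 ^ s \<le> 2 * c"
  proof (cases s)
    case (Suc k)
    then have "\<not> c \<le> 2 ^ k" unfolding s_def by (intro not_less_Least) simp
    then show ?thesis using Suc by simp
  qed (use assms in simp)
  with le show ?thesis by blast
qed

text \<open>Markov's inequality for the trace of the power 2q with ln m <= q <= 2 ln m. The ratio of
  the expected trace to the threshold is about m ln m times the q-th power of (q + 1) e S /
  (\<delta>^2 ln m). The factor q + 1 is the loss of the crude counting; a small S brings the base
  down to exp (-3), whose q-th power is at most m^(-3).\<close>

lemma whp_qform_small_variance: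
  assumes \<delta>: "\<delta> > 0" and \<gamma>: "\<gamma> > 0" and S: "0 < S" "S \<le> \<delta>\<^sup>2 * exp (-4) / 3"
  shows "\<forall>\<^sub>F m in sequentially. \<forall>Z. indep_vars (\<lambda>_. borel) Z (upper_pairs m) \<longrightarrow>
    (\<forall>e\<in>upper_pairs m. expectation (Z e) = 0) \<longrightarrow>
    (\<forall>e\<in>upper_pairs m. \<forall>\<omega>\<in>space M. \<bar>Z e \<omega>\<bar> \<le> 2 * real m powr (1 / 3)) \<longrightarrow>
    (\<forall>e\<in>upper_pairs m. expectation (\<lambda>\<omega>. (Z e \<omega>)\<^sup>2) \<le> S) \<longrightarrow>
    whp \<gamma> (\<lambda>\<omega>. form_le m (\<lambda>e. Z e \<omega>) (\<delta> * sqrt (m * ln m)))"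
proof -
  have "\<forall>\<^sub>F m in sequentially. 3 * ln (real m) * (2 * real m powr (1 / 3))\<^sup>2 \<le> real m * exp 1 * S"
    using S by real_asymp
  moreover have "\<forall>\<^sub>F m in sequentially. S \<le> (2 * real m powr (1 / 3))\<^sup>2" by real_asymp
  moreover have "\<forall>\<^sub>F m in sequentially. real m * exp 1 * (3 * ln (real m)) * (1 / real m ^ 3) < \<gamma>"
    using \<gamma> by real_asymp
  moreover have "\<forall>\<^sub>F m in sequentially. 1 \<le> ln (real m)" by real_asymp
  moreover have "\<forall>\<^sub>F m :: nat in sequentially. m > 0" by (rule eventually_gt_at_top)
  ultimately show ?thesis
  proof eventually_elim
    case (elim m)
    define c where "c = ln (real m)"
    define B where "B = 2 * real m powr (1 / 3)"
    obtain s where s: "c \<le> 2 ^ s" "2 ^ s \<le> 2 * c" using power_of_2_between[of c] elim by (auto simp: c_def)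
    define q :: nat where "q = 2 ^ s"
    have q: "c \<le> real q" "real q \<le> 2 * c" using s by (simp_all add: q_def)
    have c1: "1 \<le> c" using elim by (simp add: c_def)
    have q1: "real (q + 1) \<le> 3 * c" using q c1 by simp
    have B0: "0 < B" using elim by (simp add: B_def)
    have qB: "real (q + 1) * B\<^sup>2 \<le> real m * exp 1 * S"
    proof -
      have "real (q + 1) * B\<^sup>2 \<le> 3 * c * B\<^sup>2" by (rule mult_right_mono[OF q1]) simp
      also have "\<dots> \<le> real m * exp 1 * S" using elim(1) by (simp only: c_def B_def)
      finally show ?thesis .
    qed
    define t where "t = \<delta> * sqrt (m * ln m)"
    have mc: "0 < real m * c" using c1 elim by simp
    have t2: "t\<^sup>2 = \<delta>\<^sup>2 * real m * c" "t > 0"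
      using mc \<delta> by (simp_all add: t_def c_def[symmetric] power_mult_distrib)
    show ?case
    proof (intro allI impI)
      fix Z :: "nat \<times> nat \<Rightarrow> 'a \<Rightarrow> real"
      assume ind: "indep_vars (\<lambda>_. borel) Z (upper_pairs m)"
        and mean: "\<forall>e\<in>upper_pairs m. expectation (Z e) = 0"
        and bdd: "\<forall>e\<in>upper_pairs m. \<forall>\<omega>\<in>space M. \<bar>Z e \<omega>\<bar> \<le> 2 * real m powr (1 / 3)"
        and var: "\<forall>e\<in>upper_pairs m. expectation (\<lambda>\<omega>. (Z e \<omega>)\<^sup>2) \<le> S"
      let ?T = "\<lambda>\<omega>. mtrace m (sym_ext (\<lambda>e. Z e \<omega>)) (2 * q)"
      have SB: "S \<le> B\<^sup>2" using elim(2) by (simp only: B_def)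
      have int: "integrable M ?T"
        and E: "expectation ?T \<le> real m * exp 1 * real (q + 1) ^ (q + 1) * (real m * exp 1 * S) ^ q"
        using expectation_mtrace_le[OF ind mean[rule_format] bdd[rule_format, folded B_def] var[rule_format] B0 S(1) SB qB]
        by blast+
      have two: "2 * q = 2 ^ Suc s" by (simp add: q_def)
      have T0: "0 \<le> ?T \<omega>" for \<omega> unfolding two by (rule mtrace_even_nonneg) (rule sym_ext_commute)
      have tq: "t ^ (2 * q) = (\<delta>\<^sup>2 * real m * c) ^ q" "t ^ (2 * q) > 0"
        using t2(2) unfolding t2(1)[symmetric] by (simp_all add: power_mult[symmetric])
      have "prob {\<omega> \<in> space M. t ^ (2 * q) \<le> ?T \<omega>} \<le> expectation ?T / t ^ (2 * q)"
        by (rule integral_Markov_inequality_measure[OF int sets.empty_sets]) (use T0 tq(2) in simp_all)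
      also have "\<dots> \<le> real m * exp 1 * real (q + 1) ^ (q + 1) * (real m * exp 1 * S) ^ q / t ^ (2 * q)"
        using E tq(2) by (intro divide_right_mono) simp_all
      also have "\<dots> = real m * exp 1 * real (q + 1) * (real (q + 1) * (real m * exp 1 * S) / (\<delta>\<^sup>2 * real m * c)) ^ q"
        unfolding tq(1) by (simp add: power_mult_distrib power_divide)
      \<comment> \<open>The bound on S is made for this: q + 1 <= 3 ln m cancels the 3 and the
        logarithm, leaving e * exp (-4).\<close>
      also have "\<dots> \<le> real m * exp 1 * (3 * c) * exp (- 3) ^ q"
      proof (intro mult_mono power_mono)
        have "real (q + 1) * (real m * exp 1 * S) / (\<delta>\<^sup>2 * real m * c) \<le> 3 * c * (real m * exp 1 * (\<delta>\<^sup>2 * exp (-4) / 3)) / (\<delta>\<^sup>2 * real m * c)"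
          using q1 S c1 by (intro divide_right_mono mult_mono) auto
        also have "\<dots> = exp 1 * exp (-4)"
          using c1 elim \<delta> by (simp add: field_simps)
        also have "\<dots> = exp (- 3)" by (simp flip: exp_add)
        finally show "real (q + 1) * (real m * exp 1 * S) / (\<delta>\<^sup>2 * real m * c) \<le> exp (- 3)" .
      qed (use q1 S c1 in auto)
      also have "exp (- 3) ^ q = exp (- 3 * real q)"
        using exp_of_nat_mult[of q "- 3 :: real"] by (simp add: mult.commute)
      also have "real m * exp 1 * (3 * c) * exp (- 3 * real q) \<le> real m * exp 1 * (3 * c) * exp (- 3 * c)"
        using q(1) c1 by (intro mult_left_mono) auto
      also have "exp (- 3 * c) = 1 / real m ^ 3"
        using elim exp_of_nat_mult[of 3 c] by (simp add: exp_minus c_def inverse_eq_divide)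
      also have "real m * exp 1 * (3 * c) * (1 / real m ^ 3) \<le> \<gamma>" using elim(3) by (simp only: c_def)
      finally have p: "prob {\<omega> \<in> space M. t ^ (2 * q) \<le> ?T \<omega>} \<le> \<gamma>" .
      note [measurable] = borel_measurable_integrable[OF int]
      have "whp \<gamma> (\<lambda>\<omega>. ?T \<omega> \<le> t ^ (2 * q))"
      proof (rule whp_event)
        show "{\<omega> \<in> space M. \<not> ?T \<omega> \<le> t ^ (2 * q)} \<in> events" by measurable
        have "prob {\<omega> \<in> space M. \<not> ?T \<omega> \<le> t ^ (2 * q)} \<le> prob {\<omega> \<in> space M. t ^ (2 * q) \<le> ?T \<omega>}"
          by (rule finite_measure_mono) auto
        then show "prob {\<omega> \<in> space M. \<not> ?T \<omega> \<le> t ^ (2 * q)} \<le> \<gamma>" using p by linarith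
      qed
      then show "whp \<gamma> (\<lambda>\<omega>. form_le m (\<lambda>e. Z e \<omega>) (\<delta> * sqrt (m * ln m)))"
      proof (rule whp_mono[OF _ order_refl])
        fix \<omega> assume "?T \<omega> \<le> t ^ (2 * q)"
        then show "form_le m (\<lambda>e. Z e \<omega>) (\<delta> * sqrt (m * ln m))"
          unfolding two t_def[symmetric] using t2(2)
          by (intro allI abs_qform_le_of_mtrace sym_ext_commute) auto
      qed
    qed
  qed
qed

end

section \<open>Moderate deviations of the degrees\<close>

text \<open>Large values are sent to 0 and not clipped, so the difference of two truncations is the
  value itself between the two levels and 0 elsewhere.\<close>

definition trunc :: "real \<Rightarrow> real \<Rightarrow> real" where
  "trunc B x = (if \<bar>x\<bar> \<le> B then x else 0)"

lemma borel_measurable_trunc [measurable]: "trunc B \<in> borel_measurable borel"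
  unfolding trunc_def by measurable

lemma abs_trunc_le: "0 \<le> B \<Longrightarrow> \<bar>trunc B x\<bar> \<le> B"
  by (simp add: trunc_def)

lemma abs_exp_taylor2_le:
  fixes x :: real
  assumes "\<bar>x\<bar> \<le> 1"
  shows "\<bar>exp x - (1 + x + x\<^sup>2 / 2)\<bar> \<le> \<bar>x\<bar> ^ 3"
proof -
  obtain t where t: "\<bar>t\<bar> \<le> \<bar>x\<bar>" "exp x = (\<Sum>k<3. x ^ k / fact k) + exp t / fact 3 * x ^ 3"
    using Maclaurin_exp_le[of x 3] by blast
  have "exp t \<le> exp 1" using t(1) assms by simp
  then have "exp t \<le> 6" using exp_le by linarith
  have "exp x - (1 + x + x\<^sup>2 / 2) = exp t / 6 * x ^ 3"
    using t(2) by (simp add: numeral_3_eq_3 fact_numeral power2_eq_square)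
  then have "\<bar>exp x - (1 + x + x\<^sup>2 / 2)\<bar> = exp t / 6 * \<bar>x\<bar> ^ 3"
    by (simp only: abs_mult power_abs) simp
  also have "\<dots> \<le> 1 * \<bar>x\<bar> ^ 3" using \<open>exp t \<le> 6\<close> by (intro mult_right_mono) auto
  finally show ?thesis by simp
qed

text \<open>Puts a lower bound 1 + y for the moment generating function of one entry into
  exponential form, which multiplies over independent entries.\<close>

lemma exp_le_one_plus:
  fixes y :: real
  assumes "\<bar>y\<bar> \<le> 1 / 2"
  shows "exp (y - 2 * y\<^sup>2) \<le> 1 + y"
proof -
  have "y - 2 * y\<^sup>2 \<le> ln (1 + y)" using abs_ln_one_plus_x_minus_x_bound[OF assms] by linarith
  then have "exp (y - 2 * y\<^sup>2) \<le> exp (ln (1 + y))" by simp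
  then show ?thesis using assms by (simp add: abs_le_iff)
qed

section \<open>Moment generating functions of truncated entries\<close>

context prob_space
begin

text \<open>Integrability is demanded explicitly because the Bochner integral of a non-integrable
  function is 0, which would satisfy any bound. The variance appears as second moment, the mean
  being 0.\<close>

definition std_moments :: "real \<Rightarrow> real \<Rightarrow> ('a \<Rightarrow> real) \<Rightarrow> bool" where
  "std_moments C p Y \<longleftrightarrow> random_variable borel Y \<and> expectation Y = 0 \<and> expectation (\<lambda>\<omega>. (Y \<omega>)\<^sup>2) = 1 \<and>
    integrable M (\<lambda>\<omega>. \<bar>Y \<omega>\<bar> powr p) \<and> expectation (\<lambda>\<omega>. \<bar>Y \<omega>\<bar> powr p) \<le> C"

text \<open>Where |Y| > B, the power |Y|^k is at most |Y|^p B^(k - p). The case k = 0 gives the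
  probability of a large entry, k = 1 the bias of truncation, k = 2 the loss of variance.\<close>

lemma tail_moment_le:
  assumes Y: "std_moments C p Y" and B: "B > 0" and k: "real k < p"
  shows "integrable M (\<lambda>\<omega>. if \<bar>Y \<omega>\<bar> \<le> B then 0 else \<bar>Y \<omega>\<bar> ^ k)"
    and "expectation (\<lambda>\<omega>. if \<bar>Y \<omega>\<bar> \<le> B then 0 else \<bar>Y \<omega>\<bar> ^ k) \<le> C * B powr (real k - p)"
proof -
  have [measurable]: "random_variable borel Y" using Y by (simp add: std_moments_def)
  have int: "integrable M (\<lambda>\<omega>. \<bar>Y \<omega>\<bar> powr p * B powr (real k - p))"
    using Y by (simp add: std_moments_def)
  have le: "(if \<bar>Y \<omega>\<bar> \<le> B then 0 else \<bar>Y \<omega>\<bar> ^ k) \<le> \<bar>Y \<omega>\<bar> powr p * B powr (real k - p)" for \<omega>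
  proof (cases "\<bar>Y \<omega>\<bar> \<le> B")
    case False
    then have y: "\<bar>Y \<omega>\<bar> > 0" using B by linarith
    have "\<bar>Y \<omega>\<bar> ^ k = \<bar>Y \<omega>\<bar> powr p * \<bar>Y \<omega>\<bar> powr (real k - p)"
      using y by (simp add: powr_add[symmetric] powr_realpow)
    also have "\<dots> \<le> \<bar>Y \<omega>\<bar> powr p * B powr (real k - p)"
      using False B k by (intro mult_left_mono powr_mono2') auto
    finally show ?thesis using False by simp
  qed simp
  show int': "integrable M (\<lambda>\<omega>. if \<bar>Y \<omega>\<bar> \<le> B then 0 else \<bar>Y \<omega>\<bar> ^ k)"
    by (rule Bochner_Integration.integrable_bound[OF int]) (use le in \<open>auto intro!: AE_I2\<close>)
  have "expectation (\<lambda>\<omega>. if \<bar>Y \<omega>\<bar> \<le> B then 0 else \<bar>Y \<omega>\<bar> ^ k) \<le> expectation (\<lambda>\<omega>. \<bar>Y \<omega>\<bar> powr p * B powr (real k - p))"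
    by (rule integral_mono[OF int' int]) (rule le)
  also have "\<dots> \<le> C * B powr (real k - p)"
    using Y by (simp add: std_moments_def mult_right_mono)
  finally show "expectation (\<lambda>\<omega>. if \<bar>Y \<omega>\<bar> \<le> B then 0 else \<bar>Y \<omega>\<bar> ^ k) \<le> C * B powr (real k - p)" .
qed

lemma integrable_trunc_power:
  assumes "random_variable borel Y" "B > 0"
  shows "integrable M (\<lambda>\<omega>. trunc B (Y \<omega>) ^ k)"
proof (rule integrable_const_bound[of _ "B ^ k"])
  note [measurable] = assms(1)
  show "random_variable borel (\<lambda>\<omega>. trunc B (Y \<omega>) ^ k)" by measurable
  show "AE \<omega> in M. norm (trunc B (Y \<omega>) ^ k) \<le> B ^ k"
    using assms(2) by (intro AE_I2) (simp add: power_abs power_mono abs_trunc_le)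
qed

lemma integrable_std_moments:
  assumes Y: "std_moments C p Y" and k: "real k < p"
  shows "integrable M (\<lambda>\<omega>. Y \<omega> ^ k)"
proof -
  have rv [measurable]: "random_variable borel Y" using Y by (simp add: std_moments_def)
  have "integrable M (\<lambda>\<omega>. \<bar>trunc 1 (Y \<omega>) ^ k\<bar> + (if \<bar>Y \<omega>\<bar> \<le> 1 then 0 else \<bar>Y \<omega>\<bar> ^ k))"
    using tail_moment_le(1)[OF Y _ k, of 1] integrable_trunc_power[OF rv, of 1 k]
    by (intro Bochner_Integration.integrable_add integrable_abs) auto
  then show ?thesis
    by (rule Bochner_Integration.integrable_bound) (auto intro!: AE_I2 simp: trunc_def power_abs)
qed

text \<open>As Y has mean 0 and second moment 1, the mean of the truncation is minus that of the
  removed tail, and its second moment falls short of 1 by that of the tail.\<close>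

lemma trunc_moments:
  assumes Y: "std_moments C p Y" and p: "p > 2" and B: "B > 0"
  shows "\<bar>expectation (\<lambda>\<omega>. trunc B (Y \<omega>))\<bar> \<le> C * B powr (1 - p)"
    and "expectation (\<lambda>\<omega>. (trunc B (Y \<omega>))\<^sup>2) \<le> 1"
    and "1 - C * B powr (2 - p) \<le> expectation (\<lambda>\<omega>. (trunc B (Y \<omega>))\<^sup>2)"
proof -
  have rv [measurable]: "random_variable borel Y" using Y by (simp add: std_moments_def)
  let ?t1 = "\<lambda>\<omega>. if \<bar>Y \<omega>\<bar> \<le> B then 0 else \<bar>Y \<omega>\<bar> ^ 1"
  let ?t2 = "\<lambda>\<omega>. if \<bar>Y \<omega>\<bar> \<le> B then 0 else \<bar>Y \<omega>\<bar> ^ 2"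
  have i1: "integrable M Y" using integrable_std_moments[OF Y, of 1] p by simp
  have i2: "integrable M (\<lambda>\<omega>. (Y \<omega>)\<^sup>2)" using integrable_std_moments[OF Y, of 2] p by simp
  have it1: "integrable M (\<lambda>\<omega>. trunc B (Y \<omega>))" using integrable_trunc_power[OF rv B, of 1] by simp
  have it2: "integrable M (\<lambda>\<omega>. (trunc B (Y \<omega>))\<^sup>2)" using integrable_trunc_power[OF rv B, of 2] by simp
  have tail1: "integrable M ?t1" "expectation ?t1 \<le> C * B powr (1 - p)"
    using tail_moment_le[OF Y B, of 1] p by simp_all
  have tail2: "integrable M ?t2" "expectation ?t2 \<le> C * B powr (2 - p)"
    using tail_moment_le[OF Y B, of 2] p by simp_all
  have "expectation (\<lambda>\<omega>. trunc B (Y \<omega>)) = expectation (\<lambda>\<omega>. trunc B (Y \<omega>) - Y \<omega>)"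
    using Y by (simp add: Bochner_Integration.integral_diff[OF it1 i1] std_moments_def)
  also have "\<bar>\<dots>\<bar> \<le> expectation (\<lambda>\<omega>. \<bar>trunc B (Y \<omega>) - Y \<omega>\<bar>)" by (rule integral_abs_bound)
  also have "\<dots> = expectation ?t1" by (rule Bochner_Integration.integral_cong) (auto simp: trunc_def)
  finally show "\<bar>expectation (\<lambda>\<omega>. trunc B (Y \<omega>))\<bar> \<le> C * B powr (1 - p)" using tail1(2) by linarith
  have "expectation (\<lambda>\<omega>. (Y \<omega>)\<^sup>2) = expectation (\<lambda>\<omega>. (trunc B (Y \<omega>))\<^sup>2 + ?t2 \<omega>)"
    by (rule Bochner_Integration.integral_cong) (auto simp: trunc_def)
  also have "\<dots> = expectation (\<lambda>\<omega>. (trunc B (Y \<omega>))\<^sup>2) + expectation ?t2"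
    by (rule Bochner_Integration.integral_add[OF it2 tail2(1)])
  finally have eq: "expectation (\<lambda>\<omega>. (trunc B (Y \<omega>))\<^sup>2) + expectation ?t2 = 1"
    using Y by (simp add: std_moments_def)
  show "1 - C * B powr (2 - p) \<le> expectation (\<lambda>\<omega>. (trunc B (Y \<omega>))\<^sup>2)" using eq tail2(2) by linarith
  have "0 \<le> expectation ?t2" by (rule Bochner_Integration.integral_nonneg) simp
  then show "expectation (\<lambda>\<omega>. (trunc B (Y \<omega>))\<^sup>2) \<le> 1" using eq by linarith
qed

text \<open>The three errors are the bias, the loss of variance and the cubic Taylor remainder. In
  the last, one factor |l T| is bounded by |l| B and the other two are paid by the variance.\<close>

lemma mgf_trunc_taylor:
  assumes Y: "std_moments C p Y" and p: "p > 2" and B: "B > 0" and l: "\<bar>l\<bar> * B \<le> 1"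
  shows "\<bar>expectation (\<lambda>\<omega>. exp (l * trunc B (Y \<omega>))) - (1 + l\<^sup>2 / 2)\<bar>
    \<le> \<bar>l\<bar> * (C * B powr (1 - p)) + l\<^sup>2 * (C * B powr (2 - p)) + l\<^sup>2 * (\<bar>l\<bar> * B)"
proof -
  have rv [measurable]: "random_variable borel Y" using Y by (simp add: std_moments_def)
  let ?T = "\<lambda>\<omega>. trunc B (Y \<omega>)"
  have lT: "\<bar>l * ?T \<omega>\<bar> \<le> \<bar>l\<bar> * B" for \<omega>
    using B by (auto simp: abs_mult intro!: mult_left_mono abs_trunc_le)
  have it1: "integrable M ?T" using integrable_trunc_power[OF rv B, of 1] by simp
  have it2: "integrable M (\<lambda>\<omega>. (?T \<omega>)\<^sup>2)" using integrable_trunc_power[OF rv B, of 2] by simp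
  have ie: "integrable M (\<lambda>\<omega>. exp (l * ?T \<omega>))"
  proof (rule integrable_const_bound[of _ "exp (\<bar>l\<bar> * B)"])
    show "AE \<omega> in M. norm (exp (l * ?T \<omega>)) \<le> exp (\<bar>l\<bar> * B)"
      using lT by (intro AE_I2) (simp add: abs_le_iff)
  qed measurable
  have ip: "integrable M (\<lambda>\<omega>. 1 + l * ?T \<omega> + l\<^sup>2 / 2 * (?T \<omega>)\<^sup>2)" using it1 it2 by simp
  let ?D = "\<lambda>\<omega>. exp (l * ?T \<omega>) - (1 + l * ?T \<omega> + l\<^sup>2 / 2 * (?T \<omega>)\<^sup>2)"
  have "\<bar>expectation ?D\<bar> \<le> expectation (\<lambda>\<omega>. \<bar>?D \<omega>\<bar>)" by (rule integral_abs_bound)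
  also have "\<dots> \<le> expectation (\<lambda>\<omega>. l\<^sup>2 * (\<bar>l\<bar> * B) * (?T \<omega>)\<^sup>2)"
  proof (rule integral_mono)
    show "integrable M (\<lambda>\<omega>. \<bar>?D \<omega>\<bar>)"
      by (rule integrable_abs, rule Bochner_Integration.integrable_diff[OF ie ip])
    show "integrable M (\<lambda>\<omega>. l\<^sup>2 * (\<bar>l\<bar> * B) * (?T \<omega>)\<^sup>2)" using it2 by simp
    fix \<omega>
    have "\<bar>?D \<omega>\<bar> \<le> \<bar>l * ?T \<omega>\<bar> ^ 3"
      using abs_exp_taylor2_le[of "l * ?T \<omega>"] lT[of \<omega>] l by (simp add: power_mult_distrib)
    also have "\<dots> = \<bar>l * ?T \<omega>\<bar> * (l\<^sup>2 * (?T \<omega>)\<^sup>2)"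
    proof -
      have "\<bar>x\<bar> ^ 3 = \<bar>x\<bar> * x\<^sup>2" for x :: real by (simp add: power3_eq_cube power2_eq_square)
      then show ?thesis by (simp only: power_mult_distrib)
    qed
    also have "\<dots> \<le> (\<bar>l\<bar> * B) * (l\<^sup>2 * (?T \<omega>)\<^sup>2)" by (intro mult_right_mono lT) auto
    finally show "\<bar>?D \<omega>\<bar> \<le> l\<^sup>2 * (\<bar>l\<bar> * B) * (?T \<omega>)\<^sup>2" by (simp add: mult_ac)
  qed
  also have "\<dots> = l\<^sup>2 * (\<bar>l\<bar> * B) * expectation (\<lambda>\<omega>. (?T \<omega>)\<^sup>2)" by simp
  also have "\<dots> \<le> l\<^sup>2 * (\<bar>l\<bar> * B) * 1"
    using B by (intro mult_left_mono trunc_moments(2)[OF Y p B]) auto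
  finally have 1: "\<bar>expectation ?D\<bar> \<le> l\<^sup>2 * (\<bar>l\<bar> * B)" by simp
  have 2: "expectation ?D = expectation (\<lambda>\<omega>. exp (l * ?T \<omega>)) - (1 + l * expectation ?T + l\<^sup>2 / 2 * expectation (\<lambda>\<omega>. (?T \<omega>)\<^sup>2))"
    unfolding Bochner_Integration.integral_diff[OF ie ip] using it1 it2 by (simp add: prob_space)
  have 3: "\<bar>l * expectation ?T\<bar> \<le> \<bar>l\<bar> * (C * B powr (1 - p))"
    unfolding abs_mult by (intro mult_left_mono trunc_moments(1)[OF Y p B]) simp
  have "\<bar>expectation (\<lambda>\<omega>. (?T \<omega>)\<^sup>2) - 1\<bar> \<le> C * B powr (2 - p)"
    using trunc_moments(2,3)[OF Y p B] by linarith
  then have "l\<^sup>2 / 2 * \<bar>expectation (\<lambda>\<omega>. (?T \<omega>)\<^sup>2) - 1\<bar> \<le> l\<^sup>2 / 2 * (C * B powr (2 - p))"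
    by (rule mult_left_mono) simp
  also have "\<dots> \<le> l\<^sup>2 * (C * B powr (2 - p))"
    using trunc_moments(2,3)[OF Y p B] by (intro mult_right_mono) auto
  also have "l\<^sup>2 / 2 * \<bar>expectation (\<lambda>\<omega>. (?T \<omega>)\<^sup>2) - 1\<bar> = \<bar>l\<^sup>2 / 2 * (expectation (\<lambda>\<omega>. (?T \<omega>)\<^sup>2) - 1)\<bar>"
    by (simp add: abs_mult)
  finally have 4: "\<bar>l\<^sup>2 / 2 * expectation (\<lambda>\<omega>. (?T \<omega>)\<^sup>2) - l\<^sup>2 / 2\<bar> \<le> l\<^sup>2 * (C * B powr (2 - p))"
    by (simp add: right_diff_distrib)
  show ?thesis using 1 2 3 4 by linarith
qed

text \<open>On the scale h = sqrt (ln m / m) a product of about m such functions is a power of m,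
  namely m^(a^2/2) up to m^\<eta>; this needs errors of order o(h^2) per factor. The bound p > 6
  enters through the powers B^(-5) and B^(-4).\<close>

lemma mgf_trunc:
  assumes p: "p > 6" and C: "C > 0" and A: "A > 0" and \<eta>: "\<eta> > 0"
  shows "\<forall>\<^sub>F m in sequentially. \<forall>Y a. std_moments C p Y \<longrightarrow> \<bar>a\<bar> \<le> A \<longrightarrow>
    (let E = expectation (\<lambda>\<omega>. exp (a * sqrt (ln m / m) * trunc (m powr (1 / 3)) (Y \<omega>))) in
      exp ((a\<^sup>2 / 2 - \<eta>) * (ln m / m)) \<le> E \<and> E \<le> exp ((a\<^sup>2 / 2 + \<eta>) * (ln m / m)))"
proof -
  \<comment> \<open>The three errors of \<open>mgf_trunc_taylor\<close> at l = A h, divided by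
    h^2.\<close>
  define \<kappa> where "\<kappa> = (\<lambda>m :: nat. A * C * (m powr (1 / 3)) powr (-5) / sqrt (ln m / m)
     + A\<^sup>2 * C * (m powr (1 / 3)) powr (-4) + A ^ 3 * sqrt (ln m / m) * m powr (1 / 3))"
  have "\<forall>\<^sub>F m in sequentially. \<kappa> m \<le> \<eta> / 2" unfolding \<kappa>_def using A C \<eta> by real_asymp
  moreover have "\<forall>\<^sub>F m :: nat in sequentially. A * sqrt (ln m / m) * m powr (1 / 3) \<le> 1" using A by real_asymp
  moreover have "\<forall>\<^sub>F m :: nat in sequentially. 2 * (A\<^sup>2 / 2 + \<eta>)\<^sup>2 * (ln m / m) \<le> \<eta> / 2" using A \<eta> by real_asymp
  moreover have "\<forall>\<^sub>F m :: nat in sequentially. (A\<^sup>2 / 2 + \<eta>) * (ln m / m) \<le> 1 / 2" using A \<eta> by real_asymp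
  moreover have "\<forall>\<^sub>F m :: nat in sequentially. m \<ge> 2" by (rule eventually_ge_at_top)
  ultimately show ?thesis
  proof eventually_elim
    case (elim m)
    define B where "B = real m powr (1 / 3)"
    define h where "h = sqrt (ln m / m)"
    have B1: "B \<ge> 1" using elim(5) by (simp add: B_def ge_one_powr_ge_zero)
    have h: "h > 0" "h\<^sup>2 = ln m / m" using elim(5) by (auto simp: h_def)
    have \<kappa>m: "\<kappa> m = A * C * B powr (-5) / h + A\<^sup>2 * C * B powr (-4) + A ^ 3 * h * B"
      by (simp add: \<kappa>_def B_def h_def)
    show ?case
    proof (intro allI impI)
      fix Y a
      assume Y: "std_moments C p Y" and a: "\<bar>a\<bar> \<le> A"
      let ?E = "expectation (\<lambda>\<omega>. exp (a * h * trunc B (Y \<omega>)))"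
      have lh: "\<bar>a * h\<bar> \<le> A * h" using a h by (simp add: abs_mult mult_right_mono)
      have lB: "\<bar>a * h\<bar> * B \<le> A * h * B" using lh B1 by (intro mult_right_mono) auto
      have l1: "\<bar>a * h\<bar> * B \<le> 1" using lB elim(2) by (simp add: B_def h_def)
      have ah2: "(a * h)\<^sup>2 \<le> (A * h)\<^sup>2" using lh power_mono[of "\<bar>a * h\<bar>" "A * h" 2] by simp
      have b1: "B powr (1 - p) \<le> B powr (-5)" "B powr (2 - p) \<le> B powr (-4)"
        using B1 p by (auto intro!: powr_mono)
      have "\<bar>?E - (1 + (a * h)\<^sup>2 / 2)\<bar> \<le> \<bar>a * h\<bar> * (C * B powr (1 - p)) + (a * h)\<^sup>2 * (C * B powr (2 - p)) + (a * h)\<^sup>2 * (\<bar>a * h\<bar> * B)"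
        using mgf_trunc_taylor[OF Y _ _ l1] p B1 by simp
      also have "\<dots> \<le> A * h * (C * B powr (-5)) + (A * h)\<^sup>2 * (C * B powr (-4)) + (A * h)\<^sup>2 * (A * h * B)"
        using C B1 A h by (intro add_mono mult_mono lh ah2 lB b1 order_refl) auto
      also have "\<dots> = \<kappa> m * h\<^sup>2"
        unfolding \<kappa>m using h(1) by (simp add: field_simps power2_eq_square power3_eq_cube)
      also have "\<dots> \<le> \<eta> / 2 * h\<^sup>2" using elim(1) by (intro mult_right_mono) auto
      finally have E: "\<bar>?E - (1 + (a * h)\<^sup>2 / 2)\<bar> \<le> \<eta> / 2 * h\<^sup>2" .
      have "?E \<le> 1 + (a\<^sup>2 / 2 + \<eta>) * h\<^sup>2"
      proof -
        have "0 \<le> \<eta> / 2 * h\<^sup>2" using \<eta> by simp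
        moreover have "(a\<^sup>2 / 2 + \<eta>) * h\<^sup>2 = (a * h)\<^sup>2 / 2 + \<eta> / 2 * h\<^sup>2 + \<eta> / 2 * h\<^sup>2"
          by (simp add: power_mult_distrib algebra_simps)
        ultimately show ?thesis using E by linarith
      qed
      also have "\<dots> \<le> exp ((a\<^sup>2 / 2 + \<eta>) * h\<^sup>2)" by (rule exp_ge_add_one_self)
      finally have up: "?E \<le> exp ((a\<^sup>2 / 2 + \<eta>) * h\<^sup>2)" .
      \<comment> \<open>Half of \<eta> absorbs the Taylor error; the other half is kept for the term
        2 y^2 lost in \<open>exp_le_one_plus\<close>.\<close>
      define y where "y = (a\<^sup>2 / 2 - \<eta> / 2) * h\<^sup>2"
      have yabs: "\<bar>y\<bar> \<le> (A\<^sup>2 / 2 + \<eta>) * h\<^sup>2"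
      proof -
        have "a\<^sup>2 \<le> A\<^sup>2" using a power_mono[of "\<bar>a\<bar>" A 2] by simp
        moreover have "0 \<le> a\<^sup>2" by simp
        ultimately have "\<bar>a\<^sup>2 / 2 - \<eta> / 2\<bar> \<le> A\<^sup>2 / 2 + \<eta>" using \<eta> by linarith
        then show ?thesis unfolding y_def abs_mult by (intro mult_mono) auto
      qed
      have y2: "2 * y\<^sup>2 \<le> \<eta> / 2 * h\<^sup>2"
      proof -
        have "y\<^sup>2 \<le> ((A\<^sup>2 / 2 + \<eta>) * h\<^sup>2)\<^sup>2" using yabs power_mono[of "\<bar>y\<bar>" _ 2] by simp
        then have "2 * y\<^sup>2 \<le> (2 * (A\<^sup>2 / 2 + \<eta>)\<^sup>2 * h\<^sup>2) * h\<^sup>2"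
          by (simp add: power_mult_distrib power2_eq_square mult_ac)
        also have "\<dots> \<le> \<eta> / 2 * h\<^sup>2" using elim(3) unfolding h(2)[symmetric] by (intro mult_right_mono) auto
        finally show ?thesis .
      qed
      have "exp ((a\<^sup>2 / 2 - \<eta>) * h\<^sup>2) \<le> exp (y - 2 * y\<^sup>2)"
      proof -
        have "(a\<^sup>2 / 2 - \<eta>) * h\<^sup>2 = y - \<eta> / 2 * h\<^sup>2" by (simp add: y_def algebra_simps)
        then show ?thesis using y2 by simp
      qed
      also have "\<dots> \<le> 1 + y"
        using yabs elim(4) unfolding h(2)[symmetric] by (intro exp_le_one_plus) linarith
      also have "\<dots> \<le> ?E"
      proof -
        have "y = (a * h)\<^sup>2 / 2 - \<eta> / 2 * h\<^sup>2" by (simp add: y_def power_mult_distrib algebra_simps)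
        then show ?thesis using E by linarith
      qed
      finally have lo: "exp ((a\<^sup>2 / 2 - \<eta>) * h\<^sup>2) \<le> ?E" .
      show "let E = expectation (\<lambda>\<omega>. exp (a * sqrt (ln m / m) * trunc (m powr (1 / 3)) (Y \<omega>))) in
          exp ((a\<^sup>2 / 2 - \<eta>) * (ln m / m)) \<le> E \<and> E \<le> exp ((a\<^sup>2 / 2 + \<eta>) * (ln m / m))"
        using lo up unfolding Let_def h_def[symmetric] B_def[symmetric] unfolding h(2)[symmetric] by blast
    qed
  qed
qed

text \<open>Lower tail by exponential tilting: under the tilted law of parameter \<open>a\<close> the sum is close
  to \<open>a T\<close>.\<close>

lemma prob_ge_tilting:
  fixes S :: "'a \<Rightarrow> real"
  assumes S: "random_variable borel S" "\<And>\<omega>. \<omega> \<in> space M \<Longrightarrow> \<bar>S \<omega>\<bar> \<le> K"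
    and hT: "h * T = c" and a: "0 \<le> a" and h: "0 \<le> h" and T: "0 \<le> T" and \<epsilon>: "0 \<le> \<epsilon>"
    and lo: "exp ((a\<^sup>2 / 2 - \<eta>) * c) \<le> expectation (\<lambda>\<omega>. exp (a * h * S \<omega>))"
    and up: "\<And>b. b \<in> {a - \<epsilon>, a + \<epsilon>} \<Longrightarrow> expectation (\<lambda>\<omega>. exp (b * h * S \<omega>)) \<le> exp ((b\<^sup>2 / 2 + \<eta>) * c)"
  shows "exp ((a\<^sup>2 / 2 - \<eta>) * c) - 2 * exp ((a\<^sup>2 / 2 - \<epsilon>\<^sup>2 / 2 + \<eta>) * c)
    \<le> exp ((a\<^sup>2 + a * \<epsilon>) * c) * prob {\<omega> \<in> space M. (a - \<epsilon>) * T \<le> S \<omega>}"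
proof -
  note [measurable] = S(1)
  let ?e = "\<lambda>b \<omega>. exp (b * h * S \<omega>)"
  let ?X = "{\<omega> \<in> space M. (a - \<epsilon>) * T \<le> S \<omega>}"
  have int: "integrable M (?e b)" for b
  proof (rule integrable_const_bound[of _ "exp (\<bar>b * h\<bar> * K)"])
    have "b * h * S \<omega> \<le> \<bar>b * h\<bar> * K" if "\<omega> \<in> space M" for \<omega>
    proof -
      have "b * h * S \<omega> \<le> \<bar>b * h\<bar> * \<bar>S \<omega>\<bar>" by (metis abs_ge_self abs_mult)
      also have "\<dots> \<le> \<bar>b * h\<bar> * K" by (intro mult_left_mono S(2) that) simp
      finally show ?thesis .
    qed
    then show "AE \<omega> in M. norm (?e b \<omega>) \<le> exp (\<bar>b * h\<bar> * K)" by (intro AE_I2) simp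
  qed measurable
  \<comment> \<open>On the window between (a - \<epsilon>) T and (a + \<epsilon>) T the exponential
    is at most \<open>?u\<close>. Below and above it, the exponential is dominated by the one with
    parameter a - \<epsilon> or a + \<epsilon>; \<open>?v\<close> and \<open>?w\<close> are the
    ratios at the two ends, where h T = c.\<close>
  let ?u = "exp ((a\<^sup>2 + a * \<epsilon>) * c)" and ?v = "exp (\<epsilon> * (a - \<epsilon>) * c)" and ?w = "exp (- \<epsilon> * (a + \<epsilon>) * c)"
  have pt: "?e a \<omega> \<le> ?u * indicator ?X \<omega> + ?v * ?e (a - \<epsilon>) \<omega> + ?w * ?e (a + \<epsilon>) \<omega>"
    if \<omega>: "\<omega> \<in> space M" for \<omega>
  proof -
    consider "S \<omega> < (a - \<epsilon>) * T" | "(a - \<epsilon>) * T \<le> S \<omega>" "S \<omega> \<le> (a + \<epsilon>) * T" | "S \<omega> > (a + \<epsilon>) * T" by linarith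
    then show ?thesis
    proof cases
      case 1
      have "\<epsilon> * h * S \<omega> \<le> \<epsilon> * h * ((a - \<epsilon>) * T)" using 1 h \<epsilon> by (intro mult_left_mono) auto
      also have "\<dots> = \<epsilon> * (a - \<epsilon>) * c" by (simp add: hT[symmetric])
      finally have "?e a \<omega> \<le> exp (\<epsilon> * (a - \<epsilon>) * c + (a - \<epsilon>) * h * S \<omega>)"
        by (simp add: algebra_simps)
      then have "?e a \<omega> \<le> ?v * ?e (a - \<epsilon>) \<omega>" by (simp only: exp_add)
      moreover have "0 \<le> ?u * indicator ?X \<omega>" "0 \<le> ?w * ?e (a + \<epsilon>) \<omega>" by auto
      ultimately show ?thesis by linarith
    next
      case 2
      have "a * h * S \<omega> \<le> a * h * ((a + \<epsilon>) * T)" using 2 a h by (intro mult_left_mono) auto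
      also have "\<dots> = (a\<^sup>2 + a * \<epsilon>) * c" by (simp add: hT[symmetric] power2_eq_square algebra_simps)
      finally have "?e a \<omega> \<le> ?u" by simp
      moreover have ind: "indicator ?X \<omega> = (1 :: real)" using 2 \<omega> by simp
      moreover have "0 \<le> ?v * ?e (a - \<epsilon>) \<omega>" "0 \<le> ?w * ?e (a + \<epsilon>) \<omega>" by auto
      ultimately show ?thesis unfolding ind by linarith
    next
      case 3
      have "\<epsilon> * h * ((a + \<epsilon>) * T) \<le> \<epsilon> * h * S \<omega>" using 3 h \<epsilon> by (intro mult_left_mono) auto
      moreover have "\<epsilon> * h * ((a + \<epsilon>) * T) = \<epsilon> * (a + \<epsilon>) * c" by (simp add: hT[symmetric])
      ultimately have "?e a \<omega> \<le> exp (- \<epsilon> * (a + \<epsilon>) * c + (a + \<epsilon>) * h * S \<omega>)"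
        by (simp add: algebra_simps)
      then have "?e a \<omega> \<le> ?w * ?e (a + \<epsilon>) \<omega>" by (simp only: exp_add)
      moreover have "0 \<le> ?u * indicator ?X \<omega>" "0 \<le> ?v * ?e (a - \<epsilon>) \<omega>" by auto
      ultimately show ?thesis by linarith
    qed
  qed
  have X: "?X \<in> events" by measurable
  have iX: "integrable M (\<lambda>\<omega>. ?u * indicator ?X \<omega>)"
    by (intro integrable_mult_right integrable_real_indicator X) (simp add: emeasure_eq_measure)
  have "exp ((a\<^sup>2 / 2 - \<eta>) * c) \<le> expectation (\<lambda>\<omega>. ?e a \<omega>)" by (rule lo)
  also have "\<dots> \<le> expectation (\<lambda>\<omega>. ?u * indicator ?X \<omega> + ?v * ?e (a - \<epsilon>) \<omega> + ?w * ?e (a + \<epsilon>) \<omega>)"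
    by (intro integral_mono Bochner_Integration.integrable_add integrable_mult_right int iX pt)
  also have "\<dots> = ?u * prob ?X + ?v * expectation (\<lambda>\<omega>. ?e (a - \<epsilon>) \<omega>) + ?w * expectation (\<lambda>\<omega>. ?e (a + \<epsilon>) \<omega>)"
    using int iX X by (subst Bochner_Integration.integral_add, simp_all)+
  also have "\<dots> \<le> ?u * prob ?X + ?v * exp (((a - \<epsilon>)\<^sup>2 / 2 + \<eta>) * c) + ?w * exp (((a + \<epsilon>)\<^sup>2 / 2 + \<eta>) * c)"
    using up by (intro add_mono mult_left_mono order_refl) auto
  \<comment> \<open>Completing the square: both outer parts lose \<epsilon>^2 / 2 in the exponent
    against a^2 / 2, so the mass of the tilted law sits in the window once \<eta> is small.\<close>
  also have "?v * exp (((a - \<epsilon>)\<^sup>2 / 2 + \<eta>) * c) = exp ((a\<^sup>2 / 2 - \<epsilon>\<^sup>2 / 2 + \<eta>) * c)"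
    unfolding exp_add[symmetric] by (rule arg_cong[of _ _ exp]) (simp add: power2_eq_square field_simps)
  also have "?w * exp (((a + \<epsilon>)\<^sup>2 / 2 + \<eta>) * c) = exp ((a\<^sup>2 / 2 - \<epsilon>\<^sup>2 / 2 + \<eta>) * c)"
    unfolding exp_add[symmetric] by (rule arg_cong[of _ _ exp]) (simp add: power2_eq_square field_simps)
  finally show ?thesis by linarith
qed

lemma prob_ge_chernoff:
  fixes S :: "'a \<Rightarrow> real"
  assumes S: "random_variable borel S" "integrable M (\<lambda>\<omega>. exp (l * S \<omega>))" and l: "0 \<le> l"
    and E: "expectation (\<lambda>\<omega>. exp (l * S \<omega>)) \<le> K"
  shows "prob {\<omega> \<in> space M. s \<le> S \<omega>} \<le> exp (- (l * s)) * K"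
proof -
  note [measurable] = S(1)
  have "prob {\<omega> \<in> space M. s \<le> S \<omega>} \<le> prob {\<omega> \<in> space M. exp (l * s) \<le> exp (l * S \<omega>)}"
    using l by (intro finite_measure_mono) (auto intro: mult_left_mono)
  also have "\<dots> \<le> expectation (\<lambda>\<omega>. exp (l * S \<omega>)) / exp (l * s)"
    by (rule integral_Markov_inequality_measure[OF S(2) sets.empty_sets]) auto
  also have "\<dots> \<le> K / exp (l * s)" using E by (intro divide_right_mono) auto
  finally show ?thesis by (simp add: exp_minus field_simps)
qed

lemma mgf_sum:
  fixes Y :: "'e \<Rightarrow> 'a \<Rightarrow> real"
  assumes J: "finite J" and ind: "indep_vars (\<lambda>_. borel) Y J"
    and bdd: "\<And>j \<omega>. j \<in> J \<Longrightarrow> \<omega> \<in> space M \<Longrightarrow> \<bar>Y j \<omega>\<bar> \<le> B"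
  shows "integrable M (\<lambda>\<omega>. exp (l * (\<Sum>j\<in>J. Y j \<omega>)))"
    and "\<lbrakk>\<And>j. j \<in> J \<Longrightarrow> expectation (\<lambda>\<omega>. exp (l * Y j \<omega>)) \<le> exp u\<rbrakk> \<Longrightarrow>
      expectation (\<lambda>\<omega>. exp (l * (\<Sum>j\<in>J. Y j \<omega>))) \<le> exp (u * card J)"
    and "\<lbrakk>\<And>j. j \<in> J \<Longrightarrow> exp u \<le> expectation (\<lambda>\<omega>. exp (l * Y j \<omega>))\<rbrakk> \<Longrightarrow>
      exp (u * card J) \<le> expectation (\<lambda>\<omega>. exp (l * (\<Sum>j\<in>J. Y j \<omega>)))"
proof -
  have ex: "exp (l * (\<Sum>j\<in>J. Y j \<omega>)) = (\<Prod>j\<in>J. exp (l * Y j \<omega>))" for \<omega>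
    using J by (simp add: exp_sum sum_distrib_left)
  have ind': "indep_vars (\<lambda>_. borel) (\<lambda>j \<omega>. exp (l * Y j \<omega>)) J"
    by (rule indep_vars_compose2[OF ind]) simp
  have int: "integrable M (\<lambda>\<omega>. exp (l * Y j \<omega>))" if j: "j \<in> J" for j
  proof (rule integrable_const_bound[of _ "exp (\<bar>l\<bar> * B)"])
    show "random_variable borel (\<lambda>\<omega>. exp (l * Y j \<omega>))" using ind' j by (simp add: indep_vars_def)
    have "l * Y j \<omega> \<le> \<bar>l\<bar> * B" if "\<omega> \<in> space M" for \<omega>
    proof -
      have "l * Y j \<omega> \<le> \<bar>l\<bar> * \<bar>Y j \<omega>\<bar>" by (metis abs_ge_self abs_mult)
      also have "\<dots> \<le> \<bar>l\<bar> * B" by (intro mult_left_mono bdd j that) simp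
      finally show ?thesis .
    qed
    then show "AE \<omega> in M. norm (exp (l * Y j \<omega>)) \<le> exp (\<bar>l\<bar> * B)" by (intro AE_I2) simp
  qed
  show "integrable M (\<lambda>\<omega>. exp (l * (\<Sum>j\<in>J. Y j \<omega>)))"
    unfolding ex by (rule indep_vars_integrable[OF J ind' int])
  have E: "expectation (\<lambda>\<omega>. exp (l * (\<Sum>j\<in>J. Y j \<omega>))) = (\<Prod>j\<in>J. expectation (\<lambda>\<omega>. exp (l * Y j \<omega>)))"
    unfolding ex by (rule indep_vars_lebesgue_integral[OF J ind' int])
  have pow: "(\<Prod>j\<in>J. exp u) = exp (u * card J)" for u :: real
    by (simp add: mult.commute flip: exp_of_nat_mult)
  show "expectation (\<lambda>\<omega>. exp (l * (\<Sum>j\<in>J. Y j \<omega>))) \<le> exp (u * card J)"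
    if "\<And>j. j \<in> J \<Longrightarrow> expectation (\<lambda>\<omega>. exp (l * Y j \<omega>)) \<le> exp u"
    unfolding E pow[symmetric] using that by (intro prod_mono conjI Bochner_Integration.integral_nonneg) auto
  show "exp (u * card J) \<le> expectation (\<lambda>\<omega>. exp (l * (\<Sum>j\<in>J. Y j \<omega>)))"
    if "\<And>j. j \<in> J \<Longrightarrow> exp u \<le> expectation (\<lambda>\<omega>. exp (l * Y j \<omega>))"
    unfolding E pow[symmetric] using that by (intro prod_mono conjI) auto
qed

end

section \<open>Degrees as sums over stars of edges\<close>

definition star :: "nat \<Rightarrow> nat \<Rightarrow> (nat \<times> nat) set" where
  "star m i = {e \<in> upper_pairs m. fst e = i \<or> snd e = i}"

lemma star_subset: "star m i \<subseteq> upper_pairs m"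
  by (auto simp: star_def)

lemma finite_star [simp]: "finite (star m i)"
  by (rule finite_subset[OF star_subset]) simp

lemma bij_betw_star:
  assumes "i < m"
  shows "bij_betw (\<lambda>j. (min i j, max i j)) ({..<m} - {i}) (star m i)"
proof (rule bij_betwI')
  fix x y assume "x \<in> {..<m} - {i}" "y \<in> {..<m} - {i}"
  then show "((min i x, max i x) = (min i y, max i y)) = (x = y)" by (auto simp: min_def max_def split: if_splits)
next
  fix x assume "x \<in> {..<m} - {i}"
  then show "(min i x, max i x) \<in> star m i" using assms
    by (auto simp: star_def upper_pairs_def min_def max_def)
next
  fix e assume "e \<in> star m i"
  then obtain a b where e: "e = (a, b)" "a < b" "b < m" "a = i \<or> b = i"
    by (cases e) (auto simp: star_def upper_pairs_def)
  then show "\<exists>x\<in>{..<m} - {i}. e = (min i x, max i x)"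
    by (intro bexI[of _ "if a = i then b else a"]) (auto simp: min_def max_def)
qed

lemma card_star: "i < m \<Longrightarrow> card (star m i) = m - 1"
  using bij_betw_same_card[OF bij_betw_star] by fastforce

lemma sum_star:
  assumes "i < m"
  shows "(\<Sum>j\<in>{..<m} - {i}. sym_ext z i j) = (\<Sum>e\<in>star m i. z e)"
proof -
  have "(\<Sum>e\<in>star m i. z e) = (\<Sum>j\<in>{..<m} - {i}. z (min i j, max i j))"
    by (rule sum.reindex_bij_betw[OF bij_betw_star[OF assms], symmetric])
  also have "\<dots> = (\<Sum>j\<in>{..<m} - {i}. sym_ext z i j)"
    by (rule sum.cong) (auto simp: sym_ext_def min_def max_def)
  finally show ?thesis by simp
qed

text \<open>The stars of two vertices share the edge between them. Among the vertices below
  \<open>k\<close>, only the edges to vertices from \<open>k\<close> on form disjoint sets.\<close>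

lemma star_split:
  assumes "i < k" "k \<le> m"
  shows "star m i = star k i \<union> {i} \<times> {k..<m}" "star k i \<inter> {i} \<times> {k..<m} = {}"
  using assms by (auto simp: star_def upper_pairs_def)

context prob_space
begin

definition std_array :: "real \<Rightarrow> real \<Rightarrow> nat \<Rightarrow> (nat \<times> nat \<Rightarrow> 'a \<Rightarrow> real) \<Rightarrow> bool" where
  "std_array C p m Z \<longleftrightarrow> indep_vars (\<lambda>_. borel) Z (upper_pairs m) \<and> (\<forall>e\<in>upper_pairs m. std_moments C p (Z e))"

lemma indep_vars_trunc:
  assumes "std_array C p m Z"
  shows "indep_vars (\<lambda>_. borel) (\<lambda>e \<omega>. trunc B (Z e \<omega>)) (upper_pairs m)"
proof -
  have "indep_vars (\<lambda>_. borel) Z (upper_pairs m)" using assms by (simp add: std_array_def)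
  then show ?thesis by (rule indep_vars_compose2) simp
qed

lemma random_variable_sum_trunc:
  assumes "std_array C p m Z" "J \<subseteq> upper_pairs m"
  shows "random_variable borel (\<lambda>\<omega>. \<Sum>e\<in>J. trunc B (Z e \<omega>))"
proof (rule borel_measurable_sum)
  fix e assume "e \<in> J"
  then have [measurable]: "random_variable borel (Z e)"
    using assms unfolding std_array_def std_moments_def by blast
  show "random_variable borel (\<lambda>\<omega>. trunc B (Z e \<omega>))" by measurable
qed

text \<open>The edge set J stays arbitrary because it is used for full stars, for stars inside the
  first vertices and for the remaining rows.\<close>

lemma mgf_trunc_sum:
  assumes p: "p > 6" and C: "C > 0" and A: "A > 0" and \<eta>: "\<eta> > 0"
  shows "\<forall>\<^sub>F m in sequentially. \<forall>Z J a. std_array C p m Z \<longrightarrow> J \<subseteq> upper_pairs m \<longrightarrow> \<bar>a\<bar> \<le> A \<longrightarrow>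
    (let X = (\<lambda>\<omega>. exp (a * sqrt (ln m / m) * (\<Sum>e\<in>J. trunc (m powr (1 / 3)) (Z e \<omega>)))) in
      integrable M X \<and> exp ((a\<^sup>2 / 2 - \<eta>) * (ln m / m) * card J) \<le> expectation X \<and>
      expectation X \<le> exp ((a\<^sup>2 / 2 + \<eta>) * (ln m / m) * card J))"
  using mgf_trunc[OF p C A \<eta>]
proof eventually_elim
  case (elim m)
  show ?case
  proof (intro allI impI)
    fix Z J a
    assume Z: "std_array C p m Z" and J: "J \<subseteq> upper_pairs m" and a: "\<bar>a\<bar> \<le> A"
    let ?h = "sqrt (ln (real m) / real m)" and ?B = "real m powr (1 / 3)"
    have fin: "finite J" by (rule finite_subset[OF J]) simp
    have ind: "indep_vars (\<lambda>_. borel) (\<lambda>e \<omega>. trunc ?B (Z e \<omega>)) J"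
      by (rule indep_vars_subset[OF indep_vars_trunc[OF Z] J])
    have bdd: "\<bar>trunc ?B (Z e \<omega>)\<bar> \<le> ?B" for e \<omega> by (rule abs_trunc_le) simp
    have E: "exp ((a\<^sup>2 / 2 - \<eta>) * (ln m / m)) \<le> expectation (\<lambda>\<omega>. exp (a * ?h * trunc ?B (Z e \<omega>)))"
        "expectation (\<lambda>\<omega>. exp (a * ?h * trunc ?B (Z e \<omega>))) \<le> exp ((a\<^sup>2 / 2 + \<eta>) * (ln m / m))" if "e \<in> J" for e
    proof -
      have "std_moments C p (Z e)" using Z J that unfolding std_array_def by blast
      then show "exp ((a\<^sup>2 / 2 - \<eta>) * (ln m / m)) \<le> expectation (\<lambda>\<omega>. exp (a * ?h * trunc ?B (Z e \<omega>)))"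
        "expectation (\<lambda>\<omega>. exp (a * ?h * trunc ?B (Z e \<omega>))) \<le> exp ((a\<^sup>2 / 2 + \<eta>) * (ln m / m))"
        using elim[rule_format, of "Z e" a] a unfolding Let_def by blast+
    qed
    note mgf = mgf_sum[where Y = "\<lambda>e \<omega>. trunc ?B (Z e \<omega>)" and l = "a * ?h", OF fin ind bdd]
    show "let X = (\<lambda>\<omega>. exp (a * ?h * (\<Sum>e\<in>J. trunc ?B (Z e \<omega>)))) in
        integrable M X \<and> exp ((a\<^sup>2 / 2 - \<eta>) * (ln m / m) * card J) \<le> expectation X \<and>
        expectation X \<le> exp ((a\<^sup>2 / 2 + \<eta>) * (ln m / m) * card J)"
      unfolding Let_def by (intro conjI mgf(1) mgf(3)[OF E(1)] mgf(2)[OF E(2)])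
  qed
qed

lemma sqrt_quotient_mult:
  assumes "real m > 0" "c \<ge> 0"
  shows "sqrt (c / m) * sqrt (m * c) = c"
proof -
  have "sqrt (c / m) * sqrt (m * c) = sqrt ((c / m) * (m * c))" by (rule real_sqrt_mult[symmetric])
  also have "(c / m) * (m * c) = c\<^sup>2" using assms by (simp add: power2_eq_square)
  finally show ?thesis using assms by simp
qed

text \<open>Chernoff's bound with parameter a = sqrt 2 + \<epsilon> gives failure probability at
  most m^(-(1 + \<epsilon>)) for one degree, summable over the m vertices.\<close>

lemma whp_degrees_upper:
  assumes p: "p > 6" and C: "C > 0" and \<epsilon>: "\<epsilon> > 0" and \<gamma>: "\<gamma> > 0"
  shows "\<forall>\<^sub>F m in sequentially. \<forall>Z. std_array C p m Z \<longrightarrow>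
    whp \<gamma> (\<lambda>\<omega>. \<forall>i<m. (\<Sum>e\<in>star m i. trunc (m powr (1 / 3)) (Z e \<omega>)) \<le> (sqrt 2 + \<epsilon>) * sqrt (m * ln m))"
proof -
  define a where "a = sqrt 2 + \<epsilon>"
  have a: "a > 0" using \<epsilon> by (simp add: a_def add_pos_pos)
  \<comment> \<open>With this rational bound a^2 / 2 exceeds 1 + 5/4 \<epsilon>, so that an accuracy
    \<epsilon> / 4 of the generating function still leaves 1 + \<epsilon>.\<close>
  have sq2: "sqrt 2 \<ge> 5 / 4" by (rule real_le_rsqrt) (simp add: power2_eq_square)
  have "\<epsilon> * (5 / 4) \<le> \<epsilon> * sqrt 2" using sq2 \<epsilon> by (intro mult_left_mono) auto
  moreover have "a\<^sup>2 = 2 + 2 * (\<epsilon> * sqrt 2) + \<epsilon>\<^sup>2" by (simp add: a_def power2_eq_square algebra_simps)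
  moreover have "0 \<le> \<epsilon>\<^sup>2" by simp
  ultimately have a2: "- a\<^sup>2 / 2 + \<epsilon> / 4 \<le> - (1 + \<epsilon>)" by linarith
  have "\<epsilon> / 4 > 0" using \<epsilon> by simp
  note mgf_trunc_sum[OF p C a this]
  moreover have "\<forall>\<^sub>F m in sequentially. real m * exp (- (1 + \<epsilon>) * ln (real m)) < \<gamma>" using \<epsilon> \<gamma> by real_asymp
  moreover have "\<forall>\<^sub>F m :: nat in sequentially. m \<ge> 2" by (rule eventually_ge_at_top)
  ultimately show ?thesis
  proof eventually_elim
    case (elim m)
    define c where "c = ln (real m)"
    have c: "c > 0" "real m > 0" using elim(3) by (auto simp: c_def)
    let ?h = "sqrt (c / m)" and ?B = "real m powr (1 / 3)" and ?T = "sqrt (m * c)"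
    have hT: "?h * ?T = c" using c by (intro sqrt_quotient_mult) auto
    show ?case
    proof (intro allI impI)
      fix Z assume Z: "std_array C p m Z"
      have one: "whp (exp (- (1 + \<epsilon>) * c)) (\<lambda>\<omega>. (\<Sum>e\<in>star m i. trunc ?B (Z e \<omega>)) \<le> a * ?T)" if i: "i < m" for i
      proof -
        let ?S = "\<lambda>\<omega>. \<Sum>e\<in>star m i. trunc ?B (Z e \<omega>)"
        have rv [measurable]: "random_variable borel ?S" by (rule random_variable_sum_trunc[OF Z star_subset])
        have int: "integrable M (\<lambda>\<omega>. exp (a * ?h * ?S \<omega>))"
          and up: "expectation (\<lambda>\<omega>. exp (a * ?h * ?S \<omega>)) \<le> exp ((a\<^sup>2 / 2 + \<epsilon> / 4) * (c / m) * card (star m i))"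
          using elim(1)[rule_format, OF Z star_subset, of a i] a unfolding Let_def c_def[symmetric] by auto
        have "(a\<^sup>2 / 2 + \<epsilon> / 4) * (c / m) * card (star m i) \<le> (a\<^sup>2 / 2 + \<epsilon> / 4) * (c / m) * m"
          using i c \<epsilon> by (intro mult_left_mono) (auto simp: card_star)
        then have "(a\<^sup>2 / 2 + \<epsilon> / 4) * (c / m) * card (star m i) \<le> (a\<^sup>2 / 2 + \<epsilon> / 4) * c" using c by simp
        then have up': "expectation (\<lambda>\<omega>. exp (a * ?h * ?S \<omega>)) \<le> exp ((a\<^sup>2 / 2 + \<epsilon> / 4) * c)"
          using up by (meson exp_le_cancel_iff order_trans)
        have "prob {\<omega> \<in> space M. a * ?T \<le> ?S \<omega>} \<le> exp (- (a * ?h * (a * ?T))) * exp ((a\<^sup>2 / 2 + \<epsilon> / 4) * c)"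
          by (rule prob_ge_chernoff[OF rv int _ up']) (use a c in simp)
        also have "a * ?h * (a * ?T) = a\<^sup>2 * c" using hT by (simp add: power2_eq_square)
        also have "exp (- (a\<^sup>2 * c)) * exp ((a\<^sup>2 / 2 + \<epsilon> / 4) * c) = exp ((- a\<^sup>2 / 2 + \<epsilon> / 4) * c)"
          unfolding exp_add[symmetric] by (rule arg_cong[of _ _ exp]) (simp add: field_simps)
        also have "\<dots> \<le> exp (- (1 + \<epsilon>) * c)" using a2 c by (simp only: exp_le_cancel_iff) (intro mult_right_mono, auto)
        finally have pr: "prob {\<omega> \<in> space M. a * ?T \<le> ?S \<omega>} \<le> exp (- (1 + \<epsilon>) * c)" .
        show ?thesis
        proof (rule whp_event)
          show "{\<omega> \<in> space M. \<not> ?S \<omega> \<le> a * ?T} \<in> events" by measurable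
          have "prob {\<omega> \<in> space M. \<not> ?S \<omega> \<le> a * ?T} \<le> prob {\<omega> \<in> space M. a * ?T \<le> ?S \<omega>}"
            by (rule finite_measure_mono) auto
          then show "prob {\<omega> \<in> space M. \<not> ?S \<omega> \<le> a * ?T} \<le> exp (- (1 + \<epsilon>) * c)" using pr by linarith
        qed
      qed
      have "whp (\<Sum>i\<in>{..<m}. exp (- (1 + \<epsilon>) * c)) (\<lambda>\<omega>. \<forall>i\<in>{..<m}. (\<Sum>e\<in>star m i. trunc ?B (Z e \<omega>)) \<le> a * ?T)"
        by (rule whp_ball) (use one in auto)
      then show "whp \<gamma> (\<lambda>\<omega>. \<forall>i<m. (\<Sum>e\<in>star m i. trunc ?B (Z e \<omega>)) \<le> (sqrt 2 + \<epsilon>) * sqrt (m * ln m))"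
      proof (rule whp_mono)
        show "(\<Sum>i\<in>{..<m}. exp (- (1 + \<epsilon>) * c)) \<le> \<gamma>" using elim(2) by (simp add: c_def)
      qed (auto simp: a_def c_def)
    qed
  qed
qed

text \<open>By independence the probability of no success is at most (1 - q)^k <= exp (- q
  k).\<close>

lemma prob_none_le:
  fixes S :: "nat \<Rightarrow> 'a \<Rightarrow> real"
  assumes ind: "indep_vars (\<lambda>_. borel) S {..<k}" and k: "k > 0"
    and q: "\<And>i. i < k \<Longrightarrow> q \<le> prob {\<omega> \<in> space M. t \<le> S i \<omega>}"
  shows "whp (exp (- (q * k))) (\<lambda>\<omega>. \<exists>i<k. t \<le> S i \<omega>)"
proof (rule whp_event)
  have rv [measurable]: "random_variable borel (S i)" if "i < k" for i
    using ind that by (auto simp: indep_vars_def)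
  have eq: "{\<omega> \<in> space M. \<not> (\<exists>i<k. t \<le> S i \<omega>)} = (\<Inter>i\<in>{..<k}. S i -` {..<t} \<inter> space M)"
    using k by (auto simp: not_le)
  have ev: "S i -` {..<t} \<inter> space M \<in> events" if "i < k" for i
    using rv[OF that] by (rule measurable_sets) simp
  show "{\<omega> \<in> space M. \<not> (\<exists>i<k. t \<le> S i \<omega>)} \<in> events"
    unfolding eq using k ev by (intro sets.finite_INT) auto
  have one: "prob (S i -` {..<t} \<inter> space M) \<le> exp (- q)" if i: "i < k" for i
  proof -
    have X: "{\<omega> \<in> space M. t \<le> S i \<omega>} \<in> events" using rv[OF i] by measurable
    have "S i -` {..<t} \<inter> space M = space M - {\<omega> \<in> space M. t \<le> S i \<omega>}" by auto
    then have "prob (S i -` {..<t} \<inter> space M) = 1 - prob {\<omega> \<in> space M. t \<le> S i \<omega>}"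
      using prob_compl[OF X] by simp
    also have "\<dots> \<le> 1 + (- q)" using q[OF i] by simp
    also have "\<dots> \<le> exp (- q)" by (rule exp_ge_add_one_self)
    finally show ?thesis .
  qed
  have "prob (\<Inter>i\<in>{..<k}. S i -` {..<t} \<inter> space M) = (\<Prod>i\<in>{..<k}. prob (S i -` {..<t} \<inter> space M))"
    using k by (intro indep_varsD_finite[OF ind]) auto
  also have "\<dots> \<le> (\<Prod>i\<in>{..<k}. exp (- q))"
    by (rule prod_mono) (use one in auto)
  also have "\<dots> = exp (- (q * k))" using exp_of_nat_mult[of k "- q"] by (simp add: mult.commute)
  finally show "prob {\<omega> \<in> space M. \<not> (\<exists>i<k. t \<le> S i \<omega>)} \<le> exp (- (q * k))" unfolding eq .
qed

lemma indep_vars_row_sums: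
  assumes Z: "std_array C p m Z" and k: "k \<le> m"
  shows "indep_vars (\<lambda>_. borel) (\<lambda>i \<omega>. \<Sum>e\<in>{i} \<times> {k..<m}. trunc B (Z e \<omega>)) {..<k}"
proof -
  let ?K = "\<lambda>i. {i} \<times> {k..<m}"
  have "indep_vars (\<lambda>i. PiM (?K i) (\<lambda>_. borel)) (\<lambda>i \<omega>. restrict (\<lambda>e. trunc B (Z e \<omega>)) (?K i)) {..<k}"
    by (rule indep_vars_restrict[OF indep_vars_trunc[OF Z]])
      (auto simp: upper_pairs_def disjoint_family_on_def)
  then have "indep_vars (\<lambda>_. borel) (\<lambda>i \<omega>. \<Sum>e\<in>?K i. restrict (\<lambda>e. trunc B (Z e \<omega>)) (?K i) e) {..<k}"
    by (rule indep_vars_compose2) (auto intro!: borel_measurable_sum measurable_component_singleton)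
  moreover have "(\<lambda>i \<omega>. \<Sum>e\<in>?K i. restrict (\<lambda>e. trunc B (Z e \<omega>)) (?K i) e) = (\<lambda>i \<omega>. \<Sum>e\<in>?K i. trunc B (Z e \<omega>))"
    by (intro ext sum.cong) auto
  ultimately show ?thesis by simp
qed

text \<open>Among the first k, about \<theta> m, vertices, the sums over edges leaving this set are
  independent. Each is large with probability at least m^(-(1 - 2 \<epsilon>)) / 2, so about m^(2
  \<epsilon>) successes are expected. The edges inside the set are few enough that with high
  probability they cost no vertex more than \<epsilon> T.\<close>

lemma whp_degrees_lower:
  assumes p: "p > 6" and C: "C > 0" and \<epsilon>: "0 < \<epsilon>" "\<epsilon> \<le> 1 / 10" and \<gamma>: "\<gamma> > 0"
  shows "\<forall>\<^sub>F m in sequentially. \<forall>Z. std_array C p m Z \<longrightarrow>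
    whp \<gamma> (\<lambda>\<omega>. \<exists>i<m. (sqrt 2 - 6 * \<epsilon>) * sqrt (m * ln m) \<le> (\<Sum>e\<in>star m i. trunc (m powr (1 / 3)) (Z e \<omega>)))"
proof -
  \<comment> \<open>Tilting loses one \<epsilon> and the discarded edges another, which leads to
    sqrt 2 - 6 \<epsilon>. The distance 4 \<epsilon> makes \<open>expo\<close> hold.\<close>
  define a where "a = sqrt 2 - 4 * \<epsilon>"
  \<comment> \<open>Small for two reasons: rows shortened by \<theta> m cost at most \<epsilon>^2 /
    32 in the exponent, and with slope 32 / \<epsilon> the generating function of an inner star has
    exponent (32 / \<epsilon>)^2 / 2 times \<theta>, which is 16, plus at most 1.\<close>
  define \<theta> where "\<theta> = \<epsilon>\<^sup>2 / 32"
  \<comment> \<open>Large enough for every parameter used: a, a - \<epsilon>, a + \<epsilon> and the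
    slope 32 / \<epsilon> for the inner edges.\<close>
  define A where "A = 2 + 32 / \<epsilon>"
  have sq2: "5 / 4 \<le> sqrt 2" "sqrt 2 \<le> 3 / 2"
    by (rule real_le_rsqrt, simp add: power2_eq_square) (rule real_le_lsqrt, simp_all add: power2_eq_square)
  have a: "0 \<le> a" "a \<le> 3 / 2" using sq2 \<epsilon> by (auto simp: a_def)
  have \<epsilon>2: "\<epsilon>\<^sup>2 \<le> \<epsilon> / 10" "\<epsilon>\<^sup>2 > 0" using \<epsilon> by (auto simp: power2_eq_square)
  have a2: "a\<^sup>2 = 2 - 8 * (\<epsilon> * sqrt 2) + 16 * \<epsilon>\<^sup>2" "a * \<epsilon> = \<epsilon> * sqrt 2 - 4 * \<epsilon>\<^sup>2"
    by (simp_all add: a_def power2_eq_square algebra_simps)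
  have e2: "\<epsilon> * (5 / 4) \<le> \<epsilon> * sqrt 2" using sq2 \<epsilon> by (intro mult_left_mono) auto
  have a2le: "a\<^sup>2 / 2 \<le> 1" using a2(1) e2 \<epsilon>2 \<epsilon> by linarith
  \<comment> \<open>The power of 1/m that tilting yields for the success probability. It must stay
    below 1 for a success among order m trials.\<close>
  have expo: "a\<^sup>2 / 2 + a * \<epsilon> + \<epsilon>\<^sup>2 / 8 \<le> 1 - 2 * \<epsilon>" using a2 e2 \<epsilon>2 \<epsilon> by linarith
  have \<theta>: "0 < \<theta>" "\<theta> \<le> 1" using \<epsilon>2 \<epsilon> by (auto simp: \<theta>_def)
  have A: "A > 0" "\<bar>a\<bar> \<le> A" "\<bar>a - \<epsilon>\<bar> \<le> A" "\<bar>a + \<epsilon>\<bar> \<le> A" "\<bar>- (32 / \<epsilon>)\<bar> \<le> A"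
    using a \<epsilon> by (auto simp: A_def abs_le_iff add_pos_pos intro: order_trans[of _ 2])
  have "\<epsilon>\<^sup>2 / 16 > 0" using \<epsilon>2 by simp
  note mgf_trunc_sum[OF p C A(1) this]
  moreover have "\<forall>\<^sub>F m in sequentially. exp (- (\<theta> / 4 * exp (2 * \<epsilon> * ln (real m)))) < \<gamma> / 2"
    using \<epsilon>(1) \<theta>(1) \<gamma> by real_asymp
  moreover have "\<forall>\<^sub>F m in sequentially. 2 * exp (- (\<epsilon>\<^sup>2 / 4) * ln (real m)) \<le> 1 / 2"
    using \<epsilon>(1) by real_asymp
  moreover have "\<forall>\<^sub>F m in sequentially. real m * exp (- 2 * ln (real m)) < \<gamma> / 2" using \<gamma> by real_asymp
  moreover have "\<forall>\<^sub>F m in sequentially. \<theta> * real m \<ge> 2" using \<theta>(1) by real_asymp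
  moreover have "\<forall>\<^sub>F m :: nat in sequentially. m \<ge> 2" by (rule eventually_ge_at_top)
  ultimately show ?thesis
  proof eventually_elim
    case (elim m)
    define c where "c = ln (real m)"
    define k where "k = nat \<lfloor>\<theta> * real m\<rfloor>"
    have c: "c > 0" "real m > 0" using elim(6) by (auto simp: c_def)
    have k: "real k \<le> \<theta> * real m" "\<theta> * real m - 1 \<le> real k" "k > 0"
      using elim(5) unfolding k_def by linarith+
    have "\<theta> * real m \<le> 1 * real m" using \<theta> by (intro mult_right_mono) auto
    then have km: "k \<le> m" using k(1) by linarith
    let ?h = "sqrt (c / m)" and ?B = "real m powr (1 / 3)" and ?T = "sqrt (m * c)"
    have hT: "?h * ?T = c" using c by (intro sqrt_quotient_mult) auto
    have h0: "0 \<le> ?h" "0 \<le> ?T" using c by auto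
    show ?case
    proof (intro allI impI)
      fix Z assume Z: "std_array C p m Z"
      let ?S = "\<lambda>J \<omega>. \<Sum>e\<in>J. trunc ?B (Z e \<omega>)"
      let ?J = "\<lambda>i. {i} \<times> {k..<m}"
      let ?q = "exp (- ((1 - 2 * \<epsilon>) * c)) / 2" and ?E = "\<lambda>b i. expectation (\<lambda>\<omega>. exp (b * ?h * ?S (?J i) \<omega>))"
      note mgf = elim(1)[rule_format, OF Z, unfolded Let_def, folded c_def]
      have q: "?q \<le> prob {\<omega> \<in> space M. (a - \<epsilon>) * ?T \<le> ?S (?J i) \<omega>}" if i: "i < k" for i
      proof -
        have J: "?J i \<subseteq> upper_pairs m" using i by (auto simp: upper_pairs_def)
        have card: "card (?J i) = m - k" by (simp add: card_cartesian_product)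
        have bdd: "\<bar>?S (?J i) \<omega>\<bar> \<le> card (?J i) * ?B" for \<omega>
          by (rule order_trans[OF sum_abs sum_bounded_above]) (auto intro: abs_trunc_le)
        have cm: "(c / m) * (m - k) \<le> c" using km c by (simp add: field_simps)
        have lo: "exp ((a\<^sup>2 / 2 - \<epsilon>\<^sup>2 / 8) * c) \<le> ?E a i"
        proof -
          have "(1 - \<theta>) * c \<le> (c / m) * (m - k)"
          proof -
            have "(c / m) * real k \<le> (c / m) * (\<theta> * m)" using k(1) c by (intro mult_left_mono) auto
            also have "\<dots> = \<theta> * c" using c by simp
            finally show ?thesis using km c by (simp add: of_nat_diff algebra_simps)
          qed
          moreover have "0 \<le> a\<^sup>2 / 2 - \<epsilon>\<^sup>2 / 16"
          proof -
            have "\<epsilon> \<le> a" using sq2 \<epsilon> by (simp add: a_def)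
            then have "\<epsilon>\<^sup>2 \<le> a\<^sup>2" using \<epsilon> by (intro power_mono) auto
            then show ?thesis using \<epsilon>2 by linarith
          qed
          ultimately have "(a\<^sup>2 / 2 - \<epsilon>\<^sup>2 / 16) * ((1 - \<theta>) * c) \<le> (a\<^sup>2 / 2 - \<epsilon>\<^sup>2 / 16) * ((c / m) * (m - k))"
            by (rule mult_left_mono)
          moreover have "(a\<^sup>2 / 2 - \<epsilon>\<^sup>2 / 8) * c \<le> (a\<^sup>2 / 2 - \<epsilon>\<^sup>2 / 16) * (1 - \<theta>) * c"
          proof (rule mult_right_mono)
            have "a\<^sup>2 / 2 - \<epsilon>\<^sup>2 / 16 \<le> 1" using a2le \<epsilon>2(2) by linarith
            then have "(a\<^sup>2 / 2 - \<epsilon>\<^sup>2 / 16) * \<theta> \<le> 1 * \<theta>" using \<theta> by (intro mult_right_mono) auto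
            then have "(a\<^sup>2 / 2 - \<epsilon>\<^sup>2 / 16) * \<theta> \<le> \<epsilon>\<^sup>2 / 32" by (simp add: \<theta>_def)
            then show "a\<^sup>2 / 2 - \<epsilon>\<^sup>2 / 8 \<le> (a\<^sup>2 / 2 - \<epsilon>\<^sup>2 / 16) * (1 - \<theta>)"
              using \<epsilon>2(2) unfolding right_diff_distrib mult_1_right by linarith
          qed (use c in simp)
          ultimately have "(a\<^sup>2 / 2 - \<epsilon>\<^sup>2 / 8) * c \<le> (a\<^sup>2 / 2 - \<epsilon>\<^sup>2 / 16) * (c / m) * card (?J i)"
            unfolding card mult.assoc by linarith
          then have "exp ((a\<^sup>2 / 2 - \<epsilon>\<^sup>2 / 8) * c) \<le> exp ((a\<^sup>2 / 2 - \<epsilon>\<^sup>2 / 16) * (c / m) * card (?J i))" by simp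
          also have "\<dots> \<le> ?E a i" using mgf[OF J A(2)] by blast
          finally show ?thesis .
        qed
        have up: "?E b i \<le> exp ((b\<^sup>2 / 2 + \<epsilon>\<^sup>2 / 8) * c)"
          if b: "b \<in> {a - \<epsilon>, a + \<epsilon>}" for b
        proof -
          have bA: "\<bar>b\<bar> \<le> A" using b A by auto
          have "?E b i \<le> exp ((b\<^sup>2 / 2 + \<epsilon>\<^sup>2 / 16) * (c / m) * card (?J i))"
            using mgf[OF J bA] by blast
          also have "(b\<^sup>2 / 2 + \<epsilon>\<^sup>2 / 16) * (c / m) * card (?J i) \<le> (b\<^sup>2 / 2 + \<epsilon>\<^sup>2 / 16) * c"
            unfolding card mult.assoc using cm by (intro mult_left_mono) auto
          also have "\<dots> \<le> (b\<^sup>2 / 2 + \<epsilon>\<^sup>2 / 8) * c" using c \<epsilon>2 by (intro mult_right_mono) auto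
          finally show ?thesis by simp
        qed
        let ?P = "prob {\<omega> \<in> space M. (a - \<epsilon>) * ?T \<le> ?S (?J i) \<omega>}"
        have "exp ((a\<^sup>2 / 2 - \<epsilon>\<^sup>2 / 8) * c) - 2 * exp ((a\<^sup>2 / 2 - \<epsilon>\<^sup>2 / 2 + \<epsilon>\<^sup>2 / 8) * c) \<le> exp ((a\<^sup>2 + a * \<epsilon>) * c) * ?P"
          by (rule prob_ge_tilting[OF random_variable_sum_trunc[OF Z J] bdd hT a(1) h0 less_imp_le[OF \<epsilon>(1)] lo up])
        moreover have "exp ((a\<^sup>2 / 2 - \<epsilon>\<^sup>2 / 2 + \<epsilon>\<^sup>2 / 8) * c) = exp ((a\<^sup>2 / 2 - \<epsilon>\<^sup>2 / 8) * c) * exp (- (\<epsilon>\<^sup>2 / 4) * c)"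
          unfolding exp_add[symmetric] by (rule arg_cong[of _ _ exp]) (simp add: field_simps)
        \<comment> \<open>The error terms are smaller than the leading one by a factor 2
          m^(-\<epsilon>^2/4), eventually at most 1/2.\<close>
        moreover have "exp ((a\<^sup>2 / 2 - \<epsilon>\<^sup>2 / 8) * c) * (2 * exp (- (\<epsilon>\<^sup>2 / 4) * c)) \<le> exp ((a\<^sup>2 / 2 - \<epsilon>\<^sup>2 / 8) * c) * (1 / 2)"
          using elim(3) unfolding c_def[symmetric] by (rule mult_left_mono) simp
        ultimately have "exp ((a\<^sup>2 / 2 - \<epsilon>\<^sup>2 / 8) * c) * (1 / 2) \<le> exp ((a\<^sup>2 + a * \<epsilon>) * c) * ?P" by linarith
        then have "exp (- ((a\<^sup>2 + a * \<epsilon>) * c)) * (exp ((a\<^sup>2 / 2 - \<epsilon>\<^sup>2 / 8) * c) * (1 / 2))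
            \<le> exp (- ((a\<^sup>2 + a * \<epsilon>) * c)) * (exp ((a\<^sup>2 + a * \<epsilon>) * c) * ?P)"
          by (rule mult_left_mono) simp
        also have "\<dots> = ?P" by (simp add: exp_minus)
        finally have P: "exp (- ((a\<^sup>2 + a * \<epsilon>) * c)) * (exp ((a\<^sup>2 / 2 - \<epsilon>\<^sup>2 / 8) * c) * (1 / 2)) \<le> ?P" .
        have "?q \<le> exp (- ((a\<^sup>2 / 2 + a * \<epsilon> + \<epsilon>\<^sup>2 / 8) * c)) / 2"
          using mult_right_mono[OF expo, of c] c by simp
        also have "exp (- ((a\<^sup>2 / 2 + a * \<epsilon> + \<epsilon>\<^sup>2 / 8) * c)) = exp (- ((a\<^sup>2 + a * \<epsilon>) * c)) * exp ((a\<^sup>2 / 2 - \<epsilon>\<^sup>2 / 8) * c)"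
          unfolding exp_add[symmetric] by (rule arg_cong[of _ _ exp]) (simp add: field_simps)
        finally show ?thesis using P by simp
      qed
      have W1: "whp (\<gamma> / 2) (\<lambda>\<omega>. \<exists>i<k. (a - \<epsilon>) * ?T \<le> ?S (?J i) \<omega>)"
      proof (rule whp_mono[OF prob_none_le[OF indep_vars_row_sums[OF Z km] k(3) q]])
        have "exp (2 * \<epsilon> * c) = exp (- ((1 - 2 * \<epsilon>) * c)) * exp c"
          unfolding exp_add[symmetric] by (rule arg_cong[of _ _ exp]) (simp add: algebra_simps)
        also have "exp c = real m" using c by (simp add: c_def)
        finally have "\<theta> / 4 * exp (2 * \<epsilon> * c) = ?q * (\<theta> * real m / 2)" by simp
        \<comment> \<open>Rounding \<theta> m down costs at most half of it, as \<theta> m >=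
          2.\<close>
        also have "\<dots> \<le> ?q * k"
          using k(2) elim(5) by (intro mult_left_mono) auto
        finally have "exp (- (?q * k)) \<le> exp (- (\<theta> / 4 * exp (2 * \<epsilon> * c)))"
          by simp
        also have "\<dots> \<le> \<gamma> / 2" using elim(2) unfolding c_def by (rule less_imp_le)
        finally show "exp (- (?q * k)) \<le> \<gamma> / 2" .
      qed
      have R: "whp (exp (- 2 * c)) (\<lambda>\<omega>. - (\<epsilon> * ?T) \<le> ?S (star k i) \<omega>)" if i: "i < k" for i
      proof -
        have J: "star k i \<subseteq> upper_pairs m" using km by (auto simp: star_def upper_pairs_def)
        have rv [measurable]: "random_variable borel (?S (star k i))" by (rule random_variable_sum_trunc[OF Z J])
        let ?b = "32 / \<epsilon>"
        have neg: "?b * ?h * - x = - ?b * ?h * x" for x by simp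
        have int: "integrable M (\<lambda>\<omega>. exp (?b * ?h * - ?S (star k i) \<omega>))"
          and up: "expectation (\<lambda>\<omega>. exp (?b * ?h * - ?S (star k i) \<omega>)) \<le> exp (((- ?b)\<^sup>2 / 2 + \<epsilon>\<^sup>2 / 16) * (c / m) * card (star k i))"
          unfolding neg using mgf[OF J A(5)] by blast+
        have "((- ?b)\<^sup>2 / 2 + \<epsilon>\<^sup>2 / 16) * (c / m) * card (star k i) \<le> ((- ?b)\<^sup>2 / 2 + \<epsilon>\<^sup>2 / 16) * (c / m) * (\<theta> * m)"
          using i k c by (intro mult_left_mono) (auto simp: card_star)
        also have "\<dots> = ((- ?b)\<^sup>2 / 2 * \<theta> + \<epsilon>\<^sup>2 / 16 * \<theta>) * c" using c by (simp add: field_simps)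
        also have "\<dots> \<le> (16 + 1) * c"
        proof (intro mult_right_mono add_mono)
          show "(- ?b)\<^sup>2 / 2 * \<theta> \<le> 16" using \<epsilon> by (simp add: \<theta>_def power_divide)
          have "\<epsilon>\<^sup>2 / 16 \<le> 1" using \<epsilon> \<epsilon>2 by linarith
          then have "\<epsilon>\<^sup>2 / 16 * \<theta> \<le> 1 * 1" using \<theta> by (intro mult_mono) auto
          then show "\<epsilon>\<^sup>2 / 16 * \<theta> \<le> 1" by simp
        qed (use c in simp)
        finally have "((- ?b)\<^sup>2 / 2 + \<epsilon>\<^sup>2 / 16) * (c / m) * card (star k i) \<le> 17 * c" by simp
        then have up': "expectation (\<lambda>\<omega>. exp (?b * ?h * - ?S (star k i) \<omega>)) \<le> exp (17 * c)"
          by (intro order_trans[OF up]) (simp only: exp_le_cancel_iff)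
        have rv': "random_variable borel (\<lambda>\<omega>. - ?S (star k i) \<omega>)" by measurable
        \<comment> \<open>The slope 32 / \<epsilon> gives the gain 32 c against the cost 17 c, more
          than the 2 c wanted for the union over the vertices.\<close>
        have "prob {\<omega> \<in> space M. \<epsilon> * ?T \<le> - ?S (star k i) \<omega>} \<le> exp (- (?b * ?h * (\<epsilon> * ?T))) * exp (17 * c)"
          by (rule prob_ge_chernoff[OF rv' int _ up']) (use \<epsilon> c in simp)
        also have "?b * ?h * (\<epsilon> * ?T) = 32 * c" using hT \<epsilon> by simp
        also have "exp (- (32 * c)) * exp (17 * c) \<le> exp (- 2 * c)" using c by (simp flip: exp_add)
        finally have pr: "prob {\<omega> \<in> space M. \<epsilon> * ?T \<le> - ?S (star k i) \<omega>} \<le> exp (- 2 * c)" .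
        show ?thesis
        proof (rule whp_event)
          show "{\<omega> \<in> space M. \<not> - (\<epsilon> * ?T) \<le> ?S (star k i) \<omega>} \<in> events" by measurable
          have "prob {\<omega> \<in> space M. \<not> - (\<epsilon> * ?T) \<le> ?S (star k i) \<omega>} \<le> prob {\<omega> \<in> space M. \<epsilon> * ?T \<le> - ?S (star k i) \<omega>}"
            by (rule finite_measure_mono) auto
          then show "prob {\<omega> \<in> space M. \<not> - (\<epsilon> * ?T) \<le> ?S (star k i) \<omega>} \<le> exp (- 2 * c)" using pr by linarith
        qed
      qed
      have "whp (\<Sum>i\<in>{..<k}. exp (- 2 * c)) (\<lambda>\<omega>. \<forall>i\<in>{..<k}. - (\<epsilon> * ?T) \<le> ?S (star k i) \<omega>)"
        by (rule whp_ball) (use R in auto)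
      then have W2: "whp (\<gamma> / 2) (\<lambda>\<omega>. \<forall>i\<in>{..<k}. - (\<epsilon> * ?T) \<le> ?S (star k i) \<omega>)"
      proof (rule whp_mono)
        have "(\<Sum>i\<in>{..<k}. exp (- 2 * c)) = real k * exp (- 2 * c)" by simp
        also have "\<dots> \<le> real m * exp (- 2 * c)" using km by (intro mult_right_mono) auto
        also have "\<dots> \<le> \<gamma> / 2" using elim(4) unfolding c_def by (rule less_imp_le)
        finally show "(\<Sum>i\<in>{..<k}. exp (- 2 * c)) \<le> \<gamma> / 2" .
      qed
      show "whp \<gamma> (\<lambda>\<omega>. \<exists>i<m. (sqrt 2 - 6 * \<epsilon>) * sqrt (m * ln m) \<le> ?S (star m i) \<omega>)"
      proof (rule whp_mono[OF whp_conj[OF W1 W2]])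
        fix \<omega>
        assume *: "(\<exists>i<k. (a - \<epsilon>) * ?T \<le> ?S (?J i) \<omega>) \<and> (\<forall>i\<in>{..<k}. - (\<epsilon> * ?T) \<le> ?S (star k i) \<omega>)"
        then obtain i where i: "i < k" "(a - \<epsilon>) * ?T \<le> ?S (?J i) \<omega>" by blast
        moreover have "- (\<epsilon> * ?T) \<le> ?S (star k i) \<omega>" using * i(1) by simp
        moreover have "?S (star m i) \<omega> = ?S (star k i) \<omega> + ?S (?J i) \<omega>"
          unfolding star_split(1)[OF i(1) km] by (rule sum.union_disjoint) (use star_split(2)[OF i(1) km] in simp_all)
        moreover have "(sqrt 2 - 6 * \<epsilon>) * ?T = (a - \<epsilon>) * ?T - \<epsilon> * ?T" by (simp add: a_def algebra_simps)
        ultimately have "(sqrt 2 - 6 * \<epsilon>) * ?T \<le> ?S (star m i) \<omega>" by linarith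
        then show "\<exists>i<m. (sqrt 2 - 6 * \<epsilon>) * sqrt (m * ln m) \<le> ?S (star m i) \<omega>"
          using i(1) km unfolding c_def by (intro exI[of _ i]) simp
      qed simp
    qed
  qed
qed

end

section \<open>The quadratic form of the off-diagonal part\<close>

context prob_space
begin

text \<open>Splits \<open>Z\<close> into its values up to a large constant \<open>B\<close> (bounded, Hoeffding), those between
  \<open>B\<close> and \<open>m\<^bsup>1/3\<^esup>\<close> (small variance, trace method), and those above \<open>m\<^bsup>1/3\<^esup>\<close> (absent with high
  probability since \<open>p > 6\<close>).\<close>

lemma whp_qform_std_array:
  assumes p: "p > 6" and C: "C > 0" and \<delta>: "\<delta> > 0" and \<gamma>: "\<gamma> > 0"
  shows "\<forall>\<^sub>F m in sequentially. \<forall>Z. std_array C p m Z \<longrightarrow>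
    whp \<gamma> (\<lambda>\<omega>. (\<forall>e\<in>upper_pairs m. \<bar>Z e \<omega>\<bar> \<le> m powr (1 / 3)) \<and>
      (form_le m (\<lambda>e. Z e \<omega>) (\<delta> * sqrt (m * ln m))))"
proof -
  define S where "S = (\<delta> / 3)\<^sup>2 * exp (-4) / 3"
  have S: "S > 0" using \<delta> by (simp add: S_def)
  have "\<forall>\<^sub>F B in at_top. C * B powr (-4) < S" using C S by real_asymp
  then have "\<forall>\<^sub>F B in at_top. C * B powr (-4) < S \<and> B \<ge> (1 :: real)"
    using eventually_ge_at_top[of "1 :: real"] by eventually_elim simp
  then obtain B where B: "C * B powr (-4) < S" "B \<ge> 1"
    using eventually_happens'[OF trivial_limit_at_top_linorder] by blast
  \<comment> \<open>The level B is chosen once, independently of m, so that the variance beyond B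
    fits the trace method; B >= 1 lets p > 6 replace the exponent by -4.\<close>
  have "C * B powr (2 - p) \<le> C * B powr (-4)" using C p B by (intro mult_left_mono powr_mono) auto
  then have CB: "C * B powr (2 - p) \<le> S" using B by linarith
  have pos: "2 * B > 0" "\<delta> / 3 > 0" "\<gamma> / 3 > 0" using B \<delta> \<gamma> by auto
  \<comment> \<open>At most m^2 entries, each above the level with probability at most C m^(-p/3),
    leave C m^(-d). This d is positive exactly because p > 6.\<close>
  define d where "d = p / 3 - 2"
  have d: "d > 0" using p by (simp add: d_def)
  note whp_qform_bounded[OF pos]
  moreover note whp_qform_small_variance[OF pos(2,3) S eq_refl[OF S_def]]
  moreover have "\<forall>\<^sub>F m in sequentially. C * real m powr (- d) < \<gamma> / 3" using C d \<gamma> by real_asymp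
  moreover have "\<forall>\<^sub>F m in sequentially. (real m)\<^sup>2 * (C * (real m powr (1 / 3)) powr (-5)) \<le> \<delta> / 3 * sqrt (m * ln m)"
    using C \<delta> by real_asymp
  moreover have "\<forall>\<^sub>F m in sequentially. B \<le> real m powr (1 / 3)" by real_asymp
  moreover have "\<forall>\<^sub>F m :: nat in sequentially. m \<ge> 2" by (rule eventually_ge_at_top)
  ultimately show ?thesis
  proof eventually_elim
    case (elim m)
    define B' where "B' = real m powr (1 / 3)"
    have "B \<le> B'" using elim(5) by (simp only: B'_def)
    then have B': "B \<le> B'" "B' \<ge> 1" "B' > 0" using B(2) by simp_all
    have m: "real m > 0" using elim(6) by simp
    show ?case
    proof (intro allI impI)
      fix Z assume Z: "std_array C p m Z"
      have ind: "indep_vars (\<lambda>_. borel) Z (upper_pairs m)" using Z by (simp add: std_array_def)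
      have std: "std_moments C p (Z e)" if "e \<in> upper_pairs m" for e using Z that by (simp add: std_array_def)
      have rv: "random_variable borel (Z e)" if "e \<in> upper_pairs m" for e using std[OF that] by (simp add: std_moments_def)
      define \<mu> where "\<mu> = (\<lambda>B e. expectation (\<lambda>\<omega>. trunc B (Z e \<omega>)))"
      define U where "U = (\<lambda>e \<omega>. trunc B (Z e \<omega>) - \<mu> B e)"
      \<comment> \<open>U and V are both centred, so where |Z| <= B' the entry is U + V plus the
        mean \<open>\<mu> B'\<close>, a deterministic matrix treated as bias.\<close>
      define V where "V = (\<lambda>e \<omega>. (trunc B' (Z e \<omega>) - trunc B (Z e \<omega>)) - (\<mu> B' e - \<mu> B e))"
      have it: "integrable M (\<lambda>\<omega>. trunc b (Z e \<omega>))" if "e \<in> upper_pairs m" "b > 0" for b e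
        using integrable_trunc_power[OF rv[OF that(1)] that(2), of 1] by simp
      have abs_\<mu>: "\<bar>expectation f\<bar> \<le> b" if "\<And>\<omega>. \<bar>f \<omega>\<bar> \<le> b" "integrable M f" for f :: "'a \<Rightarrow> real" and b
      proof -
        have "\<bar>expectation f\<bar> \<le> expectation (\<lambda>\<omega>. \<bar>f \<omega>\<bar>)" by (rule integral_abs_bound)
        also have "\<dots> \<le> expectation (\<lambda>_. b)" using that by (intro integral_mono) auto
        finally show ?thesis by (simp add: prob_space)
      qed
      have WU: "whp (\<gamma> / 3) (\<lambda>\<omega>. form_le m (\<lambda>e. U e \<omega>) (\<delta> / 3 * sqrt (m * ln m)))"
      proof (rule elim(1)[rule_format])
        show "indep_vars (\<lambda>_. borel) U (upper_pairs m)"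
          unfolding U_def by (rule indep_vars_compose2[OF ind]) simp
        fix e assume e: "e \<in> upper_pairs m"
        have i: "integrable M (\<lambda>\<omega>. trunc B (Z e \<omega>))" using it[OF e] B by simp
        show "expectation (U e) = 0" unfolding U_def \<mu>_def using i by (simp add: prob_space)
        have "\<bar>\<mu> B e\<bar> \<le> B" unfolding \<mu>_def by (rule abs_\<mu>[OF abs_trunc_le i]) (use B in simp)
        then show "\<bar>U e \<omega>\<bar> \<le> 2 * B" for \<omega>
          using abs_trunc_le[of B "Z e \<omega>"] B unfolding U_def by linarith
      qed
      have WV: "whp (\<gamma> / 3) (\<lambda>\<omega>. form_le m (\<lambda>e. V e \<omega>) (\<delta> / 3 * sqrt (m * ln m)))"
      proof (rule elim(2)[rule_format])
        show "indep_vars (\<lambda>_. borel) V (upper_pairs m)"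
          unfolding V_def by (rule indep_vars_compose2[OF ind]) simp
        fix e assume e: "e \<in> upper_pairs m"
        let ?D = "\<lambda>\<omega>. trunc B' (Z e \<omega>) - trunc B (Z e \<omega>)"
        note [measurable] = rv[OF e]
        have i: "integrable M (\<lambda>\<omega>. trunc B (Z e \<omega>))" "integrable M (\<lambda>\<omega>. trunc B' (Z e \<omega>))"
          using it[OF e] B B' by simp_all
        have iD: "integrable M ?D" using i by simp
        have \<mu>D: "\<mu> B' e - \<mu> B e = expectation ?D" unfolding \<mu>_def using i by simp
        show "expectation (V e) = 0" unfolding V_def \<mu>D using iD by (simp add: prob_space)
        have absD: "\<bar>?D \<omega>\<bar> \<le> B'" for \<omega> using B B' by (auto simp: trunc_def)
        have "\<bar>expectation ?D\<bar> \<le> B'" by (rule abs_\<mu>[OF absD iD])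
        then show "\<bar>V e \<omega>\<bar> \<le> 2 * real m powr (1 / 3)" for \<omega>
          using absD[of \<omega>] unfolding V_def \<mu>D B'_def[symmetric] by linarith
        have iD2: "integrable M (\<lambda>\<omega>. (?D \<omega>)\<^sup>2)"
        proof (rule integrable_const_bound[of _ "B'\<^sup>2"])
          show "AE \<omega> in M. norm ((?D \<omega>)\<^sup>2) \<le> B'\<^sup>2"
            by (intro AE_I2) (simp add: abs_le_square_iff[symmetric] order_trans[OF absD abs_ge_self])
        qed measurable
        have "expectation (\<lambda>\<omega>. (V e \<omega>)\<^sup>2) = variance ?D" unfolding V_def \<mu>D ..
        also have "\<dots> \<le> expectation (\<lambda>\<omega>. (?D \<omega>)\<^sup>2)" using variance_eq[OF iD iD2] by simp
        also have "\<dots> \<le> expectation (\<lambda>\<omega>. if \<bar>Z e \<omega>\<bar> \<le> B then 0 else \<bar>Z e \<omega>\<bar> ^ 2)"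
          using tail_moment_le(1)[OF std[OF e], of B 2] B B'(1) p
          by (intro integral_mono iD2) (auto simp: trunc_def)
        also have "\<dots> \<le> C * B powr (2 - p)" using tail_moment_le(2)[OF std[OF e], of B 2] B p by simp
        finally show "expectation (\<lambda>\<omega>. (V e \<omega>)\<^sup>2) \<le> S" using CB by linarith
      qed
      have WW: "whp (\<gamma> / 3) (\<lambda>\<omega>. \<forall>e\<in>upper_pairs m. \<bar>Z e \<omega>\<bar> \<le> B')"
      proof (rule whp_mono[OF whp_ball])
        fix e assume e: "e \<in> upper_pairs m"
        note [measurable] = rv[OF e]
        show "whp (C * B' powr (- p)) (\<lambda>\<omega>. \<bar>Z e \<omega>\<bar> \<le> B')"
        proof (rule whp_event)
          show X: "{\<omega> \<in> space M. \<not> \<bar>Z e \<omega>\<bar> \<le> B'} \<in> events" by measurable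
          have "expectation (indicator {\<omega> \<in> space M. \<not> \<bar>Z e \<omega>\<bar> \<le> B'}) = expectation (\<lambda>\<omega>. if \<bar>Z e \<omega>\<bar> \<le> B' then 0 else \<bar>Z e \<omega>\<bar> ^ 0)"
            by (rule Bochner_Integration.integral_cong) (auto simp: indicator_def)
          then have "prob {\<omega> \<in> space M. \<not> \<bar>Z e \<omega>\<bar> \<le> B'} = expectation (\<lambda>\<omega>. if \<bar>Z e \<omega>\<bar> \<le> B' then 0 else \<bar>Z e \<omega>\<bar> ^ 0)"
            using X by simp
          also have "\<dots> \<le> C * B' powr (real 0 - p)"
            by (rule tail_moment_le(2)[OF std[OF e] B'(3)]) (use p in simp)
          finally show "prob {\<omega> \<in> space M. \<not> \<bar>Z e \<omega>\<bar> \<le> B'} \<le> C * B' powr (- p)" by simp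
        qed
      next
        have "(\<Sum>e\<in>upper_pairs m. C * B' powr (- p)) = real (card (upper_pairs m)) * (C * B' powr (- p))" by simp
        also have "\<dots> \<le> real (m * m) * (C * B' powr (- p))"
          using C by (intro mult_right_mono of_nat_mono card_upper_pairs_le) simp
        also have "\<dots> = C * (real m powr 2 * real m powr (- p / 3))"
          using m by (simp add: B'_def powr_powr power2_eq_square flip: powr_realpow)
        also have "\<dots> = C * real m powr (- d)"
          unfolding powr_add[symmetric] d_def by (rule arg_cong[of _ _ "\<lambda>x. C * real m powr x"]) simp
        also have "\<dots> \<le> \<gamma> / 3" using elim(3) by simp
        finally show "(\<Sum>e\<in>upper_pairs m. C * B' powr (- p)) \<le> \<gamma> / 3" .
      qed auto
      \<comment> \<open>All m^2 entries are at most C m^(-5/3), so even the sum of absolute values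
        is of order m^(1/3), far below T.\<close>
      have bias: "\<bar>qform m (sym_ext (\<mu> B')) v\<bar> \<le> \<delta> / 3 * sqrt (m * ln m) * norm2 m v" for v
      proof -
        have \<mu>le: "\<bar>\<mu> B' e\<bar> \<le> C * B' powr (-5)" if e: "e \<in> upper_pairs m" for e
        proof -
          have "\<bar>\<mu> B' e\<bar> \<le> C * B' powr (1 - p)"
            unfolding \<mu>_def by (rule trunc_moments(1)[OF std[OF e] _ B'(3)]) (use p in simp)
          also have "\<dots> \<le> C * B' powr (-5)" using C p B' by (intro mult_left_mono powr_mono) auto
          finally show ?thesis .
        qed
        have "(\<Sum>i<m. \<Sum>j<m. \<bar>sym_ext (\<mu> B') i j\<bar>) \<le> (\<Sum>i<m. \<Sum>j<m. C * B' powr (-5))"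
          using \<mu>le C by (intro sum_mono) (auto simp: sym_ext_def upper_pairs_def)
        also have "\<dots> = (real m)\<^sup>2 * (C * B' powr (-5))" by (simp add: power2_eq_square)
        also have "\<dots> \<le> \<delta> / 3 * sqrt (m * ln m)" using elim(4) by (simp only: B'_def)
        finally have "(\<Sum>i<m. \<Sum>j<m. \<bar>sym_ext (\<mu> B') i j\<bar>) * norm2 m v \<le> \<delta> / 3 * sqrt (m * ln m) * norm2 m v"
          by (rule mult_right_mono) simp
        then show ?thesis using abs_qform_le[of m "sym_ext (\<mu> B')" v] by linarith
      qed
      show "whp \<gamma> (\<lambda>\<omega>. (\<forall>e\<in>upper_pairs m. \<bar>Z e \<omega>\<bar> \<le> m powr (1 / 3)) \<and>
          (form_le m (\<lambda>e. Z e \<omega>) (\<delta> * sqrt (m * ln m))))"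
      proof (rule whp_mono[OF whp_conj[OF WW whp_conj[OF WU WV]]])
        show "\<gamma> / 3 + (\<gamma> / 3 + \<gamma> / 3) \<le> \<gamma>" by simp
        fix \<omega>
        assume *: "(\<forall>e\<in>upper_pairs m. \<bar>Z e \<omega>\<bar> \<le> B') \<and>
          (form_le m (\<lambda>e. U e \<omega>) (\<delta> / 3 * sqrt (m * ln m))) \<and>
          (form_le m (\<lambda>e. V e \<omega>) (\<delta> / 3 * sqrt (m * ln m)))"
        have "\<bar>qform m (sym_ext (\<lambda>e. Z e \<omega>)) v\<bar> \<le> \<delta> * sqrt (m * ln m) * norm2 m v" for v
        proof -
          have "Z e \<omega> = U e \<omega> + V e \<omega> + \<mu> B' e" if "e \<in> upper_pairs m" for e
            using * that by (simp add: U_def V_def trunc_def)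
          then have "qform m (sym_ext (\<lambda>e. Z e \<omega>)) v = qform m (sym_ext (\<lambda>e. U e \<omega>)) v + qform m (sym_ext (\<lambda>e. V e \<omega>)) v
              + qform m (sym_ext (\<mu> B')) v"
            unfolding qform_sym_ext sum.distrib[symmetric] by (intro sum.cong) (auto simp: algebra_simps)
          moreover have "\<delta> * sqrt (m * ln m) * norm2 m v = 3 * (\<delta> / 3 * sqrt (m * ln m) * norm2 m v)" by simp
          ultimately show ?thesis using * bias[of v] by (smt (verit))
        qed
        then show "(\<forall>e\<in>upper_pairs m. \<bar>Z e \<omega>\<bar> \<le> m powr (1 / 3)) \<and>
          (form_le m (\<lambda>e. Z e \<omega>) (\<delta> * sqrt (m * ln m)))"
          using * unfolding B'_def by blast
      qed
    qed
  qed
qed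

text \<open>The upper bound adds the largest degree and the norm of the off-diagonal part. The lower
  bound is immediate from a diagonal entry, which is a degree. When no entry exceeds the truncation
  level, the truncated degrees are the true ones.\<close>

lemma whp_lambda_max_laplacian:
  assumes p: "p > 6" and C: "C > 0" and \<epsilon>: "\<epsilon> > 0" and \<gamma>: "\<gamma> > 0"
  shows "\<forall>\<^sub>F m in sequentially. \<forall>A. (\<forall>\<omega>\<in>space M. A \<omega> \<in> carrier_mat m m \<and> transpose_mat (A \<omega>) = A \<omega>) \<longrightarrow>
    std_array C p m (\<lambda>e \<omega>. A \<omega> $$ e) \<longrightarrow>
    whp \<gamma> (\<lambda>\<omega>. \<bar>lambda_max (laplacian (A \<omega>)) / sqrt (m * ln m) - sqrt 2\<bar> \<le> \<epsilon>)"
proof -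
  \<comment> \<open>The cap 1/10 is the range of \<open>whp_degrees_lower\<close>; the division by 6
    compensates for its loss 6 \<epsilon>'.\<close>
  define \<epsilon>' where "\<epsilon>' = min (\<epsilon> / 6) (1 / 10)"
  have \<epsilon>': "0 < \<epsilon>'" "\<epsilon>' \<le> 1 / 10" "6 * \<epsilon>' \<le> \<epsilon>" using \<epsilon> by (auto simp: \<epsilon>'_def)
  have pos: "\<epsilon> / 2 > 0" "\<gamma> / 3 > 0" using \<epsilon> \<gamma> by auto
  note whp_qform_std_array[OF p C pos] whp_degrees_upper[OF p C pos] whp_degrees_lower[OF p C \<epsilon>'(1,2) pos(2)]
  moreover have "\<forall>\<^sub>F m :: nat in sequentially. m \<ge> 2" by (rule eventually_ge_at_top)
  ultimately show ?thesis
  proof eventually_elim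
    case (elim m)
    let ?B = "real m powr (1 / 3)"
    define T where "T = sqrt (m * ln m)"
    have T: "T > 0" using elim(4) by (simp add: T_def)
    have m: "m > 0" using elim(4) by simp
    show ?case
    proof (intro allI impI)
      fix A :: "'a \<Rightarrow> real mat"
      assume A: "\<forall>\<omega>\<in>space M. A \<omega> \<in> carrier_mat m m \<and> transpose_mat (A \<omega>) = A \<omega>"
        and Z: "std_array C p m (\<lambda>e \<omega>. A \<omega> $$ e)"
      note W = whp_conj[OF elim(1)[rule_format, OF Z] whp_conj[OF elim(2)[rule_format, OF Z] elim(3)[rule_format, OF Z]]]
      show "whp \<gamma> (\<lambda>\<omega>. \<bar>lambda_max (laplacian (A \<omega>)) / sqrt (m * ln m) - sqrt 2\<bar> \<le> \<epsilon>)"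
      proof (rule whp_mono[OF W])
        show "\<gamma> / 3 + (\<gamma> / 3 + \<gamma> / 3) \<le> \<gamma>" by simp
        fix \<omega> assume \<omega>: "\<omega> \<in> space M"
        let ?z = "\<lambda>e. A \<omega> $$ e"
        let ?d = "\<lambda>i. \<Sum>e\<in>star m i. ?z e"
        let ?L = "laplacian (A \<omega>)"
        assume *: "((\<forall>e\<in>upper_pairs m. \<bar>?z e\<bar> \<le> ?B) \<and>
            (\<forall>v. \<bar>qform m (sym_ext ?z) v\<bar> \<le> \<epsilon> / 2 * sqrt (m * ln m) * norm2 m v)) \<and>
          (\<forall>i<m. (\<Sum>e\<in>star m i. trunc ?B (?z e)) \<le> (sqrt 2 + \<epsilon> / 2) * sqrt (m * ln m)) \<and>
          (\<exists>i<m. (sqrt 2 - 6 * \<epsilon>') * sqrt (m * ln m) \<le> (\<Sum>e\<in>star m i. trunc ?B (?z e)))"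
        have tr: "(\<Sum>e\<in>star m i. trunc ?B (?z e)) = ?d i" for i
        proof (rule sum.cong[OF refl])
          fix e assume "e \<in> star m i"
          then have "\<bar>?z e\<bar> \<le> ?B" using * star_subset by blast
          then show "trunc ?B (?z e) = ?z e" by (simp add: trunc_def)
        qed
        have q: "\<bar>qform m (sym_ext ?z) v\<bar> \<le> \<epsilon> / 2 * T * norm2 m v" for v using * unfolding T_def by blast
        have d: "?d i \<le> (sqrt 2 + \<epsilon> / 2) * T" if "i < m" for i using * that unfolding tr T_def by blast
        obtain i0 where i0: "i0 < m" "(sqrt 2 - 6 * \<epsilon>') * T \<le> ?d i0" using * unfolding tr T_def by blast
        have AM: "A \<omega> \<in> carrier_mat m m" and At: "transpose_mat (A \<omega>) = A \<omega>" using A \<omega> by blast+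
        have sym: "A \<omega> $$ (i, j) = A \<omega> $$ (j, i)" if "i < m" "j < m" for i j
          using that AM At by (metis carrier_matD index_transpose_mat(1))
        have ext: "A \<omega> $$ (i, j) = sym_ext ?z i j" if "i < m" "j < m" "i \<noteq> j" for i j
          using that sym[of i j] by (auto simp: sym_ext_def)
        have LM: "?L \<in> carrier_mat m m" using AM by simp
        have Lij: "?L $$ (i, j) = (if i = j then ?d i else 0) + - sym_ext ?z i j" if "i < m" "j < m" for i j
        proof (cases "i = j")
          case True
          have "(\<Sum>l\<in>{..<m} - {i}. A \<omega> $$ (i, l)) = (\<Sum>l\<in>{..<m} - {i}. sym_ext ?z i l)"
            using that by (intro sum.cong refl ext) auto
          also have "\<dots> = ?d i" by (rule sum_star[OF that(1)])
          finally show ?thesis using True that by (simp add: laplacian_index[OF AM] sym_ext_def)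
        next
          case False
          then show ?thesis using that ext by (simp add: laplacian_index[OF AM])
        qed
        have Lsym: "?L $$ (i, j) = ?L $$ (j, i)" if "i < m" "j < m" for i j
          using that sym_ext_commute[of ?z i j] by (simp add: Lij)
        have qL: "qform m (\<lambda>i j. ?L $$ (i, j)) v = (\<Sum>i<m. ?d i * (v i)\<^sup>2) - qform m (sym_ext ?z) v" for v
        proof -
          have "qform m (\<lambda>i j. ?L $$ (i, j)) v = (\<Sum>i<m. (\<Sum>j<m. if j = i then ?d i * (v i)\<^sup>2 else 0) - (\<Sum>j<m. sym_ext ?z i j * v i * v j))"
            unfolding bform_def sum_subtractf[symmetric]
            by (intro sum.cong refl) (auto simp: Lij power2_eq_square algebra_simps)
          then show ?thesis by (simp add: sum_subtractf bform_def)
        qed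
        have "\<forall>v. qform m (\<lambda>i j. ?L $$ (i, j)) v \<le> (sqrt 2 + \<epsilon>) * T * norm2 m v"
        proof
          fix v
          have "(\<Sum>i<m. ?d i * (v i)\<^sup>2) \<le> (\<Sum>i<m. (sqrt 2 + \<epsilon> / 2) * T * (v i)\<^sup>2)"
            using d by (intro sum_mono mult_right_mono) auto
          also have "\<dots> = (sqrt 2 + \<epsilon> / 2) * T * norm2 m v" by (simp add: norm2_def sum_distrib_left)
          finally have "qform m (\<lambda>i j. ?L $$ (i, j)) v \<le> (sqrt 2 + \<epsilon> / 2) * T * norm2 m v + \<epsilon> / 2 * T * norm2 m v"
            using q[of v] unfolding qL by linarith
          then show "qform m (\<lambda>i j. ?L $$ (i, j)) v \<le> (sqrt 2 + \<epsilon>) * T * norm2 m v"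
            by (simp add: algebra_simps)
        qed
        then have "lambda_max ?L \<le> (sqrt 2 + \<epsilon>) * T" using lambda_max_le_iff[OF LM m Lsym] by blast
        moreover have "(sqrt 2 - \<epsilon>) * T \<le> lambda_max ?L"
        proof -
          have "(sqrt 2 - \<epsilon>) * T \<le> (sqrt 2 - 6 * \<epsilon>') * T" using \<epsilon>' T by (intro mult_right_mono) auto
          also have "\<dots> \<le> ?L $$ (i0, i0)" using i0 by (simp add: Lij sym_ext_def)
          also have "\<dots> \<le> lambda_max ?L" by (rule diag_le_lambda_max[OF LM i0(1) Lsym])
          finally show ?thesis .
        qed
        ultimately have "sqrt 2 - \<epsilon> \<le> lambda_max ?L / T" "lambda_max ?L / T \<le> sqrt 2 + \<epsilon>"
          using T by (simp_all add: pos_le_divide_eq pos_divide_le_eq)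
        then show "\<bar>lambda_max ?L / sqrt (m * ln m) - sqrt 2\<bar> \<le> \<epsilon>"
          unfolding T_def[symmetric] by (simp add: abs_le_iff)
      qed
    qed
  qed
qed

text \<open>A finite extended integral yields integrability, so the uniform moment bound can be
  carried over to Bochner integrals.\<close>

lemma std_moments_of_nn_integral:
  assumes Y: "random_variable borel Y" and p: "p > 2" and E: "expectation Y = 0" and V: "variance Y = 1"
    and nn: "(\<integral>\<^sup>+ \<omega>. ennreal (\<bar>Y \<omega>\<bar> powr p) \<partial>M) \<le> ennreal C" and C: "0 \<le> C"
  shows "std_moments C p Y"
proof -
  note [measurable] = Y
  have int: "integrable M (\<lambda>\<omega>. \<bar>Y \<omega>\<bar> powr p)"
    by (rule integrableI_bounded) (use nn in \<open>auto intro: le_less_trans\<close>)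
  have "ennreal (expectation (\<lambda>\<omega>. \<bar>Y \<omega>\<bar> powr p)) = (\<integral>\<^sup>+ \<omega>. ennreal (\<bar>Y \<omega>\<bar> powr p) \<partial>M)"
    by (rule nn_integral_eq_integral[OF int, symmetric]) simp
  then have "ennreal (expectation (\<lambda>\<omega>. \<bar>Y \<omega>\<bar> powr p)) \<le> ennreal C" using nn by (simp only:)
  then have "expectation (\<lambda>\<omega>. \<bar>Y \<omega>\<bar> powr p) \<le> C" unfolding ennreal_le_iff[OF C] .
  then show ?thesis using int E V Y by (simp add: std_moments_def)
qed

end

section \<open>Assembling the blocks\<close>

theorem proposition2:
  fixes M :: "'a measure"
    and k :: nat
    and N :: "nat set"
    and p :: real
    and X :: "nat \<Rightarrow> nat \<Rightarrow> 'a \<Rightarrow> real mat"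
    and L :: "nat \<Rightarrow> 'a \<Rightarrow> real mat"
  assumes "prob_space M"
    and "k \<ge> 1"
    and N_def: "N = {n. k dvd n \<and> n div k \<ge> 2}"
    and "\<And>n r. n \<in> N \<Longrightarrow> r < k \<Longrightarrow> X n r \<in> measurable M (mat_borel (n div k))"
    and "\<And>n r \<omega>. n \<in> N \<Longrightarrow> r < k \<Longrightarrow> \<omega> \<in> space M \<Longrightarrow> transpose_mat (X n r \<omega>) = X n r \<omega>"
    and "\<And>n. n \<in> N \<Longrightarrow>
      prob_space.indep_vars M (\<lambda>_. mat_borel (n div k)) (\<lambda>r \<omega>. laplacian (X n r \<omega>)) {..<k}"
    and "\<And>n r. n \<in> N \<Longrightarrow> r < k \<Longrightarrow>
      prob_space.indep_vars M (\<lambda>_. borel) (\<lambda>ij \<omega>. X n r \<omega> $$ ij) {(i, j). i < j \<and> j < n div k}"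
    and "\<And>n r i j. n \<in> N \<Longrightarrow> r < k \<Longrightarrow> i < j \<Longrightarrow> j < n div k \<Longrightarrow>
      prob_space.expectation M (\<lambda>\<omega>. X n r \<omega> $$ (i, j)) = 0"
    and "\<And>n r i j. n \<in> N \<Longrightarrow> r < k \<Longrightarrow> i < j \<Longrightarrow> j < n div k \<Longrightarrow>
      prob_space.variance M (\<lambda>\<omega>. X n r \<omega> $$ (i, j)) = 1"
    and "p > 6"
    and "(SUP (n, r, i, j) \<in> {(n, r, i, j). n \<in> N \<and> r < k \<and> i < j \<and> j < n div k}.
      \<integral>\<^sup>+ \<omega>. ennreal (\<bar>X n r \<omega> $$ (i, j)\<bar> powr p) \<partial>M) < \<infinity>"
    and "\<And>n \<omega>. n \<in> N \<Longrightarrow> \<omega> \<in> space M \<Longrightarrow>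
      L n \<omega> = diag_block_mat (map (\<lambda>r. laplacian (X n r \<omega>)) [0..<k])"
  shows "converges_in_prob M (\<lambda>n \<omega>. lambda_max (L n \<omega>) / sqrt (real n * ln (real n)))
    (sqrt (2 / real k)) (at_top \<sqinter> principal N)"
proof -
  interpret prob_space M by fact
  let ?far = "\<lambda>\<epsilon> n. {\<omega> \<in> space M. \<bar>lambda_max (L n \<omega>) / sqrt (real n * ln (real n)) - sqrt (2 / real k)\<bar> > \<epsilon>}"
  note k = assms(2) and meas = assms(4) and sym = assms(5) and ind = assms(7) and mean = assms(8)
    and var = assms(9) and p = assms(10) and sup = assms(11) and L = assms(12)
  let ?I = "{(n, r, i, j). n \<in> N \<and> r < k \<and> i < j \<and> j < n div k}"
  let ?f = "\<lambda>(n, r, i, j). \<integral>\<^sup>+ \<omega>. ennreal (\<bar>X n r \<omega> $$ (i, j)\<bar> powr p) \<partial>M"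
  \<comment> \<open>The supremum is finite, so it survives \<open>enn2real\<close>; adding 1 makes
    the constant positive.\<close>
  define C where "C = enn2real (SUP x\<in>?I. ?f x) + 1"
  have C: "C > 0" by (simp add: C_def add_nonneg_pos)
  have carr: "X n r \<omega> \<in> carrier_mat (n div k) (n div k)" if "n \<in> N" "r < k" "\<omega> \<in> space M" for n r \<omega>
    using meas[OF that(1,2)] that(3) unfolding measurable_mat_borel_iff by blast
  have rv: "random_variable borel (\<lambda>\<omega>. X n r \<omega> $$ (i, j))" if "n \<in> N" "r < k" "i < n div k" "j < n div k" for n r i j
    using meas[OF that(1,2)] that(3,4) unfolding measurable_mat_borel_iff by blast
  have arr: "std_array C p (n div k) (\<lambda>e \<omega>. X n r \<omega> $$ e)" if n: "n \<in> N" and r: "r < k" for n r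
    unfolding std_array_def
  proof (intro conjI ballI)
    show "indep_vars (\<lambda>_. borel) (\<lambda>e \<omega>. X n r \<omega> $$ e) (upper_pairs (n div k))"
      using ind[OF n r] by (simp add: upper_pairs_def)
    fix e assume "e \<in> upper_pairs (n div k)"
    then obtain i j where e: "e = (i, j)" "i < j" "j < n div k" by (auto simp: upper_pairs_def)
    have "?f (n, r, i, j) \<le> (SUP x\<in>?I. ?f x)" by (rule SUP_upper) (use n r e in simp)
    also have "\<dots> = ennreal (enn2real (SUP x\<in>?I. ?f x))" using sup by (intro ennreal_enn2real[symmetric]) simp
    also have "\<dots> \<le> ennreal C" by (rule ennreal_leI) (simp add: C_def)
    finally have nn: "(\<integral>\<^sup>+ \<omega>. ennreal (\<bar>X n r \<omega> $$ e\<bar> powr p) \<partial>M) \<le> ennreal C" by (simp add: e(1))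
    show "std_moments C p (\<lambda>\<omega>. X n r \<omega> $$ e)"
    proof (rule std_moments_of_nn_integral[OF _ _ _ _ nn less_imp_le[OF C]])
      show "random_variable borel (\<lambda>\<omega>. X n r \<omega> $$ e)" unfolding e(1) by (rule rv[OF n r]) (use e in auto)
      show "expectation (\<lambda>\<omega>. X n r \<omega> $$ e) = 0" unfolding e(1) by (rule mean[OF n r e(2,3)])
      show "variance (\<lambda>\<omega>. X n r \<omega> $$ e) = 1" unfolding e(1) by (rule var[OF n r e(2,3)])
    qed (use p in simp)
  qed
  define \<Lambda> where "\<Lambda> = (\<lambda>n r \<omega>. lambda_max (laplacian (X n r \<omega>)))"
  have lapl: "laplacian (X n r \<omega>) \<in> carrier_mat (n div k) (n div k)"
      "\<And>i j. i < n div k \<Longrightarrow> j < n div k \<Longrightarrow> laplacian (X n r \<omega>) $$ (i, j) = laplacian (X n r \<omega>) $$ (j, i)"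
    if n: "n \<in> N" and r: "r < k" and \<omega>: "\<omega> \<in> space M" for n r \<omega>
  proof -
    note c = carr[OF n r \<omega>]
    show "laplacian (X n r \<omega>) \<in> carrier_mat (n div k) (n div k)" by (rule laplacian_carrier[OF c])
    fix i j assume ij: "i < n div k" "j < n div k"
    have "X n r \<omega> $$ (i, j) = X n r \<omega> $$ (j, i)"
      using ij c sym[OF n r \<omega>] by (metis carrier_matD index_transpose_mat(1))
    then show "laplacian (X n r \<omega>) $$ (i, j) = laplacian (X n r \<omega>) $$ (j, i)"
      using ij by (simp add: laplacian_index[OF c])
  qed
  have m: "n div k > 0" "n = k * (n div k)" if "n \<in> N" for n using that by (auto simp: N_def)
  have lam: "lambda_max (L n \<omega>) = Max ((\<lambda>r. \<Lambda> n r \<omega>) ` {..<k})" if n: "n \<in> N" and \<omega>: "\<omega> \<in> space M" for n \<omega>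
    unfolding L[OF n \<omega>] \<Lambda>_def
    by (rule lambda_max_diag_block_mat) (use lapl[OF n _ \<omega>] m[OF n] k in auto)
  have rv\<Lambda>: "random_variable borel (\<Lambda> n r)" if n: "n \<in> N" and r: "r < k" for n r
    unfolding \<Lambda>_def
  proof (rule borel_measurable_lambda_max[OF lapl(1)[OF n r] m(1)[OF n] lapl(2)[OF n r]])
    fix i j assume ij: "i < n div k" "j < n div k"
    have "random_variable borel (\<lambda>\<omega>. if i = j then \<Sum>l\<in>{..<n div k} - {i}. X n r \<omega> $$ (i, l) else - X n r \<omega> $$ (i, j))"
    proof (cases "i = j")
      case True
      then show ?thesis using ij by (auto intro!: borel_measurable_sum rv[OF n r])
    next
      case False
      then show ?thesis using rv[OF n r ij] by simp
    qed
    also have "?this \<longleftrightarrow> random_variable borel (\<lambda>\<omega>. laplacian (X n r \<omega>) $$ (i, j))"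
      by (rule measurable_cong) (rule laplacian_index[OF carr[OF n r] ij, symmetric])
    finally show "random_variable borel (\<lambda>\<omega>. laplacian (X n r \<omega>) $$ (i, j))" .
  qed
  have rvY: "random_variable borel (\<lambda>\<omega>. lambda_max (L n \<omega>) / sqrt (real n * ln (real n)))" if n: "n \<in> N" for n
  proof -
    have "random_variable borel (\<lambda>\<omega>. Max ((\<lambda>r. \<Lambda> n r \<omega>) ` {..<k}))"
      by (intro borel_measurable_Max) (use rv\<Lambda>[OF n] in auto)
    also have "?this \<longleftrightarrow> random_variable borel (\<lambda>\<omega>. lambda_max (L n \<omega>))"
      by (rule measurable_cong) (rule lam[OF n, symmetric])
    finally show ?thesis by simp
  qed
  have main: "\<forall>\<^sub>F n in at_top. n \<in> N \<longrightarrow>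
      prob (?far \<epsilon> n) \<le> \<gamma>"
    if \<epsilon>: "\<epsilon> > 0" and \<gamma>: "\<gamma> > 0" for \<epsilon> \<gamma>
  proof -
    have pos: "\<epsilon> / 2 > 0" "\<gamma> / k > 0" "\<epsilon> / 4 > 0" "real k > 0" using \<epsilon> \<gamma> k by auto
    have "((\<lambda>m. sqrt (real m * ln (real m)) / sqrt (real k * real m * ln (real k * real m))) \<longlongrightarrow> inverse (real k powr (1 / 2))) sequentially"
      using pos(4) by real_asymp
    moreover have "inverse (real k powr (1 / 2)) = 1 / sqrt (real k)"
      by (simp add: powr_half_sqrt inverse_eq_divide)
    ultimately have lim: "((\<lambda>m. sqrt (real m * ln (real m)) / sqrt (real k * real m * ln (real k * real m))) \<longlongrightarrow> 1 / sqrt (real k)) sequentially"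
      by (simp only:)
    have "\<forall>\<^sub>F m in sequentially. \<bar>sqrt (real m * ln (real m)) / sqrt (real k * real m * ln (real k * real m)) - 1 / sqrt (real k)\<bar> < \<epsilon> / 4"
      using tendstoD[OF lim pos(3)] by (simp only: dist_real_def)
    with whp_lambda_max_laplacian[OF p C pos(1,2)] eventually_ge_at_top[of 2]
    \<comment> \<open>The one-block estimate is asymptotic in the block size m, so it is first
      stated for every n of block size m and then pulled back along n div k.\<close>
    have "\<forall>\<^sub>F m in sequentially. \<forall>n. n \<in> N \<longrightarrow> n div k = m \<longrightarrow>
      prob (?far \<epsilon> n) \<le> \<gamma>"
    proof eventually_elim
      case (elim m)
      show ?case
      proof (intro allI impI)
        fix n assume n: "n \<in> N" and nm: "n div k = m"
        define T where "T = sqrt (real m * ln (real m))"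
        define \<rho> where "\<rho> = T / sqrt (real n * ln (real n))"
        have n_eq: "real n = real k * real m" using m(2)[OF n] nm by (metis of_nat_mult)
        have \<rho>: "\<bar>\<rho> - 1 / sqrt (real k)\<bar> < \<epsilon> / 4" using elim(3) by (simp only: \<rho>_def T_def n_eq)
        have T: "T > 0" using elim(2) by (simp add: T_def)
        have mn: "real m \<le> real n" unfolding n_eq using k by (simp add: mult_le_cancel_right1)
        have \<rho>1: "0 \<le> \<rho>" "\<rho> \<le> 1"
        proof -
          have "T \<le> sqrt (real n * ln (real n))"
            unfolding T_def using mn elim(2) by (intro real_sqrt_le_mono mult_mono) auto
          moreover define D where "D = sqrt (real n * ln (real n))"
          ultimately have "0 < D" "T \<le> D" using T by linarith+
          then show "0 \<le> \<rho>" "\<rho> \<le> 1" using T unfolding \<rho>_def D_def[symmetric] by simp_all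
        qed
        have one: "whp (\<gamma> / k) (\<lambda>\<omega>. \<bar>\<Lambda> n r \<omega> / T - sqrt 2\<bar> \<le> \<epsilon> / 2)" if r: "r < k" for r
          using elim(1)[rule_format, of "X n r"] arr[OF n r] carr[OF n r] sym[OF n r] unfolding nm \<Lambda>_def T_def by blast
        have "whp (\<Sum>r\<in>{..<k}. \<gamma> / k) (\<lambda>\<omega>. \<forall>r\<in>{..<k}. \<bar>\<Lambda> n r \<omega> / T - sqrt 2\<bar> \<le> \<epsilon> / 2)"
          by (rule whp_ball) (use one in auto)
        then have W: "whp \<gamma> (\<lambda>\<omega>. \<forall>r\<in>{..<k}. \<bar>\<Lambda> n r \<omega> / T - sqrt 2\<bar> \<le> \<epsilon> / 2)"
          by (rule whp_mono) (use k in auto)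
        show "prob (?far \<epsilon> n) \<le> \<gamma>"
        proof (rule prob_le_of_whp[OF W])
          fix \<omega>
          assume "\<omega> \<in> ?far \<epsilon> n"
          then have \<omega>: "\<omega> \<in> space M" and far: "\<bar>lambda_max (L n \<omega>) / sqrt (real n * ln (real n)) - sqrt (2 / real k)\<bar> > \<epsilon>"
            by auto
          have "Max ((\<lambda>r. \<Lambda> n r \<omega>) ` {..<k}) \<in> (\<lambda>r. \<Lambda> n r \<omega>) ` {..<k}"
            using pos(4) by (intro Max_in) auto
          then obtain r where r: "r < k" "lambda_max (L n \<omega>) = \<Lambda> n r \<omega>" unfolding lam[OF n \<omega>] by auto
          have "\<not> \<bar>\<Lambda> n r \<omega> / T - sqrt 2\<bar> \<le> \<epsilon> / 2"
          proof
            assume near: "\<bar>\<Lambda> n r \<omega> / T - sqrt 2\<bar> \<le> \<epsilon> / 2"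
            \<comment> \<open>The maximum is attained at some block r. Its deviation splits into
              that of the block, scaled by \<rho> <= 1, and that of \<rho> from its limit 1 / sqrt
              k.\<close>
            have "lambda_max (L n \<omega>) / sqrt (real n * ln (real n)) - sqrt (2 / real k)
                = (\<Lambda> n r \<omega> / T - sqrt 2) * \<rho> + sqrt 2 * (\<rho> - 1 / sqrt (real k))"
              using T by (simp add: r(2) \<rho>_def real_sqrt_divide algebra_simps)
            also have "\<bar>\<dots>\<bar> \<le> \<bar>\<Lambda> n r \<omega> / T - sqrt 2\<bar> * \<bar>\<rho>\<bar> + sqrt 2 * \<bar>\<rho> - 1 / sqrt (real k)\<bar>"
              by (rule order_trans[OF abs_triangle_ineq]) (simp add: abs_mult)
            \<comment> \<open>The tolerance \<epsilon> / 4 for \<rho> was chosen so that sqrt 2 <= 2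
              suffices here.\<close>
            also have "\<dots> \<le> \<epsilon> / 2 * 1 + 2 * (\<epsilon> / 4)"
              using near \<rho> \<rho>1 \<epsilon> by (intro add_mono mult_mono) (auto intro: real_le_lsqrt)
            finally show False using far by simp
          qed
          then show "\<omega> \<in> space M \<and> \<not> (\<forall>r\<in>{..<k}. \<bar>\<Lambda> n r \<omega> / T - sqrt 2\<bar> \<le> \<epsilon> / 2)" using \<omega> r(1) by blast
        qed
      qed
    qed
    then have "\<forall>\<^sub>F n in at_top. \<forall>n'. n' \<in> N \<longrightarrow> n' div k = n div k \<longrightarrow>
      prob (?far \<epsilon> n') \<le> \<gamma>"
      by (rule eventually_compose_filterlim) (rule filterlim_at_top_div_const_nat, use k in simp)
    then show ?thesis by eventually_elim blast
  qed
  show ?thesis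
    unfolding converges_in_prob_def
  proof (intro conjI allI impI)
    show "\<forall>\<^sub>F n in at_top \<sqinter> principal N. random_variable borel (\<lambda>\<omega>. lambda_max (L n \<omega>) / sqrt (real n * ln (real n)))"
      unfolding eventually_inf_principal by (rule always_eventually) (use rvY in blast)
    fix \<epsilon> :: real assume \<epsilon>: "\<epsilon> > 0"
    show "((\<lambda>n. prob (?far \<epsilon> n)) \<longlongrightarrow> 0)
        (at_top \<sqinter> principal N)"
    proof (rule tendstoI)
      fix e :: real assume e: "e > 0"
      \<comment> \<open>Halving turns the bound from \<open>main\<close> into the strict inequality
        of the limit.\<close>
      then have "e / 2 > 0" by simp
      from main[OF \<epsilon> this]
      show "\<forall>\<^sub>F n in at_top \<sqinter> principal N. dist (prob (?far \<epsilon> n)) 0 < e"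
        unfolding eventually_inf_principal by eventually_elim (use e in \<open>auto simp: dist_real_def\<close>)
    qed
  qed
qed

end
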